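(* Let $n\ge 3$ and let $F:M^n\to\mathbb{A}^{n+1}$ be a connected, strictly locally convex affine hypersurface with a pointwise $SO(n-1)$ symmetry whose function $r$ (see context) vanishes nowhere. Let $a,b,r,\sigma$ be the associated functions and $\zeta=b-r^2+\sigma^2$. Then, locally around each point and in suitable local coordinates $(t,\vec u)$ on $M$, with $t$ in an open interval and $\vec u=(u_2,\dots,u_n)$ in an open subset of $\mathbb{R}^{n-1}$, the immersion $F$ is affine congruent to one of the following, for some smooth functions $\gamma_1,\gamma_2$ of $t$: 1. When $\zeta\neq 0$: $F(t,\vec u)=\left(\gamma_1(t)\phi(\vec u),\gamma_2(t)\right)$, where $\phi$ is the immersion of an $\epsilon$-quadric in a hyperplane (identified with $\mathbb{R}^n$), with $\epsilon\neq 0$. 2. When $\zeta=0$ and $\sigma\neq r$: $F(t,\vec u)=\left(\gamma_1(t)\vec u,\ \gamma_1(t)\frac{\|\vec u\|^2}{2}+\gamma_2(t),\ \gamma_1(t)\right)$. 3. When $\zeta=\sigma-r=0$: $F(t,\vec u)=\left(\vec u,\ \frac{\|\vec u\|^2}{2}+\gamma_2(t),\ \gamma_1(t)\right)$.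
   Context: $\mathbb{A}^{n+1}$ is $\mathbb{R}^{n+1}$ with its flat connection $D$ and the determinant as volume form. For an immersed hypersurface with transversal vector field $\xi$ write $D_XY=\nabla_XY+h(X,Y)\xi$, $D_X\xi=-SX+\tau(X)\xi$, and $\omega(X_1,\dots,X_n)=\det(X_1,\dots,X_n,\xi)$. If $h$ is non-degenerate, the affine normal is the transversal field $\xi$, unique up to sign, with $\nabla\omega=0$ (equivalently $\tau=0$) and $\omega(X_1,\dots,X_n)^2=|\det(h(X_i,X_j))|$ for tangent frames. The hypersurface is strictly locally convex when $h$ is definite, and the sign of $\xi$ is then chosen so that $h$ is positive definite. With this $\xi$, $h$ is the affine metric, $S$ the shape operator, $\nabla$ the Blaschke connection, $\hat\nabla$ the Levi-Civita connection of $h$, and $K_XY=K(X,Y)=\nabla_XY-\hat\nabla_XY$ the difference tensor. Pointwise $SO(n-1)$ symmetry: at every $p\in M$ there is an $h$-unit vector $X_1\in T_pM$ such that every linear $g:T_pM\to T_pM$ with $gX_1=X_1$ which restricts to an element of $SO(\langle X_1\rangle^\perp)$ satisfies $S(gX)=gS(X)$ and $K(gX,gY)=gK(X,Y)$ for all $X,Y\in T_pM$. Associated functions: there is a local smooth $h$-orthonormal frame $X_1,\dots,X_n$ with $SX_1=aX_1$, $SX_i=bX_i$, $K(X_1,X_1)=(n-1)rX_1$, $K(X_1,X_i)=-rX_i$, $K(X_i,X_j)=-r\delta_{ij}X_1$ for $i,j\ge 2$, where $a,b,r$ are smooth functions. It is a standing assumption that $r$ vanishes nowhere, and the sign of $X_1$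 is chosen so that $r>0$. The function $\sigma$ is determined by $\hat\nabla_{X_i}X_1=\sigma X_i$ for $i\ge 2$. The function $\zeta$ vanishes either everywhere or nowhere, and if $\zeta=0$ then $\sigma-r$ vanishes either everywhere or nowhere. $\epsilon$-quadrics are the convex quadratic hypersurfaces of affine mean curvature $\epsilon\in\{-1,0,1\}$. For $\epsilon\ne0$, an $\epsilon$-quadric in $\mathbb{R}^n$ is taken centred at the origin: up to an equi-affine linear transformation it is an open part of the unit sphere ($\epsilon=1$), or of one sheet of $x_1^2+\dots+x_{n-1}^2-x_n^2=-1$ ($\epsilon=-1$). Affine congruent means equal up to an affine transformation of $\mathbb{A}^{n+1}$. *)

theory Defs
  imports "HOL-Analysis.Analysis"
begin

section \<open>Smooth maps\<close>

abbreviation D :: "('a::real_normed_vector \<Rightarrow> 'b::real_normed_vector) \<Rightarrow> 'a \<Rightarrow> 'a \<Rightarrow> 'b"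
  where "D f y v \<equiv> frechet_derivative f (at y) v"

fun Ck_on :: "nat \<Rightarrow> ('a::real_normed_vector \<Rightarrow> 'b::real_normed_vector) \<Rightarrow> 'a set \<Rightarrow> bool" where
  "Ck_on 0 f V \<longleftrightarrow> continuous_on V f"
| "Ck_on (Suc k) f V \<longleftrightarrow> f differentiable_on V \<and> (\<forall>v. Ck_on k (\<lambda>y. D f y v) V)"

text \<open>This is only meant for open \<open>V\<close> (and finite-dimensional domains).\<close>
definition smooth_on :: "'a::real_normed_vector set \<Rightarrow> ('a \<Rightarrow> 'b::real_normed_vector) \<Rightarrow> bool"
  where "smooth_on V f \<longleftrightarrow> (\<forall>k. Ck_on k f V)"

section \<open>Smooth manifolds\<close>

text \<open>A chart is a pair of its domain and its coordinate map; the values of the coordinate map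
  outside the domain are irrelevant.\<close>
type_synonym ('m, 'n) chart = "'m set \<times> ('m \<Rightarrow> real ^ 'n)"

definition chart_image :: "('m, 'n) chart \<Rightarrow> (real ^ 'n) set"
  where "chart_image c = snd c ` fst c"

definition param :: "('m, 'n) chart \<Rightarrow> real ^ 'n \<Rightarrow> 'm"
  where "param c = inv_into (fst c) (snd c)"

definition is_chart :: "'m topology \<Rightarrow> ('m, 'n::finite) chart \<Rightarrow> bool"
  where "is_chart X c \<longleftrightarrow> openin X (fst c) \<and> open (chart_image c) \<and>
    homeomorphic_map (subtopology X (fst c)) (top_of_set (chart_image c)) (snd c)"

definition compatible :: "('m, 'n::finite) chart \<Rightarrow> ('m, 'n) chart \<Rightarrow> bool"
  where "compatible c c' \<longleftrightarrow>
    smooth_on (snd c ` (fst c \<inter> fst c')) (snd c' \<circ> param c) \<and>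
    smooth_on (snd c' ` (fst c \<inter> fst c')) (snd c \<circ> param c')"

definition smooth_manifold :: "'m topology \<Rightarrow> ('m, 'n::finite) chart set \<Rightarrow> bool"
  where "smooth_manifold X A \<longleftrightarrow> Hausdorff_space X \<and> second_countable X \<and>
    (\<forall>c\<in>A. is_chart X c) \<and> (\<Union>c\<in>A. fst c) = topspace X \<and> (\<forall>c\<in>A. \<forall>c'\<in>A. compatible c c')"

definition maximal_atlas :: "'m topology \<Rightarrow> ('m, 'n::finite) chart set \<Rightarrow> ('m, 'n) chart set"
  where "maximal_atlas X A = {c. is_chart X c \<and> (\<forall>c'\<in>A. compatible c c')}"

definition smooth_map :: "('m, 'n::finite) chart set \<Rightarrow> ('m \<Rightarrow> 'b::real_normed_vector) \<Rightarrow> bool"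
  where "smooth_map A G \<longleftrightarrow> (\<forall>c\<in>A. smooth_on (chart_image c) (G \<circ> param c))"

definition immersion_on :: "'a::real_normed_vector set \<Rightarrow> ('a \<Rightarrow> 'b::real_normed_vector) \<Rightarrow> bool"
  where "immersion_on V f \<longleftrightarrow> smooth_on V f \<and> (\<forall>y\<in>V. inj (D f y))"

text \<open>The index type \<open>'n option\<close> has one element more than \<open>'n\<close>, so
  \<open>real ^ 'n option\<close> is the ambient space of dimension \<open>n + 1\<close>.\<close>
definition immersed_hypersurface ::
    "('m, 'n::finite) chart set \<Rightarrow> ('m \<Rightarrow> real ^ 'n option) \<Rightarrow> bool"
  where "immersed_hypersurface A F \<longleftrightarrow> (\<forall>c\<in>A. immersion_on (chart_image c) (F \<circ> param c))"

section \<open>Local affine geometry of a parametrised hypersurface\<close>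

text \<open>Below \<open>f\<close> is an immersion of an open set of \<open>real ^ 'n\<close> and \<open>\<xi>\<close> a vector field along \<open>f\<close>;
  tangent spaces are identified with \<open>real ^ 'n\<close> by the parametrisation. Tensors are evaluated on
  tangent vectors by extending these to constant vector fields.\<close>

definition transversal_on ::
    "(real ^ 'n) set \<Rightarrow> (real ^ 'n::finite \<Rightarrow> real ^ 'n option) \<Rightarrow> (real ^ 'n \<Rightarrow> real ^ 'n option) \<Rightarrow> bool"
  where "transversal_on V f \<xi> \<longleftrightarrow> smooth_on V \<xi> \<and> (\<forall>y\<in>V. \<xi> y \<notin> range (D f y))"

definition tangential ::
    "(real ^ 'n::finite \<Rightarrow> real ^ 'n option) \<Rightarrow> (real ^ 'n \<Rightarrow> real ^ 'n option) \<Rightarrow> real ^ 'n \<Rightarrow>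
      real ^ 'n option \<Rightarrow> real ^ 'n"
  where "tangential f \<xi> y w = (THE v. \<exists>s. w = D f y v + s *\<^sub>R \<xi> y)"

definition transversal_part ::
    "(real ^ 'n::finite \<Rightarrow> real ^ 'n option) \<Rightarrow> (real ^ 'n \<Rightarrow> real ^ 'n option) \<Rightarrow> real ^ 'n \<Rightarrow>
      real ^ 'n option \<Rightarrow> real"
  where "transversal_part f \<xi> y w = (THE s. \<exists>v. w = D f y v + s *\<^sub>R \<xi> y)"

text \<open>Gauss formula \<open>D\<^sub>X Y = \<nabla>\<^sub>X Y + h(X, Y) \<xi>\<close>, Weingarten formula
  \<open>D\<^sub>X \<xi> = - S X + \<tau>(X) \<xi>\<close>.\<close>

definition induced_conn ::
    "(real ^ 'n::finite \<Rightarrow> real ^ 'n option) \<Rightarrow> (real ^ 'n \<Rightarrow> real ^ 'n option) \<Rightarrow>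
      (real ^ 'n \<Rightarrow> real ^ 'n) \<Rightarrow> (real ^ 'n \<Rightarrow> real ^ 'n) \<Rightarrow> real ^ 'n \<Rightarrow> real ^ 'n"
  where "induced_conn f \<xi> X Y y = tangential f \<xi> y (D (\<lambda>z. D f z (Y z)) y (X y))"

definition affine_metric ::
    "(real ^ 'n::finite \<Rightarrow> real ^ 'n option) \<Rightarrow> (real ^ 'n \<Rightarrow> real ^ 'n option) \<Rightarrow>
      real ^ 'n \<Rightarrow> real ^ 'n \<Rightarrow> real ^ 'n \<Rightarrow> real"
  where "affine_metric f \<xi> y v w = transversal_part f \<xi> y (D (\<lambda>z. D f z w) y v)"

definition shape_op ::
    "(real ^ 'n::finite \<Rightarrow> real ^ 'n option) \<Rightarrow> (real ^ 'n \<Rightarrow> real ^ 'n option) \<Rightarrow>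
      real ^ 'n \<Rightarrow> real ^ 'n \<Rightarrow> real ^ 'n"
  where "shape_op f \<xi> y v = - tangential f \<xi> y (D \<xi> y v)"

definition transversal_form ::
    "(real ^ 'n::finite \<Rightarrow> real ^ 'n option) \<Rightarrow> (real ^ 'n \<Rightarrow> real ^ 'n option) \<Rightarrow>
      real ^ 'n \<Rightarrow> real ^ 'n \<Rightarrow> real"
  where "transversal_form f \<xi> y v = transversal_part f \<xi> y (D \<xi> y v)"

definition induced_vol ::
    "(real ^ 'n::finite \<Rightarrow> real ^ 'n option) \<Rightarrow> (real ^ 'n \<Rightarrow> real ^ 'n option) \<Rightarrow>
      real ^ 'n \<Rightarrow> ('n \<Rightarrow> real ^ 'n) \<Rightarrow> real"
  where "induced_vol f \<xi> y E = det (\<chi> i. case i of Some j \<Rightarrow> D f y (E j) | None \<Rightarrow> \<xi> y)"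

definition affine_normal_on ::
    "(real ^ 'n) set \<Rightarrow> (real ^ 'n::finite \<Rightarrow> real ^ 'n option) \<Rightarrow> (real ^ 'n \<Rightarrow> real ^ 'n option) \<Rightarrow> bool"
  where "affine_normal_on V f \<xi> \<longleftrightarrow> transversal_on V f \<xi> \<and>
    (\<forall>y\<in>V. (\<forall>v. transversal_form f \<xi> y v = 0) \<and>
      (\<forall>E. inj E \<and> independent (range E) \<longrightarrow>
        (induced_vol f \<xi> y E)\<^sup>2 = \<bar>det (\<chi> i j. affine_metric f \<xi> y (E i) (E j))\<bar>) \<and>
      (\<forall>v. v \<noteq> 0 \<longrightarrow> affine_metric f \<xi> y v v > 0))"

definition definite :: "('a::real_vector \<Rightarrow> 'a \<Rightarrow> real) \<Rightarrow> bool"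
  where "definite g \<longleftrightarrow> (\<forall>v. v \<noteq> 0 \<longrightarrow> g v v > 0) \<or> (\<forall>v. v \<noteq> 0 \<longrightarrow> g v v < 0)"

text \<open>Whether \<open>h\<close> is definite does not depend on the transversal field used to define it.\<close>
definition strictly_locally_convex ::
    "('m, 'n::finite) chart set \<Rightarrow> ('m \<Rightarrow> real ^ 'n option) \<Rightarrow> bool"
  where "strictly_locally_convex A F \<longleftrightarrow>
    (\<forall>c\<in>A. \<forall>y\<in>chart_image c. \<exists>V N. open V \<and> y \<in> V \<and> V \<subseteq> chart_image c \<and>
      transversal_on V (F \<circ> param c) N \<and> definite (affine_metric (F \<circ> param c) N y))"

text \<open>The affine normal, with the sign for which \<open>h\<close> is positive definite.\<close>
definition affine_normal ::
    "('m, 'n::finite) chart set \<Rightarrow> ('m \<Rightarrow> real ^ 'n option) \<Rightarrow> ('m \<Rightarrow> real ^ 'n option) \<Rightarrow> bool"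
  where "affine_normal A F \<xi> \<longleftrightarrow>
    (\<forall>c\<in>A. affine_normal_on (chart_image c) (F \<circ> param c) (\<xi> \<circ> param c))"

section \<open>Levi-Civita connection and difference tensor\<close>

text \<open>An affine connection on an open subset of \<open>real ^ 'n\<close> is given by its Christoffel tensor
  \<open>\<Gamma>\<close>, as \<open>\<nabla>\<^sub>X Y = D\<^sub>X Y + \<Gamma>(X, Y)\<close>.\<close>
definition cov_deriv ::
    "(real ^ 'n \<Rightarrow> real ^ 'n \<Rightarrow> real ^ 'n \<Rightarrow> real ^ 'n) \<Rightarrow>
      (real ^ 'n::finite \<Rightarrow> real ^ 'n) \<Rightarrow> (real ^ 'n \<Rightarrow> real ^ 'n) \<Rightarrow> real ^ 'n \<Rightarrow> real ^ 'n"
  where "cov_deriv \<Gamma> X Y y = D Y y (X y) + \<Gamma> y (X y) (Y y)"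

definition lie_bracket ::
    "(real ^ 'n::finite \<Rightarrow> real ^ 'n) \<Rightarrow> (real ^ 'n \<Rightarrow> real ^ 'n) \<Rightarrow> real ^ 'n \<Rightarrow> real ^ 'n"
  where "lie_bracket X Y y = D Y y (X y) - D X y (Y y)"

definition levi_civita_on ::
    "(real ^ 'n) set \<Rightarrow> (real ^ 'n::finite \<Rightarrow> real ^ 'n \<Rightarrow> real ^ 'n \<Rightarrow> real) \<Rightarrow>
      (real ^ 'n \<Rightarrow> real ^ 'n \<Rightarrow> real ^ 'n \<Rightarrow> real ^ 'n) \<Rightarrow> bool"
  where "levi_civita_on V g \<Gamma> \<longleftrightarrow>
    (\<forall>y\<in>V. bilinear (\<Gamma> y)) \<and> (\<forall>v w. smooth_on V (\<lambda>y. \<Gamma> y v w)) \<and>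
    (\<forall>X Y. smooth_on V X \<and> smooth_on V Y \<longrightarrow>
      (\<forall>y\<in>V. cov_deriv \<Gamma> X Y y - cov_deriv \<Gamma> Y X y = lie_bracket X Y y)) \<and>
    (\<forall>X Y Z. smooth_on V X \<and> smooth_on V Y \<and> smooth_on V Z \<longrightarrow>
      (\<forall>y\<in>V. D (\<lambda>z. g z (Y z) (Z z)) y (X y) =
        g y (cov_deriv \<Gamma> X Y y) (Z y) + g y (Y y) (cov_deriv \<Gamma> X Z y)))"

text \<open>The Levi-Civita connection of \<open>h\<close> on the manifold is given by its (unique) Christoffel
  tensors in the charts of the atlas.\<close>
definition levi_civita ::
    "('m, 'n::finite) chart set \<Rightarrow> ('m \<Rightarrow> real ^ 'n option) \<Rightarrow> ('m \<Rightarrow> real ^ 'n option) \<Rightarrow>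
      (('m, 'n) chart \<Rightarrow> real ^ 'n \<Rightarrow> real ^ 'n \<Rightarrow> real ^ 'n \<Rightarrow> real ^ 'n) \<Rightarrow> bool"
  where "levi_civita A F \<xi> \<Gamma> \<longleftrightarrow>
    (\<forall>c\<in>A. levi_civita_on (chart_image c) (affine_metric (F \<circ> param c) (\<xi> \<circ> param c)) (\<Gamma> c))"

definition difference_tensor ::
    "(real ^ 'n::finite \<Rightarrow> real ^ 'n option) \<Rightarrow> (real ^ 'n \<Rightarrow> real ^ 'n option) \<Rightarrow>
      (real ^ 'n \<Rightarrow> real ^ 'n \<Rightarrow> real ^ 'n \<Rightarrow> real ^ 'n) \<Rightarrow>
      real ^ 'n \<Rightarrow> real ^ 'n \<Rightarrow> real ^ 'n \<Rightarrow> real ^ 'n"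
  where "difference_tensor f \<xi> \<Gamma> y v w =
    induced_conn f \<xi> (\<lambda>_. v) (\<lambda>_. w) y - cov_deriv \<Gamma> (\<lambda>_. v) (\<lambda>_. w) y"

section \<open>Pointwise symmetry and the associated functions\<close>

text \<open>\<open>g\<close> fixes the \<open>h\<close>-unit vector \<open>e\<close> and restricts to an element of the special orthogonal group
  of the \<open>h\<close>-orthogonal complement of \<open>e\<close>. Since \<open>g\<close> fixes \<open>e\<close> and preserves the complement, the
  determinant of the restriction is the determinant of \<open>g\<close>.\<close>
definition rotation_fixing ::
    "(real ^ 'n \<Rightarrow> real ^ 'n \<Rightarrow> real) \<Rightarrow> real ^ 'n::finite \<Rightarrow> (real ^ 'n \<Rightarrow> real ^ 'n) \<Rightarrow> bool"
  where "rotation_fixing h e g \<longleftrightarrow> linear g \<and> g e = e \<and>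
    (\<forall>v. h e v = 0 \<longrightarrow> h e (g v) = 0) \<and>
    (\<forall>v w. h e v = 0 \<and> h e w = 0 \<longrightarrow> h (g v) (g w) = h v w) \<and>
    det (matrix g) = 1"

definition pointwise_SO_symmetry ::
    "('m, 'n::finite) chart set \<Rightarrow> ('m \<Rightarrow> real ^ 'n option) \<Rightarrow> ('m \<Rightarrow> real ^ 'n option) \<Rightarrow>
      (('m, 'n) chart \<Rightarrow> real ^ 'n \<Rightarrow> real ^ 'n \<Rightarrow> real ^ 'n \<Rightarrow> real ^ 'n) \<Rightarrow> bool"
  where "pointwise_SO_symmetry A F \<xi> \<Gamma> \<longleftrightarrow>
    (\<forall>c\<in>A. \<forall>y\<in>chart_image c.
      let h = affine_metric (F \<circ> param c) (\<xi> \<circ> param c) y;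
          S = shape_op (F \<circ> param c) (\<xi> \<circ> param c) y;
          K = difference_tensor (F \<circ> param c) (\<xi> \<circ> param c) (\<Gamma> c) y
      in \<exists>e. h e e = 1 \<and>
        (\<forall>g. rotation_fixing h e g \<longrightarrow>
          (\<forall>v w. S (g v) = g (S v) \<and> K (g v) (g w) = g (K v w))))"

text \<open>From here on the dimension of the hypersurface is written as \<open>CARD('k option)\<close>, that is,
  \<open>n - 1 = CARD('k)\<close>. In the frame \<open>E\<close>, \<open>E None\<close> is \<open>X\<^sub>1\<close> and the \<open>E (Some i)\<close> are
  \<open>X\<^sub>2, \<dots>, X\<^sub>n\<close>.\<close>
definition associated_functions ::
    "('m, 'k::finite option) chart set \<Rightarrow> ('m \<Rightarrow> real ^ 'k option option) \<Rightarrow>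
      ('m \<Rightarrow> real ^ 'k option option) \<Rightarrow>
      (('m, 'k option) chart \<Rightarrow> real ^ 'k option \<Rightarrow> real ^ 'k option \<Rightarrow> real ^ 'k option \<Rightarrow> real ^ 'k option) \<Rightarrow>
      ('m \<Rightarrow> real) \<Rightarrow> ('m \<Rightarrow> real) \<Rightarrow> ('m \<Rightarrow> real) \<Rightarrow> ('m \<Rightarrow> real) \<Rightarrow> bool"
  where "associated_functions A F \<xi> \<Gamma> a b r \<sigma> \<longleftrightarrow>
    smooth_map A a \<and> smooth_map A b \<and> smooth_map A r \<and>
    (\<forall>c\<in>A. \<forall>p\<in>fst c. r p > 0 \<and>
      (\<exists>V. \<exists>E :: 'k option \<Rightarrow> real ^ 'k option \<Rightarrow> real ^ 'k option.
        open V \<and> snd c p \<in> V \<and> V \<subseteq> chart_image c \<and> (\<forall>i. smooth_on V (E i)) \<and>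
        (\<forall>y\<in>V.
          let h = affine_metric (F \<circ> param c) (\<xi> \<circ> param c) y;
              S = shape_op (F \<circ> param c) (\<xi> \<circ> param c) y;
              K = difference_tensor (F \<circ> param c) (\<xi> \<circ> param c) (\<Gamma> c) y;
              q = param c y
          in (\<forall>i j. h (E i y) (E j y) = (if i = j then 1 else 0)) \<and>
            S (E None y) = a q *\<^sub>R E None y \<and>
            (\<forall>i. S (E (Some i) y) = b q *\<^sub>R E (Some i) y) \<and>
            K (E None y) (E None y) = (real CARD('k) * r q) *\<^sub>R E None y \<and>
            (\<forall>i. K (E None y) (E (Some i) y) = - r q *\<^sub>R E (Some i) y) \<and>
            (\<forall>i j. K (E (Some i) y) (E (Some j) y) =
              (if i = j then - r q *\<^sub>R E None y else 0)) \<and>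
            (\<forall>i. cov_deriv (\<Gamma> c) (E (Some i)) (E None) y = \<sigma> q *\<^sub>R E (Some i) y))))"

section \<open>Quadrics, affine congruence and the normal forms\<close>

text \<open>\<open>vsnoc x s\<close> is the vector \<open>(x, s)\<close>.\<close>
definition vsnoc :: "real ^ 'n::finite \<Rightarrow> real \<Rightarrow> real ^ 'n option"
  where "vsnoc x s = (\<chi> i. case i of Some j \<Rightarrow> x $ j | None \<Rightarrow> s)"

definition unit_hyperboloid_sheet :: "(real ^ 'k::finite option) set"
  where "unit_hyperboloid_sheet =
    {x. (\<Sum>i\<in>UNIV. (x $ Some i)\<^sup>2) - (x $ None)\<^sup>2 = - 1 \<and> x $ None > 0}"

text \<open>Only used for \<open>\<epsilon> = 1\<close> and \<open>\<epsilon> = -1\<close>.\<close>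
definition model_quadric :: "int \<Rightarrow> (real ^ 'k::finite option) set"
  where "model_quadric \<epsilon> = (if \<epsilon> = 1 then sphere 0 1 else unit_hyperboloid_sheet)"

definition quadric_immersion ::
    "int \<Rightarrow> (real ^ 'k) set \<Rightarrow> (real ^ 'k::finite \<Rightarrow> real ^ 'k option) \<Rightarrow> bool"
  where "quadric_immersion \<epsilon> U \<phi> \<longleftrightarrow> \<epsilon> \<in> {-1, 1} \<and> immersion_on U \<phi> \<and>
    (\<exists>L. linear L \<and> det (matrix L) = 1 \<and>
      openin (top_of_set (model_quadric \<epsilon>)) (L ` \<phi> ` U))"

definition affine_transformation :: "('a::real_vector \<Rightarrow> 'a) \<Rightarrow> bool"
  where "affine_transformation T \<longleftrightarrow> (\<exists>L v. linear L \<and> bij L \<and> T = (\<lambda>x. L x + v))"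

text \<open>Around \<open>p\<close> there are coordinates \<open>(t, u)\<close> of the manifold with values in \<open>I \<times> U\<close>, encoded as
  \<open>vsnoc u t\<close>, in which \<open>F\<close> is the map \<open>G\<close> up to an affine transformation.\<close>
definition congruent_near ::
    "'m topology \<Rightarrow> ('m, 'k::finite option) chart set \<Rightarrow> ('m \<Rightarrow> real ^ 'k option option) \<Rightarrow> 'm \<Rightarrow>
      real set \<Rightarrow> (real ^ 'k) set \<Rightarrow> (real \<Rightarrow> real ^ 'k \<Rightarrow> real ^ 'k option option) \<Rightarrow> bool"
  where "congruent_near X A F p I U G \<longleftrightarrow>
    open I \<and> is_interval I \<and> open U \<and>
    (\<exists>c\<in>maximal_atlas X A. p \<in> fst c \<and> chart_image c = {vsnoc u t |t u. t \<in> I \<and> u \<in> U} \<and>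
      (\<exists>T. affine_transformation T \<and> (\<forall>t\<in>I. \<forall>u\<in>U. F (param c (vsnoc u t)) = T (G t u))))"

end

theory Submission
  imports Defs
begin

text \<open>Put \<open>\<alpha> = \<sigma> - r\<close>, \<open>\<beta> = \<sigma> + r\<close> and \<open>Z = \<xi> - \<beta> X\<^sub>1\<close>, and let \<open>i \<ge> 2\<close>. The integrability conditions of the
  moving frame show that \<open>\<alpha>\<close>, \<open>\<beta>\<close> and \<open>b\<close> are constant along the leaves tangent to the \<open>X\<^sub>i\<close>, that
  \<open>X\<^sub>1\<close> is geodesic for the metric, and they give the derivatives of \<open>\<alpha>\<close>, \<open>\<beta>\<close> and \<open>b\<close> along \<open>X\<^sub>1\<close>. The
  equations for \<open>\<beta>\<close> are those for \<open>\<alpha>\<close> with the frame replaced by the dual frame built from the conormal.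
  Then \<open>D\<^sub>i Z = - \<zeta> X\<^sub>i\<close> and \<open>D\<^sub>1 Z = - \<beta> Z\<close>, so the hyperplane spanned by \<open>Z\<close> and the \<open>X\<^sub>i\<close> is
  constant, and each leaf lies in a translate of it. If \<open>\<zeta> \<noteq> 0\<close>, the point \<open>F + Z / \<zeta>\<close> is constant on each
  leaf and moves on a fixed line; it is the common centre of homothetic quadrics. If \<open>\<zeta> = 0\<close>, the
  direction of \<open>Z\<close> is constant and the leaves are paraboloids with this axis; for \<open>\<alpha> \<noteq> 0\<close> the point
  \<open>F - X\<^sub>1 / \<alpha>\<close> moves on a line in this direction.

  All constancy statements are instances of one fact: a solution of a homogeneous linear system along the
  frame vanishes if it vanishes at one point. The coordinates \<open>(t, u)\<close> are affine coordinates of \<open>F\<close> up to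
  normalisation, which avoids the Frobenius theorem.\<close>

section \<open>Calculus of smooth maps\<close>

text \<open>Along a leaf, the derivative of X_j in direction X_i is a combination of the X_m plus
  \<xi> - \<beta> X_1 if i = j. So Z is the transversal direction of the leaf inside its own
  hyperplane, and since \<alpha>\<beta> = \<sigma>^2 - r^2, the function \<zeta> = b +
  \<alpha>\<beta> is the factor in the derivative of Z along the leaf. All these equations are
  linear in the vector fields. One affine normalisation at the base point therefore turns each
  geometric claim into the vanishing of some coordinates, with zero initial values. Without
  Frobenius the difficulty is to recognise a function of t alone. The coordinate t is a linear
  function of F that kills the constant hyperplane but not X_1, so the kernel of dt is spanned by
  the X_i, and zero derivatives along the X_i already say that a quantity depends on t only. The
  condition n >= 3 provides a second leaf direction to compare with the first, and r > 0 is what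
  makes X_1 geodesic.\<close>

lemma D_eqI: "(f has_derivative f') (at y) \<Longrightarrow> D f y v = f' v"
  by (simp add: frechet_derivative_at[symmetric])

lemma D_cong_open:
  assumes "open V" "y \<in> V" "\<And>z. z \<in> V \<Longrightarrow> f z = g z" "f differentiable (at y)"
  shows "D f y v = D g y v"
  using frechet_derivative_transform_within_open[OF assms(4,1,2,3)] by simp

lemma Ck_on_cong:
  assumes "open V" "\<And>z. z \<in> V \<Longrightarrow> f z = g z" "Ck_on k f V"
  shows "Ck_on k g V"
  using assms(2,3)
proof (induction k arbitrary: f g)
  case 0
  then show ?case by (simp cong: continuous_on_cong)
next
  case (Suc k)
  have d: "f differentiable_on V" using Suc.prems by simp
  then have d': "g differentiable_on V"
    unfolding differentiable_on_eq_differentiable_at[OF assms(1)] differentiable_def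
    using has_derivative_transform_within_open[OF _ assms(1) _ Suc.prems(1)] by meson
  have "Ck_on k (\<lambda>y. D g y v) V" for v
  proof (rule Suc.IH[of "\<lambda>y. D f y v"])
    show "D f z v = D g z v" if "z \<in> V" for z
      using D_cong_open[OF \<open>open V\<close> that, of f g] Suc.prems(1) d that \<open>open V\<close>
      by (simp add: differentiable_on_eq_differentiable_at)
    show "Ck_on k (\<lambda>y. D f y v) V" using Suc.prems by simp
  qed
  with d' show ?case by simp
qed

section \<open>Closure properties of C^k and of smooth maps\<close>

lemma Ck_on_continuous: "Ck_on k f V \<Longrightarrow> continuous_on V f"
  by (cases k) (auto intro: differentiable_imp_continuous_on)

lemma Ck_on_Suc_D: "Ck_on (Suc k) f V \<Longrightarrow> Ck_on k f V"
proof (induction k arbitrary: f)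
  case 0
  then show ?case by (auto intro: differentiable_imp_continuous_on)
qed auto

lemma Ck_on_subset: "Ck_on k f V \<Longrightarrow> W \<subseteq> V \<Longrightarrow> Ck_on k f W"
  by (induction k arbitrary: f) (auto intro: continuous_on_subset differentiable_on_subset)

lemma Ck_on_const: "Ck_on k (\<lambda>_. c) V"
  by (induction k arbitrary: c) auto

lemma Ck_on_linear:
  assumes "bounded_linear L" "open V" shows "Ck_on k L V"
proof -
  have "L differentiable_on V"
    using assms by (meson bounded_linear_imp_differentiable differentiable_at_imp_differentiable_on)
  moreover have "(\<lambda>y. D L y v) = (\<lambda>_. L v)" for v
    using D_eqI[OF bounded_linear_imp_has_derivative[OF assms(1)]] by blast
  ultimately show ?thesis
    by (cases k) (auto simp: Ck_on_const intro: differentiable_imp_continuous_on)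
qed

lemma Ck_on_differentiable: "Ck_on (Suc k) f V \<Longrightarrow> open V \<Longrightarrow> y \<in> V \<Longrightarrow> f differentiable (at y)"
  by (simp add: differentiable_on_eq_differentiable_at)

lemma Ck_on_has_derivative:
  "Ck_on (Suc k) f V \<Longrightarrow> open V \<Longrightarrow> y \<in> V \<Longrightarrow> (f has_derivative frechet_derivative f (at y)) (at y)"
  using Ck_on_differentiable frechet_derivative_works by blast

lemma Ck_on_SucI:
  assumes "open V" "\<And>y. y \<in> V \<Longrightarrow> (f has_derivative f' y) (at y)" "\<And>v. Ck_on k (\<lambda>y. f' y v) V"
  shows "Ck_on (Suc k) f V"
proof -
  have "f differentiable_on V"
    using assms(1,2) by (meson differentiable_at_imp_differentiable_on differentiableI)
  moreover have "Ck_on k (\<lambda>y. D f y v) V" for v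
    by (rule Ck_on_cong[OF assms(1) _ assms(3)[of v]]) (simp add: D_eqI[OF assms(2)])
  ultimately show ?thesis by simp
qed

lemma Ck_on_add:
  assumes "open V" "Ck_on k f V" "Ck_on k g V"
  shows "Ck_on k (\<lambda>y. f y + g y) V"
  using assms(2,3)
proof (induction k arbitrary: f g)
  case 0 then show ?case by (simp add: continuous_on_add)
next
  case (Suc k)
  show ?case
    by (rule Ck_on_SucI[OF assms(1) has_derivative_add[OF Ck_on_has_derivative[OF Suc.prems(1) assms(1)]
          Ck_on_has_derivative[OF Suc.prems(2) assms(1)]]]) (use Suc in auto)
qed

lemma Ck_on_sum:
  assumes "open V" "finite J" "\<And>j. j \<in> J \<Longrightarrow> Ck_on k (f j) V"
  shows "Ck_on k (\<lambda>y. \<Sum>j\<in>J. f j y) V"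
  using assms(2,3) by (induction J rule: finite_induct) (auto simp: Ck_on_const intro!: Ck_on_add[OF assms(1)])

lemma Ck_on_bilinear:
  assumes "bounded_bilinear B" "open V" "Ck_on k f V" "Ck_on k g V"
  shows "Ck_on k (\<lambda>y. B (f y) (g y)) V"
  using assms(3,4)
proof (induction k arbitrary: f g)
  case 0 then show ?case using bounded_bilinear.continuous_on[OF assms(1)] by auto
next
  case (Suc k)
  show ?case
  proof (rule Ck_on_SucI[OF assms(2) bounded_bilinear.FDERIV[OF assms(1)
          Ck_on_has_derivative[OF Suc.prems(1) assms(2)] Ck_on_has_derivative[OF Suc.prems(2) assms(2)]]])
    show "Ck_on k (\<lambda>x. B (f x) (D g x v) + B (D f x v) (g x)) V" for v
      using Suc Ck_on_Suc_D[OF Suc.prems(1)] Ck_on_Suc_D[OF Suc.prems(2)]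
      by (intro Ck_on_add assms Suc.IH) auto
  qed
qed

text \<open>\<open>Ck_on\<close> controls directional derivatives in fixed directions only. A
  direction that varies with the point is reduced to these by expanding it in the basis.\<close>

lemma D_basis_expand:
  fixes f :: "'a::euclidean_space \<Rightarrow> 'b::real_normed_vector"
  assumes "f differentiable (at y)"
  shows "D f y v = (\<Sum>b\<in>Basis. (v \<bullet> b) *\<^sub>R D f y b)"
proof -
  have l: "linear (frechet_derivative f (at y))" using assms linear_frechet_derivative by blast
  have "D f y v = D f y (\<Sum>b\<in>Basis. (v \<bullet> b) *\<^sub>R b)" by (simp add: euclidean_representation)
  also have "\<dots> = (\<Sum>b\<in>Basis. (v \<bullet> b) *\<^sub>R D f y b)"
    by (simp add: linear_sum[OF l] linear_cmul[OF l])
  finally show ?thesis .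
qed

lemma Ck_on_compose:
  fixes f :: "'b::euclidean_space \<Rightarrow> 'c::real_normed_vector" and g :: "'a::real_normed_vector \<Rightarrow> 'b"
  assumes "open V" "open W" "g ` V \<subseteq> W" "Ck_on k f W" "Ck_on k g V"
  shows "Ck_on k (\<lambda>y. f (g y)) V"
  using assms(4,5)
proof (induction k arbitrary: f)
  case 0 then show ?case using continuous_on_compose2[of W f V g] assms(3) by auto
next
  case (Suc k)
  have gW: "g y \<in> W" if "y \<in> V" for y using that assms(3) by auto
  have fd: "f differentiable (at (g y))" if "y \<in> V" for y
    using Ck_on_differentiable[OF Suc.prems(1) assms(2) gW[OF that]] .
  show ?case
  proof (rule Ck_on_SucI[OF assms(1) has_derivative_compose[OF Ck_on_has_derivative[OF Suc.prems(2) assms(1)]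
        Ck_on_has_derivative[OF Suc.prems(1) assms(2) gW]]])
    fix v
    \<comment> \<open>The direction \<open>D g y v\<close> depends on \<open>y\<close>; after
      expansion the induction hypothesis applies to each \<open>D f\<close> in a fixed direction
      \<open>b\<close>.\<close>
    have "Ck_on k (\<lambda>y. \<Sum>b\<in>Basis. (D g y v \<bullet> b) *\<^sub>R D f (g y) b) V"
      using Suc.prems Ck_on_Suc_D[OF Suc.prems(2)]
      by (intro Ck_on_sum assms Ck_on_bilinear[OF bounded_bilinear_scaleR]
          Ck_on_bilinear[OF bounded_bilinear_inner] Ck_on_const Suc.IH) auto
    then show "Ck_on k (\<lambda>y. D f (g y) (D g y v)) V"
      by (rule Ck_on_cong[OF assms(1), rotated]) (simp add: D_basis_expand[OF fd, symmetric])
  qed auto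
qed

lemma smooth_on_Ck: "smooth_on V f \<Longrightarrow> Ck_on k f V"
  by (simp add: smooth_on_def)

lemma smooth_on_cong: "open V \<Longrightarrow> (\<And>z. z \<in> V \<Longrightarrow> f z = g z) \<Longrightarrow> smooth_on V f \<Longrightarrow> smooth_on V g"
  unfolding smooth_on_def using Ck_on_cong by blast

lemma smooth_on_subset: "smooth_on V f \<Longrightarrow> W \<subseteq> V \<Longrightarrow> smooth_on W f"
  unfolding smooth_on_def using Ck_on_subset by blast

lemma smooth_on_continuous: "smooth_on V f \<Longrightarrow> continuous_on V f"
  unfolding smooth_on_def using Ck_on_continuous by blast

lemma smooth_on_differentiable: "smooth_on V f \<Longrightarrow> open V \<Longrightarrow> y \<in> V \<Longrightarrow> f differentiable (at y)"
  unfolding smooth_on_def using Ck_on_differentiable by blast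

lemma smooth_on_has_derivative:
  "smooth_on V f \<Longrightarrow> open V \<Longrightarrow> y \<in> V \<Longrightarrow> (f has_derivative frechet_derivative f (at y)) (at y)"
  using smooth_on_differentiable frechet_derivative_works by blast

lemma smooth_on_linear_D: "smooth_on V f \<Longrightarrow> open V \<Longrightarrow> y \<in> V \<Longrightarrow> linear (frechet_derivative f (at y))"
  using smooth_on_differentiable linear_frechet_derivative by blast

lemma smooth_on_D: "smooth_on V f \<Longrightarrow> smooth_on V (\<lambda>y. D f y v)"
  unfolding smooth_on_def by (metis Ck_on.simps(2))

lemma smooth_on_const: "smooth_on V (\<lambda>_. c)"
  by (simp add: smooth_on_def Ck_on_const)

lemma smooth_on_linear: "bounded_linear L \<Longrightarrow> open V \<Longrightarrow> smooth_on V L"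
  by (simp add: smooth_on_def Ck_on_linear)

lemma smooth_on_ident: "open V \<Longrightarrow> smooth_on V (\<lambda>y. y)"
  by (simp add: smooth_on_linear bounded_linear_ident)

lemma smooth_on_add: "open V \<Longrightarrow> smooth_on V f \<Longrightarrow> smooth_on V g \<Longrightarrow> smooth_on V (\<lambda>y. f y + g y)"
  by (simp add: smooth_on_def Ck_on_add)

lemma smooth_on_sum:
  "open V \<Longrightarrow> finite J \<Longrightarrow> (\<And>j. j \<in> J \<Longrightarrow> smooth_on V (f j)) \<Longrightarrow> smooth_on V (\<lambda>y. \<Sum>j\<in>J. f j y)"
  by (simp add: smooth_on_def Ck_on_sum)

lemma smooth_on_bilinear:
  "bounded_bilinear B \<Longrightarrow> open V \<Longrightarrow> smooth_on V f \<Longrightarrow> smooth_on V g \<Longrightarrow> smooth_on V (\<lambda>y. B (f y) (g y))"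
  by (simp add: smooth_on_def Ck_on_bilinear)

lemmas smooth_on_scaleR = smooth_on_bilinear[OF bounded_bilinear_scaleR]
lemmas smooth_on_inner = smooth_on_bilinear[OF bounded_bilinear_inner]

lemma smooth_on_mult:
  fixes f g :: "'a::real_normed_vector \<Rightarrow> real"
  shows "open V \<Longrightarrow> smooth_on V f \<Longrightarrow> smooth_on V g \<Longrightarrow> smooth_on V (\<lambda>y. f y * g y)"
  using smooth_on_bilinear[OF bounded_bilinear_mult] .

lemma smooth_on_minus: "open V \<Longrightarrow> smooth_on V f \<Longrightarrow> smooth_on V (\<lambda>y. - f y)"
  using smooth_on_scaleR[of V "\<lambda>_. -1" f] by (simp add: smooth_on_const)

lemma smooth_on_diff: "open V \<Longrightarrow> smooth_on V f \<Longrightarrow> smooth_on V g \<Longrightarrow> smooth_on V (\<lambda>y. f y - g y)"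
  using smooth_on_add[of V f "\<lambda>y. - g y"] smooth_on_minus by auto

lemma smooth_on_prod:
  fixes f :: "'j \<Rightarrow> 'a::real_normed_vector \<Rightarrow> real"
  assumes "open V" "finite J" "\<And>j. j \<in> J \<Longrightarrow> smooth_on V (f j)"
  shows "smooth_on V (\<lambda>y. \<Prod>j\<in>J. f j y)"
  using assms(2,3) by (induction J rule: finite_induct) (auto simp: smooth_on_const intro!: smooth_on_mult assms(1))

lemma smooth_on_compose:
  fixes f :: "'b::euclidean_space \<Rightarrow> 'c::real_normed_vector" and g :: "'a::real_normed_vector \<Rightarrow> 'b"
  assumes "open V" "open W" "smooth_on W f" "smooth_on V g" "g ` V \<subseteq> W"
  shows "smooth_on V (\<lambda>y. f (g y))"
  using assms by (simp add: smooth_on_def Ck_on_compose)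

lemma smooth_on_linear_compose:
  fixes L :: "'b::euclidean_space \<Rightarrow> 'c::real_normed_vector"
  assumes "linear L" "open V" "smooth_on V g"
  shows "smooth_on V (\<lambda>y. L (g y))"
  using smooth_on_compose[OF assms(2) open_UNIV smooth_on_linear assms(3)] assms(1)
  by (simp add: linear_conv_bounded_linear)

lemma smooth_on_inverse_real: "smooth_on (- {0}) (inverse :: real \<Rightarrow> real)"
proof -
  have "Ck_on k (inverse :: real \<Rightarrow> real) (- {0})" for k
  proof (induction k)
    case 0 then show ?case by (auto intro: continuous_on_inverse continuous_on_id)
  next
    case (Suc k)
    have o: "open (- {0::real})" by auto
    show ?case
    proof (rule Ck_on_SucI[OF o])
      \<comment> \<open>Written so that the derivative is again a polynomial in
        \<open>inverse\<close>, to which the induction hypothesis applies.\<close>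
      show "(inverse has_derivative (\<lambda>v. - (inverse y * v * inverse y))) (at y)"
        if "y \<in> - {0}" for y :: real
        using that by (auto intro!: derivative_eq_intros)
      show "Ck_on k (\<lambda>y. - (inverse y * v * inverse y)) (- {0::real})" for v
      proof -
        have "Ck_on k (\<lambda>y. (- v) * (inverse y * inverse y)) (- {0::real})"
          by (intro Ck_on_bilinear[OF bounded_bilinear_mult] o Ck_on_const Suc.IH)
        then show ?thesis by (simp add: mult.commute mult.left_commute)
      qed
    qed
  qed
  then show ?thesis by (simp add: smooth_on_def)
qed

lemma smooth_on_inverse:
  fixes f :: "'a::real_normed_vector \<Rightarrow> real"
  assumes "open V" "smooth_on V f" "\<And>y. y \<in> V \<Longrightarrow> f y \<noteq> 0"
  shows "smooth_on V (\<lambda>y. inverse (f y))"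
  by (rule smooth_on_compose[OF assms(1) _ smooth_on_inverse_real assms(2)]) (use assms(3) in auto)

lemma smooth_on_divide:
  fixes f g :: "'a::real_normed_vector \<Rightarrow> real"
  assumes "open V" "smooth_on V f" "smooth_on V g" "\<And>y. y \<in> V \<Longrightarrow> g y \<noteq> 0"
  shows "smooth_on V (\<lambda>y. f y / g y)"
  using smooth_on_mult[OF assms(1,2) smooth_on_inverse[OF assms(1,3,4)]] by (simp add: divide_inverse)

lemma smooth_on_sqrt_real: "smooth_on {0<..} sqrt"
proof -
  have "Ck_on k sqrt {0<..}" for k
  proof (induction k)
    case 0 then show ?case by (auto intro: continuous_on_real_sqrt continuous_on_id)
  next
    case (Suc k)
    have o: "open ({0<..} :: real set)" by auto
    show ?case
    proof (rule Ck_on_SucI[OF o])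
      show "(sqrt has_derivative (\<lambda>v. (v / 2) * inverse (sqrt y))) (at y)" if "y \<in> {0<..}" for y :: real
        using that by (auto intro!: derivative_eq_intros simp: field_simps)
      show "Ck_on k (\<lambda>y. (v / 2) * inverse (sqrt y)) {0<..}" for v
        by (intro Ck_on_bilinear[OF bounded_bilinear_mult] o Ck_on_const
            Ck_on_compose[OF o _ _ smooth_on_Ck[OF smooth_on_inverse_real] Suc.IH]) auto
    qed
  qed
  then show ?thesis by (simp add: smooth_on_def)
qed

lemma smooth_on_sqrt:
  assumes "open V" "smooth_on V f" "\<And>y. y \<in> V \<Longrightarrow> f y > 0"
  shows "smooth_on V (\<lambda>y. sqrt (f y))"
  by (rule smooth_on_compose[OF assms(1) _ smooth_on_sqrt_real assms(2)]) (use assms(3) in auto)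

lemma smooth_on_vec_nth:
  "open V \<Longrightarrow> smooth_on V (f :: _ \<Rightarrow> real ^ 'n::finite) \<Longrightarrow> smooth_on V (\<lambda>y. f y $ i)"
  by (rule smooth_on_linear_compose[of "\<lambda>x. x $ i"]) (auto simp: linear_iff)

lemma smooth_on_vec:
  fixes f :: "'a::real_normed_vector \<Rightarrow> real ^ 'n::finite"
  assumes "open V" "\<And>i. smooth_on V (\<lambda>y. f y $ i)"
  shows "smooth_on V f"
proof -
  have "smooth_on V (\<lambda>y. \<Sum>i\<in>UNIV. (f y $ i) *\<^sub>R axis i (1::real))"
    by (intro smooth_on_sum smooth_on_scaleR assms smooth_on_const) auto
  moreover have "(\<lambda>y. \<Sum>i\<in>UNIV. (f y $ i) *\<^sub>R axis i (1::real)) = f"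
    by (simp add: basis_expansion flip: scalar_mult_eq_scaleR)
  ultimately show ?thesis by simp
qed

lemma smooth_on_D_field:
  fixes f :: "'a::euclidean_space \<Rightarrow> 'b::real_normed_vector"
  assumes "open V" "smooth_on V f" "smooth_on V Y"
  shows "smooth_on V (\<lambda>y. D f y (Y y))"
proof (rule smooth_on_cong[OF assms(1)])
  show "smooth_on V (\<lambda>y. \<Sum>b\<in>Basis. (Y y \<bullet> b) *\<^sub>R D f y b)"
    by (intro smooth_on_sum smooth_on_scaleR smooth_on_inner assms smooth_on_const smooth_on_D) auto
  show "(\<Sum>b\<in>Basis. (Y z \<bullet> b) *\<^sub>R D f z b) = D f z (Y z)" if "z \<in> V" for z
    by (rule D_basis_expand[OF smooth_on_differentiable[OF assms(2,1) that], symmetric])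
qed

lemma smooth_on_det:
  fixes M :: "'a::real_normed_vector \<Rightarrow> real ^ 'n ^ 'n::finite"
  assumes "open V" "\<And>i j. smooth_on V (\<lambda>y. M y $ i $ j)"
  shows "smooth_on V (\<lambda>y. det (M y))"
  unfolding det_def by (intro smooth_on_sum smooth_on_mult smooth_on_prod smooth_on_const assms) auto

text \<open>By Cramer's rule the solution is a quotient of determinants in the entries. It yields
  the smoothness of the conormal and of the inverse of a derivative.\<close>

lemma smooth_on_solve:
  fixes M :: "'a::real_normed_vector \<Rightarrow> real ^ 'n ^ 'n::finite"
  assumes "open V" "\<And>i j. smooth_on V (\<lambda>y. M y $ i $ j)" "smooth_on V b"
    and "\<And>y. y \<in> V \<Longrightarrow> invertible (M y)" "\<And>y. y \<in> V \<Longrightarrow> M y *v x y = b y"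
  shows "smooth_on V x"
proof (rule smooth_on_vec[OF assms(1)])
  fix k
  have d: "det (M y) \<noteq> 0" if "y \<in> V" for y
    using assms(4)[OF that] by (simp add: invertible_det_nz)
  have "smooth_on V (\<lambda>y. det (\<chi> i j. if j = k then b y $ i else M y $ i $ j) / det (M y))"
  proof (intro smooth_on_divide smooth_on_det assms d)
    show "smooth_on V (\<lambda>y. (\<chi> i j. if j = k then b y $ i else M y $ i $ j) $ i $ j)" for i j
      using smooth_on_vec_nth[OF assms(1,3)] assms(2) by (cases "j = k") auto
  qed
  then show "smooth_on V (\<lambda>y. x y $ k)"
  proof (rule smooth_on_cong[OF assms(1), rotated])
    fix y assume y: "y \<in> V"
    have "x y = (\<chi> k. det (\<chi> i j. if j = k then b y $ i else M y $ i $ j) / det (M y))"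
      using cramer[OF d[OF y], of "x y" "b y"] assms(5)[OF y] by simp
    from this[symmetric] show "det (\<chi> i j. if j = k then b y $ i else M y $ i $ j) / det (M y) = x y $ k"
      by (simp add: vec_eq_iff)
  qed
qed

section \<open>Rules for directional derivatives\<close>

lemma differentiable_bounded_linear:
  "bounded_linear L \<Longrightarrow> f differentiable (at y) \<Longrightarrow> (\<lambda>z. L (f z)) differentiable (at y)"
  unfolding differentiable_def using bounded_linear.has_derivative by blast

lemma differentiable_bounded_bilinear:
  "bounded_bilinear B \<Longrightarrow> f differentiable (at y) \<Longrightarrow> g differentiable (at y) \<Longrightarrow>
    (\<lambda>z. B (f z) (g z)) differentiable (at y)"
  unfolding differentiable_def using bounded_bilinear.FDERIV by blast

lemmas differentiable_inner_left = differentiable_bounded_linear[OF bounded_linear_inner_left]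

lemma D_add:
  "f differentiable (at y) \<Longrightarrow> g differentiable (at y) \<Longrightarrow> D (\<lambda>z. f z + g z) y v = D f y v + D g y v"
  by (rule D_eqI[OF has_derivative_add]) (simp_all add: frechet_derivative_works[symmetric])

lemma D_diff:
  "f differentiable (at y) \<Longrightarrow> g differentiable (at y) \<Longrightarrow> D (\<lambda>z. f z - g z) y v = D f y v - D g y v"
  by (rule D_eqI[OF has_derivative_diff]) (simp_all add: frechet_derivative_works[symmetric])

lemma D_minus: "f differentiable (at y) \<Longrightarrow> D (\<lambda>z. - f z) y v = - D f y v"
  by (rule D_eqI[OF has_derivative_minus]) (simp add: frechet_derivative_works[symmetric])

lemma D_sum:
  "(\<And>j. j \<in> J \<Longrightarrow> f j differentiable (at y)) \<Longrightarrow> D (\<lambda>z. \<Sum>j\<in>J. f j z) y v = (\<Sum>j\<in>J. D (f j) y v)"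
  by (rule D_eqI[OF has_derivative_sum]) (simp add: frechet_derivative_works[symmetric])

lemma D_bilinear:
  assumes "bounded_bilinear B" "f differentiable (at y)" "g differentiable (at y)"
  shows "D (\<lambda>z. B (f z) (g z)) y v = B (f y) (D g y v) + B (D f y v) (g y)"
  by (rule D_eqI[OF bounded_bilinear.FDERIV[OF assms(1) assms(2)[unfolded frechet_derivative_works]
        assms(3)[unfolded frechet_derivative_works]]])

lemmas D_scaleR = D_bilinear[OF bounded_bilinear_scaleR]
lemmas D_inner = D_bilinear[OF bounded_bilinear_inner]
lemmas D_mult = D_bilinear[OF bounded_bilinear_mult]

lemma D_linear:
  assumes "bounded_linear L" "f differentiable (at y)"
  shows "D (\<lambda>z. L (f z)) y v = L (D f y v)"
  by (rule D_eqI[OF bounded_linear.has_derivative[OF assms(1) assms(2)[unfolded frechet_derivative_works]]])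

lemma D_vec_nth: "f differentiable (at y) \<Longrightarrow> D (\<lambda>z. f z $ i) y v = D f y v $ i"
  by (rule D_linear[OF bounded_linear_vec_nth])

lemma D_compose:
  assumes "f differentiable (at (g y))" "g differentiable (at y)"
  shows "D (\<lambda>z. f (g z)) y v = D f (g y) (D g y v)"
  by (rule D_eqI[OF has_derivative_compose[OF assms(2)[unfolded frechet_derivative_works]
        assms(1)[unfolded frechet_derivative_works]]])

text \<open>Product rule for a derivative applied to a moving vector field: one term differentiates
  \<open>f\<close> twice with the field frozen at \<open>y\<close>, the other differentiates the
  field.\<close>

lemma D_D_field:
  fixes f :: "'a::euclidean_space \<Rightarrow> 'b::real_normed_vector"
  assumes "open V" "smooth_on V f" "Y differentiable (at y)" "y \<in> V"
  shows "D (\<lambda>z. D f z (Y z)) y x = D (\<lambda>z. D f z (Y y)) y x + D f y (D Y y x)"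
proof -
  have e: "D f z w = (\<Sum>b\<in>Basis. (w \<bullet> b) *\<^sub>R D f z b)" if "z \<in> V" for z w
    using D_basis_expand[OF smooth_on_differentiable[OF assms(2,1) that]] .
  have dfb: "(\<lambda>z. D f z b) differentiable (at y)" for b
    using smooth_on_differentiable[OF smooth_on_D[OF assms(2)] assms(1,4)] .
  have *: "D (\<lambda>z. D f z (Z z)) y x = (\<Sum>b\<in>Basis. (Z y \<bullet> b) *\<^sub>R D (\<lambda>z. D f z b) y x + (D Z y x \<bullet> b) *\<^sub>R D f y b)"
    if Z: "Z differentiable (at y)" for Z
  proof -
    have dZ: "(\<lambda>z. Z z \<bullet> b) differentiable (at y)" for b
      using differentiable_inner_left[OF Z] .
    have d: "(\<lambda>z. (Z z \<bullet> b) *\<^sub>R D f z b) differentiable (at y)" for b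
      using differentiable_bounded_bilinear[OF bounded_bilinear_scaleR dZ dfb] .
    have "D (\<lambda>z. D f z (Z z)) y x = D (\<lambda>z. \<Sum>b\<in>Basis. (Z z \<bullet> b) *\<^sub>R D f z b) y x"
      by (rule D_cong_open[OF assms(1,4), symmetric]) (simp_all add: e[symmetric] d)
    also have "\<dots> = (\<Sum>b\<in>Basis. D (\<lambda>z. (Z z \<bullet> b) *\<^sub>R D f z b) y x)"
      by (rule D_sum[OF d])
    also have "\<dots> = (\<Sum>b\<in>Basis. (Z y \<bullet> b) *\<^sub>R D (\<lambda>z. D f z b) y x + (D Z y x \<bullet> b) *\<^sub>R D f y b)"
      by (simp only: D_scaleR[OF dZ dfb] D_linear[OF bounded_linear_inner_left Z])
    finally show ?thesis .
  qed
  have 0: "D (\<lambda>_. Y y) y x = 0" by simp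
  show ?thesis
    unfolding *[OF assms(3)] *[of "\<lambda>_. Y y", OF differentiable_const] 0 e[OF assms(4), of "D Y y x"]
    by (simp add: sum.distrib)
qed

section \<open>Frames of an affine hypersurface\<close>

lemma sum_option:
  fixes g :: "'a::finite option \<Rightarrow> 'b::comm_monoid_add"
  shows "(\<Sum>x\<in>UNIV. g x) = g None + (\<Sum>i\<in>UNIV. g (Some i))"
proof -
  have "(\<Sum>x\<in>UNIV. g x) = g None + (\<Sum>x\<in>range Some. g x)"
    unfolding UNIV_option_conv by (subst sum.insert) auto
  also have "(\<Sum>x\<in>range Some. g x) = (\<Sum>i\<in>UNIV. g (Some i))"
    by (subst sum.reindex) (auto simp: o_def)
  finally show ?thesis .
qed

lemma sum_kronecker:
  fixes g :: "'a::finite \<Rightarrow> real"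
  shows "(\<Sum>d\<in>UNIV. (if d = b then 1 else 0) * g d) = g b" "(\<Sum>d\<in>UNIV. (if b = d then 1 else 0) * g d) = g b"
    "(\<Sum>d\<in>UNIV. g d * (if d = b then 1 else 0)) = g b" "(\<Sum>d\<in>UNIV. g d * (if b = d then 1 else 0)) = g b"
  by (simp_all add: if_distrib[of "\<lambda>x. x * _"] if_distrib[of "\<lambda>x. _ * x"] cong: if_cong)

text \<open>Duality says that the square matrix with rows \<open>d\<close> is a left inverse of the
  one with columns \<open>e\<close>; the expansion is the statement that it is also a right
  inverse.\<close>

lemma dual_frame_expand:
  fixes e d :: "'n::finite \<Rightarrow> real ^ 'n"
  assumes "\<And>i j. d i \<bullet> e j = (if i = j then 1 else 0)"
  shows "x = (\<Sum>i\<in>UNIV. (d i \<bullet> x) *\<^sub>R e i)"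
proof -
  define A :: "real ^ 'n ^ 'n" where "A = (\<chi> i. d i)"
  define B :: "real ^ 'n ^ 'n" where "B = (\<chi> i j. e j $ i)"
  have "A ** B = mat 1"
    using assms by (simp add: vec_eq_iff A_def B_def matrix_matrix_mult_def mat_def inner_vec_def)
  then have "B ** A = mat 1" by (simp add: matrix_left_right_inverse)
  then have "x = B *v (A *v x)" by (simp add: matrix_vector_mul_assoc)
  also have "\<dots> = (\<Sum>i\<in>UNIV. (d i \<bullet> x) *\<^sub>R e i)"
    by (simp add: vec_eq_iff A_def B_def matrix_vector_mult_def inner_vec_def sum_component mult.commute)
  finally show ?thesis .
qed

section \<open>Gauss and Weingarten formulas of a parametrised hypersurface\<close>

locale affine_hypersurface =
  fixes U :: "(real ^ 'n::finite) set" and f \<xi> :: "real ^ 'n \<Rightarrow> real ^ 'n option"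
  assumes open_U: "open U" and immersion: "immersion_on U f" and normal: "affine_normal_on U f \<xi>"
begin

abbreviation "h \<equiv> affine_metric f \<xi>"

lemma smooth_f: "smooth_on U f"
  using immersion by (simp add: immersion_on_def)

lemma smooth_xi: "smooth_on U \<xi>"
  using normal by (simp add: affine_normal_on_def transversal_on_def)

lemma linear_Df: "y \<in> U \<Longrightarrow> linear (frechet_derivative f (at y))"
  using smooth_on_linear_D[OF smooth_f open_U] .

lemma decomp_unique:
  assumes y: "y \<in> U" and eq: "D f y v + s *\<^sub>R \<xi> y = D f y v' + s' *\<^sub>R \<xi> y"
  shows "v = v' \<and> s = s'"
proof -
  note l = linear_Df[OF y]
  have inj: "inj (frechet_derivative f (at y))" using immersion y by (simp add: immersion_on_def)
  have tr: "\<xi> y \<notin> range (frechet_derivative f (at y))"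
    using normal y by (simp add: affine_normal_on_def transversal_on_def)
  have s: "s = s'"
  proof (rule ccontr)
    assume "s \<noteq> s'"
    have "D f y (inverse (s - s') *\<^sub>R (v' - v)) = inverse (s - s') *\<^sub>R ((s - s') *\<^sub>R \<xi> y)"
    proof -
      have "D f y (v' - v) = (s - s') *\<^sub>R \<xi> y"
        using eq by (simp add: linear_diff[OF l] algebra_simps)
      then show ?thesis by (simp add: linear_cmul[OF l])
    qed
    then have "\<xi> y = D f y (inverse (s - s') *\<^sub>R (v' - v))" using \<open>s \<noteq> s'\<close> by simp
    then show False using tr by blast
  qed
  with eq inj show ?thesis by (auto dest: injD)
qed

lemma decomp_exists:
  assumes y: "y \<in> U" shows "\<exists>v s. w = D f y v + s *\<^sub>R \<xi> y"
proof -
  \<comment> \<open>Dimension count: the tangent coordinates and the coefficient of \<xi> fill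
    exactly the ambient type, so injectivity of \<open>L\<close> gives surjectivity.\<close>
  define L :: "real ^ 'n option \<Rightarrow> real ^ 'n option"
    where "L x = D f y (\<chi> i. x $ Some i) + x $ None *\<^sub>R \<xi> y" for x
  note l = linear_Df[OF y]
  have split: "(\<chi> i. (x + z) $ Some i) = (\<chi> i. x $ Some i) + (\<chi> i. z $ Some i)"
    "(\<chi> i. (c *\<^sub>R x) $ Some i) = c *\<^sub>R (\<chi> i. x $ Some i)" for x z :: "real ^ 'n option" and c
    by (simp_all add: vec_eq_iff)
  have "linear L"
    by (rule linearI) (simp_all only: L_def split linear_add[OF l] linear_cmul[OF l], simp_all add: algebra_simps)
  moreover have "inj L"
  proof (rule injI)
    fix x z assume "L x = L z"
    then have "(\<chi> i. x $ Some i) = (\<chi> i. z $ Some i) \<and> x $ None = z $ None"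
      using decomp_unique[OF y] unfolding L_def by blast
    then have "x $ i = z $ i" for i by (cases i) (auto simp: vec_eq_iff)
    then show "x = z" by (simp add: vec_eq_iff)
  qed
  ultimately have "surj L" using linear_injective_imp_surjective by blast
  then obtain x where "w = L x" by (metis surjD)
  then show ?thesis unfolding L_def by blast
qed

lemma decomp_parts:
  assumes y: "y \<in> U" and w: "w = D f y v + s *\<^sub>R \<xi> y"
  shows "tangential f \<xi> y w = v" "transversal_part f \<xi> y w = s"
  unfolding tangential_def transversal_part_def using w decomp_unique[OF y] by blast+

lemma decomp:
  assumes y: "y \<in> U"
  shows "w = D f y (tangential f \<xi> y w) + transversal_part f \<xi> y w *\<^sub>R \<xi> y"
  using decomp_exists[OF y, of w] decomp_parts[OF y] by metis

lemma linear_transversal_part: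
  assumes y: "y \<in> U" shows "linear (transversal_part f \<xi> y)"
proof (rule linearI)
  note l = linear_Df[OF y]
  fix w w' c
  show "transversal_part f \<xi> y (w + w') = transversal_part f \<xi> y w + transversal_part f \<xi> y w'"
  proof (rule decomp_parts(2)[OF y])
    show "w + w' = D f y (tangential f \<xi> y w + tangential f \<xi> y w')
      + (transversal_part f \<xi> y w + transversal_part f \<xi> y w') *\<^sub>R \<xi> y"
      by (subst (1) decomp[OF y, of w], subst (1) decomp[OF y, of w'])
        (simp add: linear_add[OF l] algebra_simps)
  qed
  show "transversal_part f \<xi> y (c *\<^sub>R w) = c *\<^sub>R transversal_part f \<xi> y w"
  proof (rule decomp_parts(2)[OF y])
    show "c *\<^sub>R w = D f y (c *\<^sub>R tangential f \<xi> y w) + (c *\<^sub>R transversal_part f \<xi> y w) *\<^sub>R \<xi> y"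
      by (subst (1) decomp[OF y, of w]) (simp add: linear_cmul[OF l] algebra_simps)
  qed
qed

lemma differentiable_Df: "y \<in> U \<Longrightarrow> (\<lambda>z. D f z w) differentiable (at y)"
  using smooth_on_differentiable[OF smooth_on_D[OF smooth_f] open_U] .

lemma linear_D2:
  assumes y: "y \<in> U" shows "linear (\<lambda>v. D (\<lambda>z. D f z w) y v)" "linear (\<lambda>w. D (\<lambda>z. D f z w) y v)"
proof -
  show "linear (\<lambda>v. D (\<lambda>z. D f z w) y v)" using linear_frechet_derivative[OF differentiable_Df[OF y]] .
  show "linear (\<lambda>w. D (\<lambda>z. D f z w) y v)"
  proof (rule linearI)
    fix w w' and c :: real
    have "D (\<lambda>z. D f z w + D f z w') y v = D (\<lambda>z. D f z (w + w')) y v"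
      by (rule D_cong_open[OF open_U y]) (auto simp: linear_add[OF linear_Df] intro: differentiable_add differentiable_Df[OF y])
    then show "D (\<lambda>z. D f z (w + w')) y v = D (\<lambda>z. D f z w) y v + D (\<lambda>z. D f z w') y v"
      by (simp add: D_add[OF differentiable_Df[OF y] differentiable_Df[OF y]])
    have "D (\<lambda>z. c *\<^sub>R D f z w) y v = D (\<lambda>z. D f z (c *\<^sub>R w)) y v"
      by (rule D_cong_open[OF open_U y])
        (auto simp: linear_cmul[OF linear_Df] intro!: differentiable_bounded_linear[OF bounded_linear_scaleR_right] differentiable_Df[OF y])
    then show "D (\<lambda>z. D f z (c *\<^sub>R w)) y v = c *\<^sub>R D (\<lambda>z. D f z w) y v"
      by (simp add: D_linear[OF bounded_linear_scaleR_right differentiable_Df[OF y]])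
  qed
qed

lemma linear_h:
  assumes y: "y \<in> U" shows "linear (\<lambda>v. h y v w)" "linear (\<lambda>w. h y v w)"
  unfolding affine_metric_def
  using linear_compose[OF linear_D2(1)[OF y] linear_transversal_part[OF y]]
    linear_compose[OF linear_D2(2)[OF y] linear_transversal_part[OF y]] by (auto simp: o_def)

text \<open>Valid for every \<open>\<Gamma>\<close>, because the difference tensor subtracts what is
  added back. The Levi-Civita \<open>\<Gamma>\<close> gives the splitting by K, while
  \<open>\<Gamma>\<close> = 0 gives the plain Gauss formula.\<close>

lemma D_Df:
  assumes y: "y \<in> U"
  shows "D (\<lambda>z. D f z w) y v = D f y (difference_tensor f \<xi> \<Gamma> y v w + \<Gamma> y v w) + h y v w *\<^sub>R \<xi> y"
  using decomp[OF y, of "D (\<lambda>z. D f z w) y v"]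
  by (simp add: affine_metric_def difference_tensor_def induced_conn_def cov_deriv_def)

lemma D_xi:
  assumes y: "y \<in> U" shows "D \<xi> y v = - D f y (shape_op f \<xi> y v)"
proof -
  have "transversal_part f \<xi> y (D \<xi> y v) = 0"
    using normal y unfolding affine_normal_on_def transversal_form_def by auto
  then show ?thesis using decomp[OF y, of "D \<xi> y v"]
    by (simp add: shape_op_def linear_neg[OF linear_Df[OF y]])
qed

end

section \<open>Orthonormal frames and their dual frames\<close>

locale orthonormal_frame = affine_hypersurface U f \<xi>
  for U :: "(real ^ 'n::finite) set" and f \<xi> :: "real ^ 'n \<Rightarrow> real ^ 'n option" +
  fixes V :: "(real ^ 'n) set" and E :: "'n \<Rightarrow> real ^ 'n \<Rightarrow> real ^ 'n"
  assumes open_V: "open V" and V_sub: "V \<subseteq> U" and smooth_E: "\<And>i. smooth_on V (E i)"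
    and orthonormal: "\<And>y i j. y \<in> V \<Longrightarrow> h y (E i y) (E j y) = (if i = j then 1 else 0)"
begin

definition X :: "'n \<Rightarrow> real ^ 'n \<Rightarrow> real ^ 'n option"
  where "X a y = D f y (E a y)"

definition frame_matrix :: "real ^ 'n \<Rightarrow> real ^ 'n option ^ 'n option"
  where "frame_matrix y = (\<chi> i. case i of Some a \<Rightarrow> X a y | None \<Rightarrow> \<xi> y)"

text \<open>The covector that kills the tangent space and is 1 on \<xi>, as a vector through the
  inner product. The form of a linear system makes \<open>smooth_on_solve\<close>
  applicable.\<close>

definition conormal :: "real ^ 'n \<Rightarrow> real ^ 'n option"
  where "conormal y = (SOME x. frame_matrix y *v x = axis None 1)"

text \<open>The conormal map \<nu> satisfies D\<nu>(X) . Y = - h(X, Y), so for an orthonormal frame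
  these derivatives are dual to the \<open>X a\<close>. Being derivatives of one map, they obey the
  same commutator identities as the \<open>X a\<close>, which are derivatives of
  \<open>f\<close>.\<close>

definition coframe :: "'n \<Rightarrow> real ^ 'n \<Rightarrow> real ^ 'n option"
  where "coframe a y = - D conormal y (E a y)"

lemma VU: "y \<in> V \<Longrightarrow> y \<in> U" using V_sub by auto

lemma smooth_f_V: "smooth_on V f" and smooth_xi_V: "smooth_on V \<xi>"
  using smooth_on_subset[OF smooth_f V_sub] smooth_on_subset[OF smooth_xi V_sub] by auto

lemma smooth_X: "smooth_on V (X a)"
  unfolding X_def[abs_def] by (rule smooth_on_D_field[OF open_V smooth_f_V smooth_E])

lemma E_expand: "y \<in> V \<Longrightarrow> v = (\<Sum>a\<in>UNIV. h y v (E a y) *\<^sub>R E a y)"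
proof -
  assume y: "y \<in> V"
  define d where "d a = (\<chi> i. h y (axis i 1) (E a y))" for a
  note l = linear_h(1)[OF VU[OF y]]
  have d: "d a \<bullet> v = h y v (E a y)" for a v
  proof -
    have "h y v (E a y) = h y (\<Sum>i\<in>UNIV. v $ i *\<^sub>R axis i 1) (E a y)"
      using basis_expansion[of v] by (simp add: scalar_mult_eq_scaleR)
    also have "\<dots> = (\<Sum>i\<in>UNIV. v $ i * h y (axis i 1) (E a y))"
      by (simp add: linear_sum[OF l] linear_cmul[OF l])
    finally show ?thesis by (simp add: d_def inner_vec_def mult.commute)
  qed
  have "v = (\<Sum>a\<in>UNIV. (d a \<bullet> v) *\<^sub>R E a y)"
    by (rule dual_frame_expand) (simp add: d orthonormal[OF y])
  then show ?thesis by (simp only: d)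
qed

lemma Df_expand: "y \<in> V \<Longrightarrow> D f y v = (\<Sum>a\<in>UNIV. h y v (E a y) *\<^sub>R X a y)"
proof -
  assume y: "y \<in> V"
  note l = linear_Df[OF VU[OF y]]
  have "D f y v = D f y (\<Sum>a\<in>UNIV. h y v (E a y) *\<^sub>R E a y)" by (rule arg_cong[OF E_expand[OF y]])
  then show ?thesis by (simp add: linear_sum[OF l] linear_cmul[OF l] X_def)
qed

lemma invertible_frame_matrix: "y \<in> V \<Longrightarrow> invertible (frame_matrix y)"
proof -
  assume y: "y \<in> V"
  have "x = 0" if "frame_matrix y *v x = 0" for x
  proof -
    have c: "(frame_matrix y $ i) \<bullet> x = 0" for i
      using that by (simp add: vec_eq_iff matrix_vector_mult_def inner_vec_def)
    have "X a y \<bullet> x = 0" "\<xi> y \<bullet> x = 0" for a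
      using c[of "Some a"] c[of None] by (simp_all add: frame_matrix_def)
    then have "D f y v \<bullet> x = 0" "\<xi> y \<bullet> x = 0" for v
      by (simp_all add: Df_expand[OF y] inner_sum_left)
    then have "x \<bullet> x = 0"
      by (subst (1) decomp[OF VU[OF y], of x]) (simp add: inner_add_left)
    then show ?thesis by simp
  qed
  then show ?thesis
    using matrix_left_invertible_ker invertible_left_inverse by blast
qed

lemma frame_matrix_conormal: "y \<in> V \<Longrightarrow> frame_matrix y *v conormal y = axis None 1"
proof -
  assume "y \<in> V"
  then obtain B where "frame_matrix y ** B = mat 1"
    using invertible_frame_matrix invertible_right_inverse by blast
  then have "frame_matrix y *v (B *v axis None 1) = axis None 1" by (simp add: matrix_vector_mul_assoc)
  then show ?thesis unfolding conormal_def by (rule someI)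
qed

lemma conormal_X: "y \<in> V \<Longrightarrow> conormal y \<bullet> X a y = 0"
  using arg_cong[OF frame_matrix_conormal, of y "\<lambda>x. x $ Some a"]
  by (simp add: frame_matrix_def matrix_vector_mult_def inner_vec_def axis_def mult.commute)

lemma conormal_xi: "y \<in> V \<Longrightarrow> conormal y \<bullet> \<xi> y = 1"
  using arg_cong[OF frame_matrix_conormal, of y "\<lambda>x. x $ None"]
  by (simp add: frame_matrix_def matrix_vector_mult_def inner_vec_def axis_def mult.commute)

lemma smooth_conormal: "smooth_on V conormal"
proof (rule smooth_on_solve[OF open_V])
  show "smooth_on V (\<lambda>y. frame_matrix y $ i $ j)" for i j
    using smooth_on_vec_nth[OF open_V smooth_X] smooth_on_vec_nth[OF open_V smooth_xi_V]
    by (cases i) (simp_all add: frame_matrix_def)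
  show "smooth_on V (\<lambda>y. axis None 1 :: real ^ 'n option)" by (rule smooth_on_const)
qed (auto simp: invertible_frame_matrix frame_matrix_conormal)

lemma smooth_coframe: "smooth_on V (coframe a)"
  unfolding coframe_def[abs_def]
  by (intro smooth_on_minus smooth_on_D_field open_V smooth_conormal smooth_E)

lemma diffV:
  assumes "y \<in> V"
  shows "f differentiable (at y)" "\<xi> differentiable (at y)" "E a differentiable (at y)"
    "X a differentiable (at y)" "conormal differentiable (at y)" "coframe a differentiable (at y)"
  using smooth_on_differentiable[OF _ open_V assms] smooth_f_V smooth_xi_V smooth_E smooth_X
    smooth_conormal smooth_coframe by blast+

lemma D_X:
  assumes y: "y \<in> V"
  shows "D (X b) y (E a y) =
    D f y (difference_tensor f \<xi> \<Gamma> y (E a y) (E b y) + cov_deriv \<Gamma> (E a) (E b) y) + (if a = b then \<xi> y else 0)"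
proof -
  have "D (X b) y (E a y) = D (\<lambda>z. D f z (E b y)) y (E a y) + D f y (D (E b) y (E a y))"
    unfolding X_def[abs_def] by (rule D_D_field[OF open_V smooth_f_V diffV(3)[OF y] y])
  then show ?thesis
    by (simp add: D_Df[OF VU[OF y], of _ _ \<Gamma>] orthonormal[OF y] cov_deriv_def linear_add[OF linear_Df[OF VU[OF y]]])
qed

text \<open>Obtained by differentiating \<open>conormal z \<bullet> X b z = 0\<close> along
  \<open>E a\<close>: the conormal sees only the \<xi>-part of the derivative of \<open>X b\<close>,
  and this is h(E_a, E_b).\<close>

lemma coframe_X: assumes y: "y \<in> V" shows "coframe a y \<bullet> X b y = (if a = b then 1 else 0)"
proof -
  have "D (\<lambda>z. conormal z \<bullet> X b z) y (E a y) = D (\<lambda>_. 0) y (E a y)"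
    by (rule D_cong_open[OF open_V y])
      (auto simp: conormal_X intro: differentiable_bounded_bilinear[OF bounded_bilinear_inner] diffV[OF y])
  then have "conormal y \<bullet> D (X b) y (E a y) + D conormal y (E a y) \<bullet> X b y = 0"
    by (simp add: D_inner[OF diffV(5)[OF y] diffV(4)[OF y]])
  moreover have "conormal y \<bullet> D (X b) y (E a y) = (if a = b then 1 else 0)"
    unfolding D_X[OF y, of _ _ "\<lambda>_ _ _. 0"]
    by (simp add: inner_add_right Df_expand[OF y] inner_sum_right conormal_X[OF y] conormal_xi[OF y])
  ultimately show ?thesis by (simp add: coframe_def)
qed

lemma coframe_xi: assumes y: "y \<in> V" shows "coframe a y \<bullet> \<xi> y = 0"
proof -
  have "D (\<lambda>z. conormal z \<bullet> \<xi> z) y (E a y) = D (\<lambda>_. 1) y (E a y)"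
    by (rule D_cong_open[OF open_V y])
      (auto simp: conormal_xi intro: differentiable_bounded_bilinear[OF bounded_bilinear_inner] diffV[OF y])
  then have "conormal y \<bullet> D \<xi> y (E a y) + D conormal y (E a y) \<bullet> \<xi> y = 0"
    by (simp add: D_inner[OF diffV(5)[OF y] diffV(2)[OF y]])
  moreover have "conormal y \<bullet> D \<xi> y (E a y) = 0"
    by (simp add: D_xi[OF VU[OF y]] Df_expand[OF y] inner_sum_right conormal_X[OF y])
  ultimately show ?thesis by (simp add: coframe_def)
qed

lemma coframe_Df: "y \<in> V \<Longrightarrow> coframe a y \<bullet> D f y v = h y v (E a y)"
  by (simp add: Df_expand inner_sum_right coframe_X if_distrib cong: if_cong)

lemma h_expand: assumes y: "y \<in> V" shows "h y v w = (\<Sum>c\<in>UNIV. h y v (E c y) * h y w (E c y))"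
proof -
  note l = linear_h(2)[OF VU[OF y]]
  have "h y v w = h y v (\<Sum>c\<in>UNIV. h y w (E c y) *\<^sub>R E c y)" by (rule arg_cong[OF E_expand[OF y]])
  then show ?thesis by (simp add: linear_sum[OF l] linear_cmul[OF l] mult.commute)
qed

lemma h_sym: assumes y: "y \<in> V" shows "h y v w = h y w v"
proof -
  have "h y v w = (\<Sum>c\<in>UNIV. h y v (E c y) * h y w (E c y))" by (rule h_expand[OF y])
  also have "\<dots> = (\<Sum>c\<in>UNIV. h y w (E c y) * h y v (E c y))" by (simp add: mult.commute)
  also have "\<dots> = h y w v" by (rule h_expand[OF y, symmetric])
  finally show ?thesis .
qed

text \<open>Metric compatibility applied to orthonormal fields. Compatibility is stated for fields
  smooth on all of \<open>U\<close>, while the frame is smooth on \<open>V\<close> only; hence it is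
  applied to the constant fields with the values of the frame at \<open>y\<close>.\<close>

lemma cov_deriv_skew:
  assumes LC: "levi_civita_on U h \<Gamma>" and y: "y \<in> V"
  shows "h y (cov_deriv \<Gamma> (E a) (E b) y) (E c y) = - h y (cov_deriv \<Gamma> (E a) (E c) y) (E b y)"
proof -
  let ?x = "E a y"
  \<comment> \<open>On \<open>V\<close> this is h(v, E_d), in a form whose smoothness in the base
    point is visible; h becomes a sum of squares of such forms.\<close>
  define \<theta> where "\<theta> d z v = coframe d z \<bullet> D f z v" for d z v
  have \<theta>h: "\<theta> d z v = h z v (E d z)" if "z \<in> V" for d z v
    using coframe_Df[OF that] by (simp add: \<theta>_def)
  have sDf: "smooth_on V (\<lambda>z. D f z v)" for v by (rule smooth_on_D[OF smooth_f_V])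
  have d\<theta>: "(\<lambda>z. \<theta> d z v) differentiable (at y)" for d v
    unfolding \<theta>_def using smooth_on_differentiable[OF smooth_on_inner[OF open_V smooth_coframe sDf] open_V y] .
  \<comment> \<open>The pairing of the d-th form with the moving field \<open>E e\<close> is
    constant, so freezing \<open>E e\<close> at \<open>y\<close> costs exactly minus the derivative
    of \<open>E e\<close>.\<close>
  have 1: "D (\<lambda>z. \<theta> d z (E e y)) y ?x = - h y (D (E e) y ?x) (E d y)" for d e
  proof -
    have "D (\<lambda>z. coframe d z \<bullet> X e z) y ?x = D (\<lambda>_. if d = e then 1 else 0) y ?x"
      by (rule D_cong_open[OF open_V y])
        (auto simp: coframe_X intro: differentiable_bounded_bilinear[OF bounded_bilinear_inner] diffV[OF y])
    then have "coframe d y \<bullet> D (X e) y ?x + D (coframe d) y ?x \<bullet> X e y = 0"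
      by (simp add: D_inner[OF diffV(6)[OF y] diffV(4)[OF y]])
    moreover have "D (X e) y ?x = D (\<lambda>z. D f z (E e y)) y ?x + D f y (D (E e) y ?x)"
      unfolding X_def[abs_def] by (rule D_D_field[OF open_V smooth_f_V diffV(3)[OF y] y])
    moreover have "D (\<lambda>z. \<theta> d z (E e y)) y ?x
        = coframe d y \<bullet> D (\<lambda>z. D f z (E e y)) y ?x + D (coframe d) y ?x \<bullet> X e y"
      unfolding \<theta>_def X_def
      by (rule D_inner[OF diffV(6)[OF y] differentiable_Df[OF VU[OF y]]])
    ultimately show ?thesis by (simp add: inner_add_right coframe_Df[OF y])
  qed
  have "D (\<lambda>z. \<Sum>d\<in>UNIV. \<theta> d z (E b y) * \<theta> d z (E c y)) y ?x = D (\<lambda>z. h z (E b y) (E c y)) y ?x"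
    by (rule D_cong_open[OF open_V y]) (auto simp: \<theta>h h_expand[symmetric] intro!: differentiable_sum differentiable_mult d\<theta>)
  moreover have "D (\<lambda>z. \<Sum>d\<in>UNIV. \<theta> d z (E b y) * \<theta> d z (E c y)) y ?x
      = (\<Sum>d\<in>UNIV. \<theta> d y (E b y) * D (\<lambda>z. \<theta> d z (E c y)) y ?x + D (\<lambda>z. \<theta> d z (E b y)) y ?x * \<theta> d y (E c y))"
    by (subst D_sum) (auto simp: D_mult[OF d\<theta> d\<theta>] intro!: differentiable_mult d\<theta>)
  moreover have "\<dots> = - h y (D (E c) y ?x) (E b y) - h y (D (E b) y ?x) (E c y)"
    by (simp only: 1 \<theta>h[OF y] orthonormal[OF y] sum.distrib sum_kronecker)
  moreover have "D (\<lambda>z. h z (E b y) (E c y)) y ?x = h y (\<Gamma> y ?x (E b y)) (E c y) + h y (E b y) (\<Gamma> y ?x (E c y))"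
  proof -
    have "\<forall>X Y Z. smooth_on U X \<and> smooth_on U Y \<and> smooth_on U Z \<longrightarrow>
      (\<forall>y\<in>U. D (\<lambda>z. h z (Y z) (Z z)) y (X y) =
        h y (cov_deriv \<Gamma> X Y y) (Z y) + h y (Y y) (cov_deriv \<Gamma> X Z y))"
      using LC unfolding levi_civita_on_def by blast
    from this[rule_format, of "\<lambda>_. ?x" "\<lambda>_. E b y" "\<lambda>_. E c y" y] show ?thesis
      by (simp add: smooth_on_const VU[OF y] cov_deriv_def)
  qed
  moreover have "h y (E b y) (\<Gamma> y ?x (E c y)) = h y (\<Gamma> y ?x (E c y)) (E b y)"
    by (rule h_sym[OF y])
  ultimately show ?thesis
    by (simp add: cov_deriv_def linear_add[OF linear_h(1)[OF VU[OF y]]])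
qed

end

section \<open>Symmetry of the second derivative\<close>

lemma has_real_derivative_line:
  fixes g :: "'a::real_normed_vector \<Rightarrow> real"
  assumes "g differentiable (at (p + s *\<^sub>R v))"
  shows "((\<lambda>s. g (p + s *\<^sub>R v)) has_real_derivative D g (p + s *\<^sub>R v) v) (at s)"
proof -
  have "((\<lambda>s. p + s *\<^sub>R v) has_derivative (\<lambda>h. h *\<^sub>R v)) (at s)"
    by (auto intro!: derivative_eq_intros)
  from has_derivative_compose[OF this assms[unfolded frechet_derivative_works]]
  have "((\<lambda>s. g (p + s *\<^sub>R v)) has_derivative (\<lambda>h. D g (p + s *\<^sub>R v) (h *\<^sub>R v))) (at s)" .
  moreover have "D g (p + s *\<^sub>R v) (h *\<^sub>R v) = D g (p + s *\<^sub>R v) v * h" for h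
    using linear_cmul[OF linear_frechet_derivative[OF assms]] by (simp add: mult.commute)
  ultimately show ?thesis by (simp add: has_field_derivative_def)
qed

text \<open>The mean value theorem is used twice, first in direction \<open>v\<close>, then in
  direction \<open>w\<close>. The second difference on the left is symmetric in \<open>v\<close> and
  \<open>w\<close>, the right side is not visibly so.\<close>

lemma second_difference_mvt:
  fixes g :: "'a::real_normed_vector \<Rightarrow> real"
  assumes g: "smooth_on V g" "open V" and sub: "ball y e \<subseteq> V" and h: "h > 0" "h * (norm v + norm w) < e"
  shows "\<exists>z\<in>ball y e. g (y + h *\<^sub>R v + h *\<^sub>R w) - g (y + h *\<^sub>R v) - g (y + h *\<^sub>R w) + g y
    = h\<^sup>2 * D (\<lambda>z. D g z v) z w"
proof -
  have inb: "y + s *\<^sub>R v + t *\<^sub>R w \<in> ball y e" if "0 \<le> s" "s \<le> h" "0 \<le> t" "t \<le> h" for s t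
  proof -
    have "norm (s *\<^sub>R v + t *\<^sub>R w) \<le> s * norm v + t * norm w"
      using norm_triangle_ineq[of "s *\<^sub>R v" "t *\<^sub>R w"] that by simp
    also have "\<dots> \<le> h * norm v + h * norm w" using that by (intro add_mono mult_right_mono) auto
    also have "\<dots> < e" using h by (simp add: algebra_simps)
    finally have "norm (s *\<^sub>R v + t *\<^sub>R w) < e" .
    moreover have "dist y (y + s *\<^sub>R v + t *\<^sub>R w) = norm (s *\<^sub>R v + t *\<^sub>R w)"
      by (metis add.assoc add_diff_cancel_left' dist_norm dist_commute)
    ultimately show ?thesis by simp
  qed
  have dg: "g differentiable (at z)" if "z \<in> ball y e" for z
    using smooth_on_differentiable[OF g] that sub by blast
  have dDg: "(\<lambda>z. D g z v) differentiable (at z)" if "z \<in> ball y e" for z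
    using smooth_on_differentiable[OF smooth_on_D[OF g(1)] g(2)] that sub by blast
  have 1: "((\<lambda>s. g (y + t *\<^sub>R w + s *\<^sub>R v)) has_real_derivative D g (y + t *\<^sub>R w + s *\<^sub>R v) v) (at s)"
    if "0 \<le> s" "s \<le> h" "0 \<le> t" "t \<le> h" for s t
    using has_real_derivative_line[of g "y + t *\<^sub>R w" s v] dg[OF inb[OF that]] by (simp add: add_ac)
  have "\<exists>s>0. s < h \<and> (g (y + h *\<^sub>R w + h *\<^sub>R v) - g (y + 0 *\<^sub>R w + h *\<^sub>R v)) - (g (y + h *\<^sub>R w + 0 *\<^sub>R v) - g (y + 0 *\<^sub>R w + 0 *\<^sub>R v))
      = (h - 0) * (D g (y + h *\<^sub>R w + s *\<^sub>R v) v - D g (y + 0 *\<^sub>R w + s *\<^sub>R v) v)"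
    by (rule MVT2[OF h(1)]) (use h(1) in \<open>intro DERIV_diff 1; simp\<close>)
  then obtain s where s: "0 < s" "s < h" and
    es: "(g (y + h *\<^sub>R w + h *\<^sub>R v) - g (y + 0 *\<^sub>R w + h *\<^sub>R v)) - (g (y + h *\<^sub>R w + 0 *\<^sub>R v) - g (y + 0 *\<^sub>R w + 0 *\<^sub>R v))
      = (h - 0) * (D g (y + h *\<^sub>R w + s *\<^sub>R v) v - D g (y + 0 *\<^sub>R w + s *\<^sub>R v) v)" by blast
  have 2: "((\<lambda>t. D g (y + s *\<^sub>R v + t *\<^sub>R w) v) has_real_derivative D (\<lambda>z. D g z v) (y + s *\<^sub>R v + t *\<^sub>R w) w) (at t)"
    if "0 \<le> t" "t \<le> h" for t
    using has_real_derivative_line[of "\<lambda>z. D g z v" "y + s *\<^sub>R v" t w] dDg[OF inb] s that by simp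
  have "\<exists>t>0. t < h \<and> D g (y + s *\<^sub>R v + h *\<^sub>R w) v - D g (y + s *\<^sub>R v + 0 *\<^sub>R w) v
      = (h - 0) * D (\<lambda>z. D g z v) (y + s *\<^sub>R v + t *\<^sub>R w) w"
    by (rule MVT2[OF h(1)]) (rule 2)
  then obtain t where t: "0 < t" "t < h" and
    et: "D g (y + s *\<^sub>R v + h *\<^sub>R w) v - D g (y + s *\<^sub>R v + 0 *\<^sub>R w) v
      = (h - 0) * D (\<lambda>z. D g z v) (y + s *\<^sub>R v + t *\<^sub>R w) w" by blast
  show ?thesis
  proof (rule bexI)
    show "y + s *\<^sub>R v + t *\<^sub>R w \<in> ball y e" using inb s t by simp
    show "g (y + h *\<^sub>R v + h *\<^sub>R w) - g (y + h *\<^sub>R v) - g (y + h *\<^sub>R w) + g y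
      = h\<^sup>2 * D (\<lambda>z. D g z v) (y + s *\<^sub>R v + t *\<^sub>R w) w"
      using es et by (simp add: add_ac power2_eq_square)
  qed
qed

text \<open>Both mixed derivatives, taken at points close to \<open>y\<close>, equal the same second
  difference quotient. By continuity they cannot differ at \<open>y\<close> itself.\<close>

lemma D2_symmetric_real:
  fixes g :: "'a::real_normed_vector \<Rightarrow> real"
  assumes g: "smooth_on V g" "open V" and y: "y \<in> V"
  shows "D (\<lambda>z. D g z v) y w = D (\<lambda>z. D g z w) y v"
proof (rule ccontr)
  let ?A = "\<lambda>z. D (\<lambda>z. D g z v) z w" and ?B = "\<lambda>z. D (\<lambda>z. D g z w) z v"
  assume ne: "?A y \<noteq> ?B y"
  define d where "d = \<bar>?A y - ?B y\<bar> / 2"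
  have d: "d > 0" using ne by (simp add: d_def)
  have "continuous_on V ?A" "continuous_on V ?B"
    using smooth_on_continuous[OF smooth_on_D[OF smooth_on_D[OF g(1)]]] by auto
  then have "isCont ?A y" "isCont ?B y" using continuous_on_eq_continuous_at[OF g(2)] y by auto
  then obtain e1 e2 where e: "e1 > 0" "\<And>z. dist z y < e1 \<Longrightarrow> dist (?A z) (?A y) < d"
    "e2 > 0" "\<And>z. dist z y < e2 \<Longrightarrow> dist (?B z) (?B y) < d"
    using d unfolding continuous_at_eps_delta by metis
  obtain e3 where e3: "e3 > 0" "ball y e3 \<subseteq> V" using g(2) y open_contains_ball by blast
  define e where "e = min e1 (min e2 e3)"
  have e0: "e > 0" "ball y e \<subseteq> V" using e e3 by (auto simp: e_def)
  \<comment> \<open>Small enough for the parallelogram spanned by \<open>h v\<close> and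
    \<open>h w\<close> to stay in the ball; the summand 1 keeps the denominator nonzero when both
    vectors vanish.\<close>
  define h where "h = e / (2 * (norm v + norm w + 1))"
  have n: "0 < norm v + norm w + 1" using norm_ge_zero[of v] norm_ge_zero[of w] by linarith
  have h: "h > 0" using e0 n by (simp add: h_def)
  have "h * (norm v + norm w) < h * (2 * (norm v + norm w + 1))"
  proof (rule mult_strict_left_mono[OF _ h])
    show "norm v + norm w < 2 * (norm v + norm w + 1)" using n by simp
  qed
  also have "\<dots> = e" using n by (simp add: h_def)
  finally have he: "h * (norm v + norm w) < e" .
  then have he': "h * (norm w + norm v) < e" by (simp add: add.commute)
  obtain z z' where z: "z \<in> ball y e" "z' \<in> ball y e" "h\<^sup>2 * ?A z = h\<^sup>2 * ?B z'"
    using second_difference_mvt[OF g e0(2) h he] second_difference_mvt[OF g e0(2) h he']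
    by (fastforce simp: algebra_simps)
  then have "?A z = ?B z'" using h by simp
  moreover have "dist (?A z) (?A y) < d" "dist (?B z') (?B y) < d"
    using z(1,2) e(2)[of z] e(4)[of z'] by (simp_all add: e_def dist_commute)
  moreover have "\<not> (\<bar>x - p\<bar> < \<bar>p - q\<bar> / 2 \<and> \<bar>x - q\<bar> < \<bar>p - q\<bar> / 2)" for x p q :: real
    by (auto simp: abs_if split: if_splits)
  ultimately show False unfolding d_def dist_real_def by metis
qed

lemma D2_symmetric:
  fixes g :: "'a::real_normed_vector \<Rightarrow> 'b::euclidean_space"
  assumes g: "smooth_on V g" "open V" and y: "y \<in> V"
  shows "D (\<lambda>z. D g z v) y w = D (\<lambda>z. D g z w) y v"
proof (rule euclidean_eqI)
  fix b :: 'b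
  have s: "smooth_on V (\<lambda>z. g z \<bullet> b)" by (intro smooth_on_inner g smooth_on_const)
  have *: "D (\<lambda>z. D (\<lambda>z. g z \<bullet> b) z u) y u' = D (\<lambda>z. D g z u) y u' \<bullet> b" for u u'
  proof -
    have "D (\<lambda>z. D (\<lambda>z. g z \<bullet> b) z u) y u' = D (\<lambda>z. D g z u \<bullet> b) y u'"
      by (rule D_cong_open[OF g(2) y])
        (auto intro: D_linear[OF bounded_linear_inner_left] smooth_on_differentiable[OF g]
          smooth_on_differentiable[OF smooth_on_D[OF s] g(2) y])
    then show ?thesis
      using D_linear[OF bounded_linear_inner_left smooth_on_differentiable[OF smooth_on_D[OF g(1)] g(2) y]] by simp
  qed
  show "D (\<lambda>z. D g z v) y w \<bullet> b = D (\<lambda>z. D g z w) y v \<bullet> b"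
    using D2_symmetric_real[OF s g(2) y, of v w] by (simp add: *)
qed

section \<open>Structure equations\<close>

context orthonormal_frame begin

text \<open>Coefficients of the Blaschke connection in the frame. The indices are direction,
  differentiated field and component, in this order.\<close>

definition conn :: "'n \<Rightarrow> 'n \<Rightarrow> 'n \<Rightarrow> real ^ 'n \<Rightarrow> real"
  where "conn a b c y = coframe c y \<bullet> D (X b) y (E a y)"

lemma smooth_conn: "smooth_on V (conn a b c)"
  unfolding conn_def[abs_def]
  by (rule smooth_on_inner[OF open_V smooth_coframe smooth_on_D_field[OF open_V smooth_X smooth_E]])

lemma frame_expand:
  assumes y: "y \<in> V"
  shows "x = (\<Sum>c\<in>UNIV. (coframe c y \<bullet> x) *\<^sub>R X c y) + (conormal y \<bullet> x) *\<^sub>R \<xi> y"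
    "x = (\<Sum>c\<in>UNIV. (X c y \<bullet> x) *\<^sub>R coframe c y) + (\<xi> y \<bullet> x) *\<^sub>R conormal y"
proof -
  define d e where "d = (\<lambda>i. case i of Some c \<Rightarrow> coframe c y | None \<Rightarrow> conormal y)"
    and "e = (\<lambda>i. case i of Some c \<Rightarrow> X c y | None \<Rightarrow> \<xi> y)"
  have de: "d i \<bullet> e j = (if i = j then 1 else 0)" for i j
    by (auto simp: d_def e_def coframe_X coframe_xi conormal_X conormal_xi y split: option.split)
  then have ed: "e i \<bullet> d j = (if i = j then 1 else 0)" for i j
    using de[of j i] by (auto simp: inner_commute)
  show "x = (\<Sum>c\<in>UNIV. (coframe c y \<bullet> x) *\<^sub>R X c y) + (conormal y \<bullet> x) *\<^sub>R \<xi> y"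
    using dual_frame_expand[of d e x, OF de] unfolding sum_option by (simp add: d_def e_def add.commute)
  show "x = (\<Sum>c\<in>UNIV. (X c y \<bullet> x) *\<^sub>R coframe c y) + (\<xi> y \<bullet> x) *\<^sub>R conormal y"
    using dual_frame_expand[of e d x, OF ed] unfolding sum_option by (simp add: d_def e_def add.commute)
qed

lemma conormal_D_X:
  assumes y: "y \<in> V" shows "conormal y \<bullet> D (X b) y (E a y) = (if a = b then 1 else 0)"
  unfolding D_X[OF y, of _ _ "\<lambda>_ _ _. 0"]
  by (simp add: inner_add_right Df_expand[OF y] inner_sum_right conormal_X[OF y] conormal_xi[OF y])

lemma D_X_conn:
  assumes y: "y \<in> V"
  shows "D (X b) y (E a y) = (\<Sum>c\<in>UNIV. conn a b c y *\<^sub>R X c y) + (if a = b then \<xi> y else 0)"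
  by (subst frame_expand(1)[OF y, of "D (X b) y (E a y)"]) (simp add: conn_def conormal_D_X[OF y])

lemma coframe_D_xi: "y \<in> V \<Longrightarrow> coframe c y \<bullet> D \<xi> y (E a y) = - h y (shape_op f \<xi> y (E a y)) (E c y)"
  by (simp add: D_xi VU coframe_Df)

lemma D_coframe_X:
  assumes y: "y \<in> V" shows "D (coframe c) y (E a y) \<bullet> X b y = - conn a b c y"
proof -
  have "D (\<lambda>z. coframe c z \<bullet> X b z) y (E a y) = D (\<lambda>_. if c = b then 1 else 0) y (E a y)"
    by (rule D_cong_open[OF open_V y])
      (auto simp: coframe_X intro: differentiable_bounded_bilinear[OF bounded_bilinear_inner] diffV[OF y])
  then show ?thesis by (simp add: D_inner[OF diffV(6)[OF y] diffV(4)[OF y]] conn_def)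
qed

lemma D_coframe_xi:
  assumes y: "y \<in> V"
  shows "D (coframe c) y (E a y) \<bullet> \<xi> y = h y (shape_op f \<xi> y (E a y)) (E c y)"
proof -
  have "D (\<lambda>z. coframe c z \<bullet> \<xi> z) y (E a y) = D (\<lambda>_. 0) y (E a y)"
    by (rule D_cong_open[OF open_V y])
      (auto simp: coframe_xi intro: differentiable_bounded_bilinear[OF bounded_bilinear_inner] diffV[OF y])
  then show ?thesis by (simp add: D_inner[OF diffV(6)[OF y] diffV(2)[OF y]] coframe_D_xi[OF y])
qed

lemma D_coframe:
  assumes y: "y \<in> V"
  shows "D (coframe c) y (E a y)
    = (\<Sum>d\<in>UNIV. - conn a d c y *\<^sub>R coframe d y) + h y (shape_op f \<xi> y (E a y)) (E c y) *\<^sub>R conormal y"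
  by (subst frame_expand(2)[OF y, of "D (coframe c) y (E a y)"])
    (simp add: D_coframe_X[OF y] D_coframe_xi[OF y] inner_commute[of "X _ _"] inner_commute[of "\<xi> _"])

lemma D_E_expand:
  fixes G :: "real ^ 'n \<Rightarrow> 'b::real_normed_vector"
  assumes "G differentiable (at y)" "y \<in> V"
  shows "D G y v = (\<Sum>c\<in>UNIV. h y v (E c y) *\<^sub>R D G y (E c y))"
proof -
  note l = linear_frechet_derivative[OF assms(1)]
  have "D G y v = D G y (\<Sum>c\<in>UNIV. h y v (E c y) *\<^sub>R E c y)" by (rule arg_cong[OF E_expand[OF assms(2)]])
  then show ?thesis by (simp add: linear_sum[OF l] linear_cmul[OF l])
qed

lemma second_derivatives_bracket:
  fixes G :: "real ^ 'n \<Rightarrow> 'b::euclidean_space"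
  assumes G: "smooth_on V G" and y: "y \<in> V"
  shows "D (\<lambda>z. D G z (E b z)) y (E a y) - D (\<lambda>z. D G z (E a z)) y (E b y)
    = D G y (D (E b) y (E a y) - D (E a) y (E b y))"
  using D_D_field[OF open_V G diffV(3)[OF y] y, of b "E a y"] D_D_field[OF open_V G diffV(3)[OF y] y, of a "E b y"]
    D2_symmetric[OF G open_V y, of "E b y" "E a y"] linear_diff[OF smooth_on_linear_D[OF G open_V y]]
  by simp

text \<open>The second derivatives in a moving frame fail to commute by the Lie bracket. Its
  components are read off from the special case where the map is \<open>f\<close>, whose first
  derivatives are the \<open>X c\<close>.\<close>

lemma commutator:
  fixes G :: "real ^ 'n \<Rightarrow> 'b::euclidean_space"
  assumes G: "smooth_on V G" and y: "y \<in> V"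
  shows "D (\<lambda>z. D G z (E b z)) y (E a y) - D (\<lambda>z. D G z (E a z)) y (E b y)
    = (\<Sum>c\<in>UNIV. (conn a b c y - conn b a c y) *\<^sub>R D G y (E c y))"
proof -
  let ?B = "D (E b) y (E a y) - D (E a) y (E b y)"
  have "h y ?B (E c y) = conn a b c y - conn b a c y" for c
  proof -
    have "h y ?B (E c y) = coframe c y \<bullet> D f y ?B" by (simp add: coframe_Df[OF y])
    also have "D f y ?B = D (X b) y (E a y) - D (X a) y (E b y)"
      using second_derivatives_bracket[OF smooth_f_V y, of b a] by (simp add: X_def[abs_def])
    finally show ?thesis by (simp add: conn_def inner_diff_right)
  qed
  then show ?thesis
    using second_derivatives_bracket[OF G y, of b a] D_E_expand[OF smooth_on_differentiable[OF G open_V y] y, of ?B]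
    by simp
qed

end


section \<open>Integrability conditions under the SO(n-1) symmetry\<close>

locale symmetric_hypersurface =
  orthonormal_frame U f \<xi> V E
  for U :: "(real ^ 'k::finite option) set" and f \<xi> V and E :: "'k option \<Rightarrow> real ^ 'k option \<Rightarrow> real ^ 'k option" +
  fixes \<Gamma> :: "real ^ 'k option \<Rightarrow> real ^ 'k option \<Rightarrow> real ^ 'k option \<Rightarrow> real ^ 'k option"
    and a b r \<sigma> :: "real ^ 'k option \<Rightarrow> real"
  assumes LC: "levi_civita_on U h \<Gamma>" and card: "CARD('k) \<ge> 2"
    and smooth_a: "smooth_on V a" and smooth_b: "smooth_on V b" and smooth_r: "smooth_on V r"
    and r_pos: "\<And>y. y \<in> V \<Longrightarrow> r y > 0"
    and shape: "\<And>y. y \<in> V \<Longrightarrow> shape_op f \<xi> y (E None y) = a y *\<^sub>R E None y"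
      "\<And>y i. y \<in> V \<Longrightarrow> shape_op f \<xi> y (E (Some i) y) = b y *\<^sub>R E (Some i) y"
    and K: "\<And>y. y \<in> V \<Longrightarrow>
        difference_tensor f \<xi> \<Gamma> y (E None y) (E None y) = (real CARD('k) * r y) *\<^sub>R E None y"
      "\<And>y i. y \<in> V \<Longrightarrow> difference_tensor f \<xi> \<Gamma> y (E None y) (E (Some i) y) = - r y *\<^sub>R E (Some i) y"
      "\<And>y i. y \<in> V \<Longrightarrow> difference_tensor f \<xi> \<Gamma> y (E (Some i) y) (E None y) = - r y *\<^sub>R E (Some i) y"
      "\<And>y i j. y \<in> V \<Longrightarrow> difference_tensor f \<xi> \<Gamma> y (E (Some i) y) (E (Some j) y) =
        (if i = j then - r y *\<^sub>R E None y else 0)"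
    and sigma: "\<And>y i. y \<in> V \<Longrightarrow> cov_deriv \<Gamma> (E (Some i)) (E None) y = \<sigma> y *\<^sub>R E (Some i) y"
begin

definition \<alpha> where "\<alpha> y = \<sigma> y - r y"
definition \<beta> where "\<beta> y = \<sigma> y + r y"

lemma conn_h:
  assumes y: "y \<in> V"
  shows "conn c d e y = h y (difference_tensor f \<xi> \<Gamma> y (E c y) (E d y)) (E e y)
    + h y (cov_deriv \<Gamma> (E c) (E d) y) (E e y)"
  unfolding conn_def D_X[OF y, of _ _ \<Gamma>]
  by (simp add: inner_add_right coframe_Df[OF y] coframe_xi[OF y] linear_add[OF linear_h(1)[OF VU[OF y]]])

lemma h_E:
  assumes y: "y \<in> V"
  shows "h y (s *\<^sub>R v) w = s * h y v w" "h y 0 w = 0" "h y (- v) w = - h y v w"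
    "h y (E c y) (E d y) = (if c = d then 1 else 0)"
  using linear_cmul[OF linear_h(1)[OF VU[OF y]]] linear_0[OF linear_h(1)[OF VU[OF y]]]
    linear_neg[OF linear_h(1)[OF VU[OF y]]] orthonormal[OF y] by auto

text \<open>Each coefficient is a K-part plus a Levi-Civita part, and the latter is skew in its last
  two indices. In the mixed coefficients K contributes - r and the Levi-Civita part contributes
  \<sigma> or - \<sigma>, which is why \<sigma> - r and \<sigma> + r are the natural
  unknowns.\<close>

lemma conn_values:
  assumes y: "y \<in> V"
  shows "conn (Some i) None None y = 0"
    and "conn (Some i) None (Some j) y = (if i = j then \<alpha> y else 0)"
    and "conn (Some i) (Some j) None y = (if i = j then - \<beta> y else 0)"
    and "conn (Some i) (Some j) (Some m) y = - conn (Some i) (Some m) (Some j) y"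
    and "conn None None None y = CARD('k) * r y"
    and "conn None (Some i) None y = - conn None None (Some i) y"
    and "conn None (Some i) (Some j) y + conn None (Some j) (Some i) y = (if i = j then - 2 * r y else 0)"
proof -
  note skew = cov_deriv_skew[OF LC y]
  show "conn (Some i) None None y = 0"
    "conn (Some i) None (Some j) y = (if i = j then \<alpha> y else 0)"
    by (simp_all add: conn_h[OF y] K[OF y] sigma[OF y] h_E[OF y] \<alpha>_def)
  show "conn (Some i) (Some j) None y = (if i = j then - \<beta> y else 0)"
    using skew[of "Some i" "Some j" None] by (simp add: conn_h[OF y] K[OF y] sigma[OF y] h_E[OF y] \<beta>_def)
  show "conn (Some i) (Some j) (Some m) y = - conn (Some i) (Some m) (Some j) y"
    using skew[of "Some i" "Some j" "Some m"] by (simp add: conn_h[OF y] K[OF y] h_E[OF y])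
  show "conn None None None y = CARD('k) * r y"
    using skew[of None None None] by (simp add: conn_h[OF y] K[OF y] h_E[OF y])
  show "conn None (Some i) None y = - conn None None (Some i) y"
    using skew[of None None "Some i"] by (simp add: conn_h[OF y] K[OF y] h_E[OF y])
  show "conn None (Some i) (Some j) y + conn None (Some j) (Some i) y = (if i = j then - 2 * r y else 0)"
    using skew[of None "Some j" "Some i"] by (simp add: conn_h[OF y] K[OF y] h_E[OF y])
qed

lemma D_xi_frame:
  assumes y: "y \<in> V"
  shows "D \<xi> y (E None y) = - a y *\<^sub>R X None y" "D \<xi> y (E (Some i) y) = - b y *\<^sub>R X (Some i) y"
  by (simp_all add: D_xi[OF VU[OF y]] shape[OF y] X_def linear_cmul[OF linear_Df[OF VU[OF y]]])

lemma D_X_leaf: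
  assumes y: "y \<in> V"
  shows "D (X None) y (E (Some i) y) = \<alpha> y *\<^sub>R X (Some i) y"
    and "D (X (Some j)) y (E (Some i) y) = (\<Sum>m\<in>UNIV. conn (Some i) (Some j) (Some m) y *\<^sub>R X (Some m) y)
      + (if i = j then \<xi> y - \<beta> y *\<^sub>R X None y else 0)"
  by (auto simp: D_X_conn[OF y] sum_option conn_values(1-3)[OF y] if_distrib[of "\<lambda>x. x *\<^sub>R _"] cong: if_cong)

text \<open>Dual counterpart of the first part of \<open>D_X_leaf\<close>, with \<beta> in the place
  of \<alpha>. There is no conormal term since S X_i is orthogonal to X_1.\<close>

lemma D_coframe_leaf:
  assumes y: "y \<in> V"
  shows "D (coframe None) y (E (Some i) y) = \<beta> y *\<^sub>R coframe (Some i) y"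
  by (auto simp: D_coframe[OF y] sum_option conn_values(1-3)[OF y] shape[OF y] h_E[OF y]
      if_distrib[of "\<lambda>x. x *\<^sub>R _"] if_distrib[of "\<lambda>x. - x"] cong: if_cong)

text \<open>\<sigma> comes without a smoothness assumption, so \<alpha> is obtained as a connection
  coefficient, and \<beta> then as \<alpha> + 2 r.\<close>

lemma smooth_alpha: "smooth_on V \<alpha>"
proof -
  obtain i :: 'k where True by simp
  have "smooth_on V (conn (Some i) None (Some i))" by (rule smooth_conn)
  then show ?thesis by (rule smooth_on_cong[OF open_V, rotated]) (simp add: conn_values)
qed

lemma smooth_beta: "smooth_on V \<beta>"
proof -
  have "smooth_on V (\<lambda>y. \<alpha> y + 2 * r y)"
    by (intro smooth_on_add smooth_on_mult open_V smooth_alpha smooth_r smooth_on_const)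
  then show ?thesis by (rule smooth_on_cong[OF open_V, rotated]) (simp add: \<alpha>_def \<beta>_def)
qed

text \<open>The second derivatives of \<open>Y0\<close> along two different leaf directions commute up to the bracket.\<close>
lemma leaf_constant:
  fixes Y0 :: "real ^ 'k option \<Rightarrow> 'b::euclidean_space"
  assumes y: "y \<in> V" and sm: "smooth_on V Y0" "smooth_on V c" "\<And>i. smooth_on V (Y i)"
    and DY0: "\<And>z i. z \<in> V \<Longrightarrow> D Y0 z (E (Some i) z) = c z *\<^sub>R Y i z"
    and br: "\<And>i j. D (Y j) y (E (Some i) y) - D (Y i) y (E (Some j) y)
      = (\<Sum>m\<in>UNIV. (conn (Some i) (Some j) (Some m) y - conn (Some j) (Some i) (Some m) y) *\<^sub>R Y m y)"
    and dual: "\<And>i j. u i \<bullet> Y j y = (if i = j then 1 else 0)"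
  shows "D c y (E (Some i) y) = 0"
proof -
  \<comment> \<open>Here n >= 3 enters: there is a second leaf direction.\<close>
  have "\<not> (\<forall>j::'k. j = i)"
  proof
    assume "\<forall>j::'k. j = i"
    then have "(UNIV :: 'k set) = {i}" by auto
    then have "CARD('k) = 1" by (metis card_1_singleton_iff One_nat_def)
    then show False using card by simp
  qed
  then obtain j where j: "j \<noteq> i" by blast
  have d: "c differentiable (at y)" "Y i differentiable (at y)" for i
    using smooth_on_differentiable[OF _ open_V y] sm by auto
  have 2: "D (\<lambda>z. D Y0 z (E (Some j) z)) y (E (Some i) y)
      = c y *\<^sub>R D (Y j) y (E (Some i) y) + D c y (E (Some i) y) *\<^sub>R Y j y" for i j
  proof -
    have "D (\<lambda>z. D Y0 z (E (Some j) z)) y (E (Some i) y) = D (\<lambda>z. c z *\<^sub>R Y j z) y (E (Some i) y)"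
      by (rule D_cong_open[OF open_V y DY0 smooth_on_differentiable[OF smooth_on_D_field[OF open_V sm(1) smooth_E] open_V y]])
    then show ?thesis by (simp add: D_scaleR[OF d])
  qed
  \<comment> \<open>The X_1-component of the bracket of two leaf fields cancels, because
    \<open>conn (Some i) (Some j) None\<close> is symmetric in i and j; this is the involutivity of
    the leaves.\<close>
  have "(\<Sum>c'\<in>UNIV. (conn (Some i) (Some j) c' y - conn (Some j) (Some i) c' y) *\<^sub>R D Y0 y (E c' y))
      = c y *\<^sub>R (\<Sum>m\<in>UNIV. (conn (Some i) (Some j) (Some m) y - conn (Some j) (Some i) (Some m) y) *\<^sub>R Y m y)"
    by (simp add: sum_option conn_values(3)[OF y] DY0[OF y] scaleR_sum_right mult.commute)
  also have "\<dots> = c y *\<^sub>R (D (Y j) y (E (Some i) y) - D (Y i) y (E (Some j) y))" by (simp only: br)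
  finally have S: "(\<Sum>c'\<in>UNIV. (conn (Some i) (Some j) c' y - conn (Some j) (Some i) c' y) *\<^sub>R D Y0 y (E c' y))
      = c y *\<^sub>R (D (Y j) y (E (Some i) y) - D (Y i) y (E (Some j) y))" .
  have "D c y (E (Some i) y) *\<^sub>R Y j y = D c y (E (Some j) y) *\<^sub>R Y i y"
    using commutator[OF sm(1) y, of "Some j" "Some i", unfolded 2 S] by (simp add: algebra_simps)
  then have "u j \<bullet> (D c y (E (Some i) y) *\<^sub>R Y j y) = u j \<bullet> (D c y (E (Some j) y) *\<^sub>R Y i y)" by simp
  then show ?thesis using j by (simp add: dual)
qed

lemma bracket_X:
  assumes y: "y \<in> V"
  shows "D (X (Some j)) y (E (Some i) y) - D (X (Some i)) y (E (Some j) y)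
      = (\<Sum>m\<in>UNIV. (conn (Some i) (Some j) (Some m) y - conn (Some j) (Some i) (Some m) y) *\<^sub>R X (Some m) y)"
  by (simp add: D_X_leaf[OF y] sum_subtractf algebra_simps)

text \<open>The commutator identity for the conormal, whose derivatives along the frame are the
  coframe up to sign.\<close>

lemma bracket_coframe:
  assumes y: "y \<in> V"
  shows "D (coframe (Some j)) y (E (Some i) y) - D (coframe (Some i)) y (E (Some j) y)
      = (\<Sum>m\<in>UNIV. (conn (Some i) (Some j) (Some m) y - conn (Some j) (Some i) (Some m) y) *\<^sub>R coframe (Some m) y)"
proof -
  have *: "D (\<lambda>z. D conormal z (E c z)) y v = - D (coframe c) y v" for c v
  proof -
    have "(\<lambda>z. D conormal z (E c z)) = (\<lambda>z. - coframe c z)" by (simp add: coframe_def)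
    then show ?thesis using D_minus[OF diffV(6)[OF y]] by simp
  qed
  have D: "D conormal y (E c y) = - coframe c y" for c by (simp add: coframe_def)
  have s: "conn (Some i) (Some j) None y = conn (Some j) (Some i) None y"
    by (simp add: conn_values(3)[OF y])
  show ?thesis
    using commutator[OF smooth_conormal y, of "Some j" "Some i"]
    by (simp add: * D sum_option s sum_negf) (simp add: algebra_simps)
qed

lemma alpha_leaf: assumes y: "y \<in> V" shows "D \<alpha> y (E (Some i) y) = 0"
  by (rule leaf_constant[OF y smooth_X smooth_alpha smooth_X D_X_leaf(1) bracket_X[OF y],
        where u = "\<lambda>i. coframe (Some i) y"]) (simp_all add: coframe_X[OF y])

lemma beta_leaf: assumes y: "y \<in> V" shows "D \<beta> y (E (Some i) y) = 0"
  by (rule leaf_constant[OF y smooth_coframe smooth_beta smooth_coframe D_coframe_leaf bracket_coframe[OF y],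
        where u = "\<lambda>i. X (Some i) y"]) (simp_all add: coframe_X[OF y] inner_commute[of "X _ _"])

lemma b_leaf: assumes y: "y \<in> V" shows "D b y (E (Some i) y) = 0"
proof -
  have "D (\<lambda>y. - b y) y (E (Some i) y) = 0"
    by (rule leaf_constant[OF y smooth_xi_V smooth_on_minus[OF open_V smooth_b] smooth_X D_xi_frame(2) bracket_X[OF y],
        where u = "\<lambda>i. coframe (Some i) y"]) (simp_all add: coframe_X[OF y])
  then show ?thesis using D_minus[OF smooth_on_differentiable[OF smooth_b open_V y]] by simp
qed

lemma r_leaf: assumes y: "y \<in> V" shows "D r y (E (Some i) y) = 0"
proof -
  have d: "\<alpha> differentiable (at y)" "\<beta> differentiable (at y)"
    using smooth_on_differentiable[OF _ open_V y] smooth_alpha smooth_beta by auto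
  have "r = (\<lambda>y. (1/2) *\<^sub>R (\<beta> y - \<alpha> y))" by (auto simp: \<alpha>_def \<beta>_def)
  then have "D r y (E (Some i) y) = D (\<lambda>y. (1/2) *\<^sub>R (\<beta> y - \<alpha> y)) y (E (Some i) y)" by simp
  also have "\<dots> = (1/2) *\<^sub>R D (\<lambda>y. \<beta> y - \<alpha> y) y (E (Some i) y)"
    by (rule D_linear[OF bounded_linear_scaleR_right differentiable_diff[OF d(2,1)]])
  also have "\<dots> = 0" by (simp add: D_diff[OF d(2,1)] alpha_leaf[OF y] beta_leaf[OF y])
  finally show ?thesis .
qed

lemma geodesic: assumes y: "y \<in> V" shows "conn None None (Some i) y = 0"
proof -
  \<comment> \<open>Pairing the commutator on \<open>X\<^sub>1\<close> with the first element of the dual frame gives \<open>- 2 r c = (n - 1) r c\<close>.\<close>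
  let ?c = "conn None None (Some i) y"
  let ?T = "\<lambda>z. D (X None) z (E None z)"
  have dT: "?T differentiable (at y)"
    by (rule smooth_on_differentiable[OF smooth_on_D_field[OF open_V smooth_X smooth_E] open_V y])
  have dr: "r differentiable (at y)" using smooth_on_differentiable[OF smooth_r open_V y] .
  have d\<alpha>: "\<alpha> differentiable (at y)" using smooth_on_differentiable[OF smooth_alpha open_V y] .
  have "D (\<lambda>z. coframe None z \<bullet> ?T z) y (E (Some i) y) = D (\<lambda>z. CARD('k) * r z) y (E (Some i) y)"
    by (rule D_cong_open[OF open_V y])
      (auto simp: conn_values(5)[unfolded conn_def] intro!: differentiable_bounded_bilinear[OF bounded_bilinear_inner] diffV[OF y] dT)
  also have "\<dots> = 0" by (simp add: D_mult[OF differentiable_const dr] r_leaf[OF y])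
  finally have "coframe None y \<bullet> D ?T y (E (Some i) y) + \<beta> y * ?c = 0"
    by (simp add: D_inner[OF diffV(6)[OF y] dT] D_coframe_leaf[OF y] conn_def)
  moreover have "D (\<lambda>z. D (X None) z (E (Some i) z)) y (E None y) = D (\<lambda>z. \<alpha> z *\<^sub>R X (Some i) z) y (E None y)"
    by (rule D_cong_open[OF open_V y D_X_leaf(1) smooth_on_differentiable[OF smooth_on_D_field[OF open_V smooth_X smooth_E] open_V y]])
  then have "coframe None y \<bullet> D (\<lambda>z. D (X None) z (E (Some i) z)) y (E None y) = - \<alpha> y * ?c"
    using conn_values(6)[OF y, of i]
    by (simp add: D_scaleR[OF d\<alpha> diffV(4)[OF y]] inner_add_right coframe_X[OF y] conn_def)
  moreover have "coframe None y \<bullet> (\<Sum>c\<in>UNIV. (conn (Some i) None c y - conn None (Some i) c y) *\<^sub>R D (X None) y (E c y))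
      = ?c * (CARD('k) * r y)"
    by (simp add: sum_option inner_add_right inner_sum_right conn_values(1,6)[OF y] D_X_leaf(1)[OF y] coframe_X[OF y]
        conn_values(5)[OF y, unfolded conn_def])
  moreover have "coframe None y \<bullet> (D ?T y (E (Some i) y) - D (\<lambda>z. D (X None) z (E (Some i) z)) y (E None y)) =
     coframe None y \<bullet> (\<Sum>c\<in>UNIV. (conn (Some i) None c y - conn None (Some i) c y) *\<^sub>R D (X None) y (E c y))"
    by (simp only: commutator[OF smooth_X y])
  ultimately have "- \<beta> y * ?c + \<alpha> y * ?c = ?c * (CARD('k) * r y)" by (simp add: inner_diff_right)
  \<comment> \<open>The 2 comes from \<beta> - \<alpha> = 2 r; the total factor (n + 1) r is
    positive.\<close>
  then have "?c * ((2 + CARD('k)) * r y) = 0" by (simp add: \<alpha>_def \<beta>_def algebra_simps)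
  then show ?thesis using r_pos[OF y] by (simp add: add_nonneg_eq_0_iff)
qed

section \<open>Evolution along X_1\<close>

lemma D_T:
  assumes y: "y \<in> V"
  shows "D (X None) y (E None y) = (CARD('k) * r y) *\<^sub>R X None y + 1 *\<^sub>R \<xi> y"
    and "D (X (Some i)) y (E None y) = (\<Sum>j\<in>UNIV. conn None (Some i) (Some j) y *\<^sub>R X (Some j) y)"
    and "D (coframe None) y (E None y) = - (CARD('k) * r y) *\<^sub>R coframe None y + a y *\<^sub>R conormal y"
  by (simp_all add: D_X_conn[OF y] D_coframe[OF y] sum_option conn_values(5,6)[OF y] geodesic[OF y] shape[OF y] h_E[OF y])

text \<open>The commutator of X_i and X_1 on \<open>Y0\<close>, paired with the dual
  \<open>u\<close> of \<open>Y i\<close>, determines the X_1-derivative of the leaf coefficient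
  \<open>c\<close>. Three choices are made later: X_1 with c = \<alpha>, its dual covector with c =
  \<beta>, and \<xi> with c = - b; the second field \<eta> is \<xi>, the conormal and X_1
  respectively.\<close>

lemma T_derivative:
  fixes Y0 :: "real ^ 'k option \<Rightarrow> 'b::euclidean_space"
  assumes y: "y \<in> V"
    and sm: "smooth_on V Y0" "smooth_on V c" "\<And>i. smooth_on V (Y i)" "smooth_on V \<kappa>" "smooth_on V a'" "smooth_on V \<eta>"
    and leaf: "\<And>z i. z \<in> V \<Longrightarrow> D Y0 z (E (Some i) z) = c z *\<^sub>R Y i z"
    and T: "\<And>z. z \<in> V \<Longrightarrow> D Y0 z (E None z) = \<kappa> z *\<^sub>R Y0 z + a' z *\<^sub>R \<eta> z"
    and \<eta>: "D \<eta> y (E (Some i) y) = - b' *\<^sub>R Y i y"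
    and N: "u \<bullet> D (Y i) y (E None y) = N"
    and dual: "\<And>j. u \<bullet> Y j y = (if i = j then 1 else 0)" "u \<bullet> Y0 y = 0" "u \<bullet> \<eta> y = 0"
  shows "D c y (E None y) = \<kappa> y * c y - a' y * b' - c y * N - c y * (\<alpha> y - conn None (Some i) (Some i) y)"
proof -
  have d: "Y0 differentiable (at y)" "c differentiable (at y)" "Y i differentiable (at y)" "\<kappa> differentiable (at y)"
    "a' differentiable (at y)" "\<eta> differentiable (at y)" for i
    using smooth_on_differentiable[OF _ open_V y] sm by auto
  have dd: "(\<lambda>z. \<kappa> z *\<^sub>R Y0 z) differentiable (at y)" "(\<lambda>z. a' z *\<^sub>R \<eta> z) differentiable (at y)"
    using d by (auto intro: differentiable_bounded_bilinear[OF bounded_bilinear_scaleR])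
  have "D (\<lambda>z. D Y0 z (E None z)) y (E (Some i) y) = D (\<lambda>z. \<kappa> z *\<^sub>R Y0 z + a' z *\<^sub>R \<eta> z) y (E (Some i) y)"
    by (rule D_cong_open[OF open_V y T smooth_on_differentiable[OF smooth_on_D_field[OF open_V sm(1) smooth_E] open_V y]])
  then have 1: "u \<bullet> D (\<lambda>z. D Y0 z (E None z)) y (E (Some i) y) = \<kappa> y * c y - a' y * b'"
    by (simp add: D_add[OF dd] D_scaleR[OF d(4,1)] D_scaleR[OF d(5,6)] leaf[OF y] \<eta> inner_add_right inner_diff_right dual)
  have "D (\<lambda>z. D Y0 z (E (Some i) z)) y (E None y) = D (\<lambda>z. c z *\<^sub>R Y i z) y (E None y)"
    by (rule D_cong_open[OF open_V y leaf smooth_on_differentiable[OF smooth_on_D_field[OF open_V sm(1) smooth_E] open_V y]])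
  then have 2: "u \<bullet> D (\<lambda>z. D Y0 z (E (Some i) z)) y (E None y) = c y * N + D c y (E None y)"
    by (simp add: D_scaleR[OF d(2,3)] inner_add_right N dual)
  have 3: "u \<bullet> (\<Sum>c'\<in>UNIV. (conn (Some i) None c' y - conn None (Some i) c' y) *\<^sub>R D Y0 y (E c' y))
      = (\<alpha> y - conn None (Some i) (Some i) y) * c y"
    by (simp add: sum_option inner_add_right inner_sum_right conn_values(1,2,6)[OF y] geodesic[OF y] leaf[OF y] dual
        if_distrib[of "\<lambda>x. _ * x"] cong: if_cong)
  show ?thesis
    using arg_cong[OF commutator[OF sm(1) y, of None "Some i"], of "\<lambda>x. u \<bullet> x"] 1 2 3
    by (simp add: inner_diff_right algebra_simps)
qed

lemma conn_diag: "y \<in> V \<Longrightarrow> conn None (Some i) (Some i) y = - r y"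
  using conn_values(7)[of y i i] by simp

lemma T_alpha: assumes y: "y \<in> V"
  shows "D \<alpha> y (E None y) = CARD('k) * r y * \<alpha> y - b y - (\<alpha> y)\<^sup>2"
proof -
  obtain i :: 'k where True by simp
  have "D \<alpha> y (E None y) = (CARD('k) * r y) * \<alpha> y - 1 * b y - \<alpha> y * (- r y) - \<alpha> y * (\<alpha> y - conn None (Some i) (Some i) y)"
    by (rule T_derivative[OF y smooth_X smooth_alpha smooth_X _ smooth_on_const smooth_xi_V D_X_leaf(1) D_T(1) D_xi_frame(2)[OF y],
        where u = "coframe (Some i) y"])
      (simp_all add: coframe_X[OF y] coframe_xi[OF y] conn_diag[OF y] smooth_on_mult[OF open_V] smooth_on_const smooth_r flip: conn_def)
  then show ?thesis by (simp add: conn_diag[OF y] power2_eq_square algebra_simps)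
qed

lemma T_beta: assumes y: "y \<in> V"
  shows "D \<beta> y (E None y) = - CARD('k) * r y * \<beta> y - a y - \<beta> y * (\<alpha> y + 2 * r y)"
proof -
  obtain i :: 'k where True by simp
  have "D \<beta> y (E None y) = (- (CARD('k) * r y)) * \<beta> y - a y * 1 - \<beta> y * r y - \<beta> y * (\<alpha> y - conn None (Some i) (Some i) y)"
  proof (rule T_derivative[OF y smooth_coframe smooth_beta smooth_coframe _ smooth_a smooth_conormal D_coframe_leaf D_T(3),
        where u = "X (Some i) y"])
    show "smooth_on V (\<lambda>y. - (real CARD('k) * r y))"
      by (intro smooth_on_minus smooth_on_mult open_V smooth_on_const smooth_r)
    show "D conormal y (E (Some i) y) = - 1 *\<^sub>R coframe (Some i) y" by (simp add: coframe_def)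
  qed (auto simp: inner_commute[of "X _ _"] coframe_X[OF y] conormal_X[OF y] D_coframe_X[OF y] conn_diag[OF y])
  then show ?thesis by (simp add: conn_diag[OF y] algebra_simps)
qed

lemma T_b: assumes y: "y \<in> V"
  shows "D b y (E None y) = (a y - b y) * \<alpha> y"
proof -
  obtain i :: 'k where True by simp
  have "D (\<lambda>y. - b y) y (E None y) = 0 * (- b y) - (- a y) * (- \<alpha> y) - (- b y) * (- r y) - (- b y) * (\<alpha> y - conn None (Some i) (Some i) y)"
    by (rule T_derivative[OF y smooth_xi_V smooth_on_minus[OF open_V smooth_b] smooth_X smooth_on_const
        smooth_on_minus[OF open_V smooth_a] smooth_X[of None] D_xi_frame(2), where u = "coframe (Some i) y"])
      (simp_all add: coframe_X[OF y] coframe_xi[OF y] conn_diag[OF y] D_xi_frame(1) D_X_leaf(1)[OF y] flip: conn_def)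
  then show ?thesis
    using D_minus[OF smooth_on_differentiable[OF smooth_b open_V y]] by (simp add: conn_diag[OF y] algebra_simps)
qed

end

section \<open>Linear systems of differential equations along a frame\<close>

text \<open>Gronwall's argument for the energy \<phi>, the sum of the squares: \<phi>' is at most K
  \<phi>, so \<phi> exp(- K s) does not increase from its initial value 0.\<close>

lemma linear_ode_vanish:
  fixes g :: "'j::finite \<Rightarrow> real \<Rightarrow> real"
  assumes g: "\<And>j t. t \<in> {0..1} \<Longrightarrow> (g j has_real_derivative (\<Sum>k\<in>UNIV. A j k t * g k t)) (at t)"
    and A: "\<And>j k. continuous_on {0..1} (A j k)" and g0: "\<And>j. g j 0 = 0" and t: "t \<in> {0..1}"
  shows "g j t = 0"
proof -
  have "\<exists>B. \<forall>t\<in>{0..1}. \<bar>A j k t\<bar> \<le> B" for j k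
    using compact_imp_bounded[OF compact_continuous_image[OF A compact_Icc]]
    by (auto simp: bounded_iff)
  then obtain B where B: "\<And>j k t. t \<in> {0..1} \<Longrightarrow> \<bar>A j k t\<bar> \<le> B j k" by metis
  define C where "C = (\<Sum>j\<in>UNIV. \<Sum>k\<in>UNIV. B j k)"
  have B0: "0 \<le> B j k" for j k using B[of 0 j k] by auto
  have BC: "B j k \<le> C" for j k
  proof -
    have "B j k \<le> (\<Sum>k\<in>UNIV. B j k)" using B0 by (intro member_le_sum) auto
    also have "\<dots> \<le> C" unfolding C_def using B0 by (intro member_le_sum sum_nonneg) auto
    finally show ?thesis .
  qed
  \<comment> \<open>2 |g_j g_k| is bounded by g_j^2 + g_k^2; summing over both indices counts each
    square twice \<open>CARD('j)\<close> times.\<close>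
  define K where "K = 2 * C * CARD('j)"
  define \<phi> where "\<phi> s = (\<Sum>j\<in>UNIV. (g j s)\<^sup>2)" for s
  define \<phi>' where "\<phi>' s = (\<Sum>j\<in>UNIV. 2 * g j s * (\<Sum>k\<in>UNIV. A j k s * g k s))" for s
  have d: "(\<phi> has_real_derivative \<phi>' s) (at s)" if "s \<in> {0..1}" for s
    unfolding \<phi>_def \<phi>'_def
    by (intro DERIV_sum) (use that in \<open>auto intro!: derivative_eq_intros g\<close>)
  have le: "\<phi>' s \<le> K * \<phi> s" if s: "s \<in> {0..1}" for s
  proof -
    have "\<phi>' s = (\<Sum>j\<in>UNIV. \<Sum>k\<in>UNIV. A j k s * (2 * g j s * g k s))"
      unfolding \<phi>'_def by (simp add: sum_distrib_left mult_ac)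
    also have "\<dots> \<le> (\<Sum>j\<in>UNIV. \<Sum>k\<in>UNIV. C * ((g j s)\<^sup>2 + (g k s)\<^sup>2))"
    proof (intro sum_mono)
      fix j k
      have "A j k s * (2 * g j s * g k s) \<le> \<bar>A j k s\<bar> * \<bar>2 * g j s * g k s\<bar>"
        by (metis abs_ge_self abs_mult)
      also have "\<dots> \<le> C * ((g j s)\<^sup>2 + (g k s)\<^sup>2)"
      proof (rule mult_mono)
        show "\<bar>A j k s\<bar> \<le> C" using B[OF s, of j k] BC[of j k] by linarith
        show "\<bar>2 * g j s * g k s\<bar> \<le> (g j s)\<^sup>2 + (g k s)\<^sup>2"
          using sum_squares_bound[of "\<bar>g j s\<bar>" "\<bar>g k s\<bar>"] by (simp add: abs_mult)
        show "0 \<le> C" using B0 BC order_trans by blast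
      qed simp
      finally show "A j k s * (2 * g j s * g k s) \<le> C * ((g j s)\<^sup>2 + (g k s)\<^sup>2)" .
    qed
    also have "\<dots> = K * \<phi> s"
      by (simp add: sum.distrib sum_distrib_left[symmetric] \<phi>_def K_def algebra_simps)
    finally show ?thesis .
  qed
  have "\<phi> 0 * exp (- K * 0) \<ge> \<phi> t * exp (- K * t)"
  proof (rule DERIV_nonpos_imp_nonincreasing[where f = "\<lambda>s. \<phi> s * exp (- K * s)"])
    show "0 \<le> t" using t by simp
    fix s assume "0 \<le> s" "s \<le> t"
    then have s: "s \<in> {0..1}" using t by simp
    have "((\<lambda>s. \<phi> s * exp (- K * s)) has_real_derivative (\<phi>' s - K * \<phi> s) * exp (- K * s)) (at s)"
      by (auto intro!: derivative_eq_intros d[OF s] simp: algebra_simps)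
    moreover have "(\<phi>' s - K * \<phi> s) * exp (- K * s) \<le> 0"
      using le[OF s] by (intro mult_nonpos_nonneg) auto
    ultimately show "\<exists>y. ((\<lambda>s. \<phi> s * exp (- K * s)) has_real_derivative y) (at s) \<and> y \<le> 0" by blast
  qed
  then have "\<phi> t \<le> 0" by (simp add: \<phi>_def g0 zero_less_mult_iff mult_le_0_iff)
  then have "\<phi> t = 0" unfolding \<phi>_def by (meson antisym sum_nonneg zero_le_power2)
  then show ?thesis unfolding \<phi>_def by (subst (asm) sum_nonneg_eq_0_iff) auto
qed

text \<open>Membership in the ideal generated by a family \<open>G\<close> is stable under the ring operations; for the
  derivatives of the \<open>G j\<close> it says that \<open>G\<close> solves a homogeneous linear system.\<close>
definition in_ideal :: "'a::topological_space set \<Rightarrow> ('j::finite \<Rightarrow> 'a \<Rightarrow> real) \<Rightarrow> ('a \<Rightarrow> real) \<Rightarrow> bool"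
  where "in_ideal V G \<phi> \<longleftrightarrow> (\<exists>A. (\<forall>k. continuous_on V (A k)) \<and> (\<forall>y\<in>V. \<phi> y = (\<Sum>k\<in>UNIV. A k y * G k y)))"

lemma in_ideal_cong: "in_ideal V G \<phi> \<Longrightarrow> (\<And>y. y \<in> V \<Longrightarrow> \<psi> y = \<phi> y) \<Longrightarrow> in_ideal V G \<psi>"
  unfolding in_ideal_def by metis

lemma in_ideal_zero: "in_ideal V G (\<lambda>_. 0)"
  unfolding in_ideal_def by (rule exI[of _ "\<lambda>_ _. 0"]) auto

lemma in_ideal_generator: "in_ideal V G (G j)"
  unfolding in_ideal_def
  by (rule exI[of _ "\<lambda>k _. if k = j then 1 else 0"]) (auto simp: if_distrib[of "\<lambda>x. x * _"] cong: if_cong)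

lemma in_ideal_add:
  assumes "in_ideal V G \<phi>" "in_ideal V G \<psi>" shows "in_ideal V G (\<lambda>y. \<phi> y + \<psi> y)"
proof -
  from assms obtain A B where "\<forall>k. continuous_on V (A k)" "\<forall>k. continuous_on V (B k)"
    "\<forall>y\<in>V. \<phi> y = (\<Sum>k\<in>UNIV. A k y * G k y)" "\<forall>y\<in>V. \<psi> y = (\<Sum>k\<in>UNIV. B k y * G k y)"
    unfolding in_ideal_def by blast
  then show ?thesis unfolding in_ideal_def
    by (intro exI[of _ "\<lambda>k y. A k y + B k y"]) (auto simp: distrib_right sum.distrib intro!: continuous_on_add)
qed

lemma in_ideal_mult:
  assumes "continuous_on V c" "in_ideal V G \<phi>" shows "in_ideal V G (\<lambda>y. c y * \<phi> y)"
proof -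
  from assms obtain A where "\<forall>k. continuous_on V (A k)" "\<forall>y\<in>V. \<phi> y = (\<Sum>k\<in>UNIV. A k y * G k y)"
    unfolding in_ideal_def by blast
  then show ?thesis unfolding in_ideal_def
    using assms(1) by (intro exI[of _ "\<lambda>k y. c y * A k y"]) (auto simp: sum_distrib_left mult.assoc intro!: continuous_on_mult)
qed

lemma in_ideal_sum:
  assumes "finite J" "\<And>j. j \<in> J \<Longrightarrow> in_ideal V G (\<phi> j)" shows "in_ideal V G (\<lambda>y. \<Sum>j\<in>J. \<phi> j y)"
  using assms by (induction J rule: finite_induct) (auto simp: in_ideal_zero intro: in_ideal_add)

text \<open>On the segment from \<open>y0\<close> to \<open>y\<close> the system becomes an ordinary
  one: its constant direction is expanded in the frame, and each frame derivative is linear in the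
  unknowns. This is why the domain is convex.\<close>

lemma linear_system_vanish:
  fixes G :: "'j::finite \<Rightarrow> 'a::real_normed_vector \<Rightarrow> real" and E :: "'i::finite \<Rightarrow> 'a \<Rightarrow> 'a"
  assumes E: "\<And>y v. y \<in> V \<Longrightarrow> v = (\<Sum>a\<in>UNIV. \<theta> a y v *\<^sub>R E a y)"
    and \<theta>: "\<And>a v. continuous_on V (\<lambda>y. \<theta> a y v)"
    and dG: "\<And>j y. y \<in> V \<Longrightarrow> G j differentiable (at y)"
    and ideal: "\<And>j a. in_ideal V G (\<lambda>y. D (G j) y (E a y))"
    and V: "convex V" "y0 \<in> V" "y \<in> V" and G0: "\<And>j. G j y0 = 0"
  shows "G j y = 0"
proof -
  from ideal obtain A where A: "\<And>j a k. continuous_on V (A j a k)"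
    "\<And>j a y. y \<in> V \<Longrightarrow> D (G j) y (E a y) = (\<Sum>k\<in>UNIV. A j a k y * G k y)"
    unfolding in_ideal_def by metis
  define v where "v = y - y0"
  have seg: "y0 + t *\<^sub>R v \<in> V" if "t \<in> {0..1}" for t
    using that V convexD_alt[OF V(1,2,3), of t] by (auto simp: v_def algebra_simps)
  have line: "continuous_on {0..1} (\<lambda>t. y0 + t *\<^sub>R v)" by (intro continuous_intros)
  have "G j (y0 + 1 *\<^sub>R v) = 0"
  proof (rule linear_ode_vanish[where g = "\<lambda>j t. G j (y0 + t *\<^sub>R v)"
        and A = "\<lambda>j k t. \<Sum>a\<in>UNIV. \<theta> a (y0 + t *\<^sub>R v) v * A j a k (y0 + t *\<^sub>R v)"])
    fix j and t :: real assume t: "t \<in> {0..1}"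
    let ?z = "y0 + t *\<^sub>R v"
    note l = linear_frechet_derivative[OF dG[OF seg[OF t]]]
    have "D (G j) ?z v = D (G j) ?z (\<Sum>a\<in>UNIV. \<theta> a ?z v *\<^sub>R E a ?z)"
      by (rule arg_cong[OF E[OF seg[OF t]]])
    also have "\<dots> = (\<Sum>a\<in>UNIV. \<theta> a ?z v * (\<Sum>k\<in>UNIV. A j a k ?z * G k ?z))"
      by (simp add: linear_sum[OF l] linear_cmul[OF l] A(2)[OF seg[OF t]])
    also have "\<dots> = (\<Sum>a\<in>UNIV. \<Sum>k\<in>UNIV. \<theta> a ?z v * A j a k ?z * G k ?z)"
      by (simp add: sum_distrib_left mult.assoc)
    also have "\<dots> = (\<Sum>k\<in>UNIV. \<Sum>a\<in>UNIV. \<theta> a ?z v * A j a k ?z * G k ?z)" by (rule sum.swap)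
    also have "\<dots> = (\<Sum>k\<in>UNIV. (\<Sum>a\<in>UNIV. \<theta> a ?z v * A j a k ?z) * G k ?z)"
      by (simp add: sum_distrib_right)
    finally have e: "D (G j) ?z v = (\<Sum>k\<in>UNIV. (\<Sum>a\<in>UNIV. \<theta> a ?z v * A j a k ?z) * G k ?z)" .
    show "((\<lambda>t. G j (y0 + t *\<^sub>R v)) has_real_derivative
        (\<Sum>k\<in>UNIV. (\<Sum>a\<in>UNIV. \<theta> a ?z v * A j a k ?z) * G k ?z)) (at t)"
      using has_real_derivative_line[OF dG[OF seg[OF t], of j]] unfolding e .
  next
    fix j k
    show "continuous_on {0..1} (\<lambda>t. \<Sum>a\<in>UNIV. \<theta> a (y0 + t *\<^sub>R v) v * A j a k (y0 + t *\<^sub>R v))"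
      by (intro continuous_on_sum continuous_on_mult continuous_on_compose2[OF \<theta> line]
          continuous_on_compose2[OF A(1) line]) (use seg in auto)
  qed (auto simp: G0)
  then show ?thesis by (simp add: v_def)
qed

section \<open>Frames satisfying the structure equations\<close>

text \<open>In terms of the associated functions, \<open>\<alpha> = \<sigma> - r\<close>, \<open>\<beta> = \<sigma> + r\<close>, \<open>\<kappa> = (n - 1) r + \<beta>\<close> and
  \<open>Z = \<xi> - \<beta> X\<^sub>1\<close>.\<close>
locale normal_frame =
  fixes V :: "(real ^ 'k::finite option) set" and f :: "real ^ 'k option \<Rightarrow> real ^ 'k option option"
    and E :: "'k option \<Rightarrow> real ^ 'k option \<Rightarrow> real ^ 'k option"
    and \<theta> :: "'k option \<Rightarrow> real ^ 'k option \<Rightarrow> real ^ 'k option \<Rightarrow> real"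
    and X :: "'k option \<Rightarrow> real ^ 'k option \<Rightarrow> real ^ 'k option option" and Z :: "real ^ 'k option \<Rightarrow> real ^ 'k option option"
    and \<alpha> \<beta> \<kappa> \<zeta> :: "real ^ 'k option \<Rightarrow> real" and M :: "'k \<Rightarrow> 'k \<Rightarrow> real ^ 'k option \<Rightarrow> real"
    and C :: "'k \<Rightarrow> 'k \<Rightarrow> 'k \<Rightarrow> real ^ 'k option \<Rightarrow> real"
  assumes open_V: "open V" and convex_V: "convex V"
    and smooth_f: "smooth_on V f" and smooth_X: "\<And>a. smooth_on V (X a)" and smooth_Z: "smooth_on V Z"
    and smooth_scalars: "smooth_on V \<alpha>" "smooth_on V \<beta>" "smooth_on V \<kappa>" "smooth_on V \<zeta>"
    and smooth_MC: "\<And>i j. smooth_on V (M i j)" "\<And>i j m. smooth_on V (C i j m)"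
    and smooth_theta: "\<And>a v. smooth_on V (\<lambda>y. \<theta> a y v)"
    and E_expand: "\<And>y v. y \<in> V \<Longrightarrow> v = (\<Sum>a\<in>UNIV. \<theta> a y v *\<^sub>R E a y)"
    and D_f: "\<And>y a. y \<in> V \<Longrightarrow> D f y (E a y) = X a y"
    and D_X0: "\<And>y i. y \<in> V \<Longrightarrow> D (X None) y (E (Some i) y) = \<alpha> y *\<^sub>R X (Some i) y"
      "\<And>y. y \<in> V \<Longrightarrow> D (X None) y (E None y) = \<kappa> y *\<^sub>R X None y + Z y"
    and D_Xi: "\<And>y i j. y \<in> V \<Longrightarrow> D (X (Some j)) y (E (Some i) y) =
        (\<Sum>m\<in>UNIV. C i j m y *\<^sub>R X (Some m) y) + (if i = j then Z y else 0)"
      "\<And>y i. y \<in> V \<Longrightarrow> D (X (Some i)) y (E None y) = (\<Sum>m\<in>UNIV. M i m y *\<^sub>R X (Some m) y)"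
    and D_Z: "\<And>y i. y \<in> V \<Longrightarrow> D Z y (E (Some i) y) = - \<zeta> y *\<^sub>R X (Some i) y"
      "\<And>y. y \<in> V \<Longrightarrow> D Z y (E None y) = - \<beta> y *\<^sub>R Z y"
    and C_skew: "\<And>y i j m. y \<in> V \<Longrightarrow> C i j m y = - C i m j y"
    and M_sym: "\<And>y i j. y \<in> V \<Longrightarrow> M i j y + M j i y = (if i = j then \<alpha> y - \<beta> y else 0)"
    and D_alpha: "\<And>y i. y \<in> V \<Longrightarrow> D \<alpha> y (E (Some i) y) = 0"
      "\<And>y. y \<in> V \<Longrightarrow> D \<alpha> y (E None y) = \<alpha> y * (\<kappa> y - \<alpha> y) - \<zeta> y"
    and D_zeta: "\<And>y i. y \<in> V \<Longrightarrow> D \<zeta> y (E (Some i) y) = 0"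
      "\<And>y. y \<in> V \<Longrightarrow> D \<zeta> y (E None y) = - (\<alpha> y + \<beta> y) * \<zeta> y"
    and spanning: "\<And>y u. y \<in> V \<Longrightarrow> (\<And>a. u \<bullet> X a y = 0) \<Longrightarrow> u \<bullet> Z y = 0 \<Longrightarrow> u = 0"
begin

lemma diff:
  assumes "y \<in> V"
  shows "f differentiable (at y)" "X a differentiable (at y)" "Z differentiable (at y)"
    "\<alpha> differentiable (at y)" "\<zeta> differentiable (at y)"
  using smooth_on_differentiable[OF _ open_V assms] smooth_f smooth_X smooth_Z smooth_scalars by blast+

lemma cont: "continuous_on V \<alpha>" "continuous_on V \<beta>" "continuous_on V \<kappa>" "continuous_on V \<zeta>"
    "continuous_on V (M i j)" "continuous_on V (C i j m)"
  using smooth_on_continuous smooth_scalars smooth_MC by blast+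

lemma vanish:
  fixes G :: "'j::finite \<Rightarrow> real ^ 'k option \<Rightarrow> real"
  assumes "\<And>j. smooth_on V (G j)" "\<And>j i. in_ideal V G (\<lambda>y. D (G j) y (E (Some i) y))"
    "\<And>j. in_ideal V G (\<lambda>y. D (G j) y (E None y))" "y0 \<in> V" "\<And>j. G j y0 = 0" "y \<in> V"
  shows "G j y = 0"
proof (rule linear_system_vanish[where \<theta> = \<theta> and E = E and V = V and ?y0.0 = y0])
  show "v = (\<Sum>a\<in>UNIV. \<theta> a y v *\<^sub>R E a y)" if "y \<in> V" for y v using E_expand[OF that] .
  show "continuous_on V (\<lambda>y. \<theta> a y v)" for a v by (rule smooth_on_continuous[OF smooth_theta])
  show "G j differentiable (at y)" if "y \<in> V" for j y using smooth_on_differentiable[OF assms(1) open_V that] .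
  show "in_ideal V G (\<lambda>y. D (G j) y (E a y))" for j a using assms(2,3) by (cases a) auto
qed (use convex_V assms in auto)

lemma vanish1:
  fixes g :: "real ^ 'k option \<Rightarrow> real"
  assumes "smooth_on V g" "\<And>y i. y \<in> V \<Longrightarrow> D g y (E (Some i) y) = 0" "continuous_on V c"
    "\<And>y. y \<in> V \<Longrightarrow> D g y (E None y) = c y * g y" "y0 \<in> V" "g y0 = 0" "y \<in> V"
  shows "g y = 0"
proof (rule vanish[where G = "\<lambda>_::unit. g"])
    show "in_ideal V (\<lambda>_::unit. g) (\<lambda>y. D g y (E (Some i) y))" for i
      by (rule in_ideal_cong[OF in_ideal_zero assms(2)])
    show "in_ideal V (\<lambda>_::unit. g) (\<lambda>y. D g y (E None y))"
      by (rule in_ideal_cong[OF in_ideal_mult[OF assms(3) in_ideal_generator] assms(4)])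
qed (use assms in auto)

lemma const_if_D_zero:
  assumes "smooth_on V g" "\<And>y a. y \<in> V \<Longrightarrow> D g y (E a y) = 0" "y0 \<in> V" "y \<in> V"
  shows "g y = (g y0 :: real)"
proof -
  have "(\<lambda>y. g y - g y0) y = 0"
  proof (rule vanish1[where y = y and y0 = y0 and c = "\<lambda>_. 0"])
    have "D (\<lambda>y. g y - g y0) y (E a y) = 0" if "y \<in> V" for y a
      using D_diff[OF smooth_on_differentiable[OF assms(1) open_V that] differentiable_const] assms(2)[OF that] by simp
    then show "D (\<lambda>y. g y - g y0) y (E (Some i) y) = 0" "D (\<lambda>y. g y - g y0) y (E None y) = 0 * (g y - g y0)"
      if "y \<in> V" for y i using that by auto
  qed (use assms open_V in \<open>auto intro: smooth_on_diff smooth_on_const\<close>)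
  then show ?thesis by simp
qed

text \<open>The local dichotomy for \<zeta>, which is constant on the leaves and satisfies a
  homogeneous linear equation along X_1.\<close>

lemma zeta_zero: "y0 \<in> V \<Longrightarrow> \<zeta> y0 = 0 \<Longrightarrow> y \<in> V \<Longrightarrow> \<zeta> y = 0"
  by (rule vanish1[where c = "\<lambda>y. - (\<alpha> y + \<beta> y)" and ?y0.0 = y0])
    (auto simp: D_zeta smooth_scalars intro!: continuous_intros cont)

text \<open>For \<zeta> = 0 the Riccati equation of \<alpha> has the right side \<alpha> (\<kappa> -
  \<alpha>). Regarding the second factor as a given coefficient makes it linear.\<close>

lemma alpha_zero: "(\<And>y. y \<in> V \<Longrightarrow> \<zeta> y = 0) \<Longrightarrow> y0 \<in> V \<Longrightarrow> \<alpha> y0 = 0 \<Longrightarrow> y \<in> V \<Longrightarrow> \<alpha> y = 0"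
  by (rule vanish1[where c = "\<lambda>y. \<kappa> y - \<alpha> y" and ?y0.0 = y0])
    (auto simp: D_alpha smooth_scalars intro!: continuous_intros cont)

text \<open>The derivatives of the X_i and of Z, also those along X_1, involve only the X_i and Z.
  Hence a coordinate that kills all of them at one point does so everywhere: the hyperplane is
  constant.\<close>

lemma leaf_direction:
  assumes X: "\<And>i. X (Some i) y0 $ p = 0" "Z y0 $ p = 0" and y0: "y0 \<in> V" and y: "y \<in> V"
  shows "X (Some i) y $ p = 0" "Z y $ p = 0"
proof -
  define G where "G j y = (case j of Some i \<Rightarrow> X (Some i) y $ p | None \<Rightarrow> Z y $ p)" for j :: "'k option" and y
  have X: "G (Some i) = (\<lambda>y. X (Some i) y $ p)" and Z: "G None = (\<lambda>y. Z y $ p)" for i by (auto simp: G_def)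
  have gen: "in_ideal V G (\<lambda>y. X (Some i) y $ p)" "in_ideal V G (\<lambda>y. Z y $ p)" for i
    using in_ideal_generator[of V G "Some i"] in_ideal_generator[of V G None] by (simp_all add: X Z)
  have "G j y = 0" for j
  proof (rule vanish[OF _ _ _ y0 _ y])
    fix j :: "'k option" and i
    show "smooth_on V (G j)"
      by (cases j) (auto simp: X Z intro!: smooth_on_vec_nth open_V smooth_X smooth_Z)
    show "in_ideal V G (\<lambda>y. D (G j) y (E (Some i) y))"
    proof (cases j)
      case None
      have "in_ideal V G (\<lambda>y. - \<zeta> y * (X (Some i) y $ p))"
        by (intro in_ideal_mult gen continuous_intros cont)
      then show ?thesis
        by (rule in_ideal_cong) (simp add: None Z D_vec_nth diff D_Z)
    next
      case (Some m)
      have "in_ideal V G (\<lambda>y. (\<Sum>l\<in>UNIV. C i m l y * (X (Some l) y $ p)) + (if i = m then 1 else 0) * (Z y $ p))"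
        by (intro in_ideal_add in_ideal_sum in_ideal_mult gen continuous_intros cont) auto
      then show ?thesis
        by (rule in_ideal_cong) (simp add: Some X D_vec_nth diff D_Xi)
    qed
    show "in_ideal V G (\<lambda>y. D (G j) y (E None y))"
    proof (cases j)
      case None
      have "in_ideal V G (\<lambda>y. - \<beta> y * (Z y $ p))"
        by (intro in_ideal_mult gen continuous_intros cont)
      then show ?thesis
        by (rule in_ideal_cong) (simp add: None Z D_vec_nth diff D_Z)
    next
      case (Some m)
      have "in_ideal V G (\<lambda>y. \<Sum>l\<in>UNIV. M m l y * (X (Some l) y $ p))"
        by (intro in_ideal_sum in_ideal_mult gen continuous_intros cont) auto
      then show ?thesis
        by (rule in_ideal_cong) (simp add: Some X D_vec_nth diff D_Xi)
    qed
    show "G j y0 = 0" using assms by (cases j) (auto simp: G_def)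
  qed
  from this[of "Some i"] this[of None] show "X (Some i) y $ p = 0" "Z y $ p = 0" by (simp_all add: G_def)
qed

end

text \<open>The vector equations are linear and the scalar coefficients do not see the ambient
  space. This permits prescribing the frame at the base point.\<close>

lemma normal_frame_affine:
  assumes nf: "normal_frame V f E \<theta> X Z \<alpha> \<beta> \<kappa> \<zeta> M C" and A: "linear A" "surj A"
  shows "normal_frame V (\<lambda>y. A (f y - w)) E \<theta> (\<lambda>a y. A (X a y)) (\<lambda>y. A (Z y)) \<alpha> \<beta> \<kappa> \<zeta> M C"
proof -
  interpret normal_frame V f E \<theta> X Z \<alpha> \<beta> \<kappa> \<zeta> M C by fact
  have bl: "bounded_linear A" using A(1) linear_conv_bounded_linear by blast
  have DA: "D (\<lambda>y. A (g y)) y v = A (D g y v)" if "g differentiable (at y)" for g y v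
    by (rule D_linear[OF bl that])
  have Df: "D (\<lambda>y. f y - w) y v = D f y v" if "y \<in> V" for y v
    using D_diff[OF diff(1)[OF that] differentiable_const] by simp
  have df: "(\<lambda>y. f y - w) differentiable (at y)" if "y \<in> V" for y
    using differentiable_diff[OF diff(1)[OF that] differentiable_const] .
  note l = linear_add[OF A(1)] linear_cmul[OF A(1)] linear_sum[OF A(1)] linear_0[OF A(1)] linear_neg[OF A(1)]
  show ?thesis
  proof
    fix y u assume y: "y \<in> V" and u: "\<And>a. u \<bullet> A (X a y) = 0" "u \<bullet> A (Z y) = 0"
    \<comment> \<open>The spanning condition is dual, so it is transported by the adjoint and
      returns through surjectivity.\<close>
    have "adjoint A u \<bullet> x = u \<bullet> A x" for x
      using adjoint_works[OF A(1), of x u] by (simp add: inner_commute)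
    then have "adjoint A u = 0" using u by (intro spanning[OF y]) auto
    then have "u \<bullet> A x = 0" for x using adjoint_works[OF A(1), of x u] by (simp add: inner_commute)
    then show "u = 0" using A(2) by (metis inner_eq_zero_iff surjD)
  qed (rule open_V convex_V smooth_scalars smooth_MC smooth_theta
      | rule E_expand C_skew M_sym D_alpha D_zeta, assumption
      | intro smooth_on_linear_compose[OF A(1)] smooth_on_diff smooth_on_const open_V smooth_f smooth_X smooth_Z; fail
      | simp add: DA df Df diff D_f D_X0 D_Xi D_Z l; fail)+
qed

section \<open>Charts from coordinate functions\<close>

text \<open>The inverse function theorem gives a C^1 inverse; higher regularity is
  bootstrapped.\<close>

lemma smooth_inverse_function:
  fixes \<Phi> :: "real ^ 'n::finite \<Rightarrow> real ^ 'n"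
  assumes \<Phi>: "smooth_on B \<Phi>" "open B" and y0: "y0 \<in> B" and inj: "inj (frechet_derivative \<Phi> (at y0))"
  obtains U W g where "open U" "U \<subseteq> B" "y0 \<in> U" "open W" "\<Phi> y0 \<in> W" "homeomorphism U W \<Phi> g" "smooth_on W g"
proof -
  define \<Phi>' where "\<Phi>' y = Blinfun (frechet_derivative \<Phi> (at y))" for y
  have app: "blinfun_apply (\<Phi>' y) = frechet_derivative \<Phi> (at y)" if "y \<in> B" for y
    unfolding \<Phi>'_def
    by (rule bounded_linear_Blinfun_apply) (use smooth_on_linear_D[OF \<Phi> that] linear_conv_bounded_linear in blast)
  have "continuous_on B \<Phi>'"
  proof (rule continuous_on_blinfun_componentwise)
    fix i :: "real ^ 'n"
    show "continuous_on B (\<lambda>x. blinfun_apply (\<Phi>' x) i)"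
      using smooth_on_continuous[OF smooth_on_D[OF \<Phi>(1), of i]] by (simp add: app cong: continuous_on_cong)
  qed
  obtain L where L: "linear L" "L \<circ> frechet_derivative \<Phi> (at y0) = id"
    using linear_injective_left_inverse[OF smooth_on_linear_D[OF \<Phi> y0] inj] by blast
  have bL: "bounded_linear L" using L(1) linear_conv_bounded_linear by blast
  have "Blinfun L o\<^sub>L \<Phi>' y0 = id_blinfun"
    using L(2) by (intro blinfun_eqI) (simp add: bounded_linear_Blinfun_apply[OF bL] app[OF y0] fun_eq_iff)
  have der: "(\<Phi> has_derivative blinfun_apply (\<Phi>' x)) (at x)" if "x \<in> B" for x
    unfolding app[OF that] by (rule smooth_on_has_derivative[OF \<Phi> that])
  obtain U W g g' where UW: "open U" "U \<subseteq> B" "y0 \<in> U" "open W" "\<Phi> y0 \<in> W" "homeomorphism U W \<Phi> g"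
    and g': "\<And>x. x \<in> W \<Longrightarrow> (g has_derivative g' x) (at x)"
      "\<And>x. x \<in> W \<Longrightarrow> g' x = inv (blinfun_apply (\<Phi>' (g x)))"
      "\<And>x. x \<in> W \<Longrightarrow> bij (blinfun_apply (\<Phi>' (g x)))"
    using inverse_function_theorem[OF \<Phi>(2) der \<open>continuous_on B \<Phi>'\<close> y0 \<open>Blinfun L o\<^sub>L \<Phi>' y0 = id_blinfun\<close>]
    by metis
  have gU: "g x \<in> U" if "x \<in> W" for x using UW(6) that unfolding homeomorphism_def by blast
  have bij: "bij (frechet_derivative \<Phi> (at y))" if "y \<in> U" for y
  proof -
    have "\<Phi> y \<in> W" "g (\<Phi> y) = y" using UW(6) that unfolding homeomorphism_def by auto
    then show ?thesis using g'(3)[of "\<Phi> y"] app[of y] that UW(2) by auto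
  qed
  have sU: "smooth_on U \<Phi>" using smooth_on_subset[OF \<Phi>(1) UW(2)] .
  have sinv: "smooth_on U (\<lambda>y. inv (frechet_derivative \<Phi> (at y)) v)" for v
  proof (rule smooth_on_solve[OF UW(1)])
    show "smooth_on U (\<lambda>y. matrix (frechet_derivative \<Phi> (at y)) $ i $ j)" for i j
      unfolding matrix_def by (simp add: smooth_on_vec_nth[OF UW(1) smooth_on_D[OF sU]])
    show "smooth_on U (\<lambda>_. v)" by (rule smooth_on_const)
    fix y assume y: "y \<in> U"
    note l = smooth_on_linear_D[OF sU UW(1) y]
    show "invertible (matrix (frechet_derivative \<Phi> (at y)))"
      using bij[OF y] by (simp add: invertible_eq_bij l)
    show "matrix (frechet_derivative \<Phi> (at y)) *v inv (frechet_derivative \<Phi> (at y)) v = v"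
      using fun_cong[OF matrix_vector_mul(2)[OF l]] bij[OF y] by (simp add: bij_is_surj surj_f_inv_f)
  qed
  \<comment> \<open>The derivative of \<open>g\<close> is the inverse of that of \<Phi>, evaluated
    at \<open>g\<close>. The inverse depends smoothly on its base point, so \<open>g\<close> of
    class C^k has a derivative of class C^k.\<close>
  have "Ck_on k g W" for k
  proof (induction k)
    case 0 then show ?case using UW(6) by (simp add: homeomorphism_def)
  next
    case (Suc k)
    show ?case
    proof (rule Ck_on_SucI[OF UW(4) g'(1)])
      fix v
      have "Ck_on k (\<lambda>x. inv (frechet_derivative \<Phi> (at (g x))) v) W"
        using Ck_on_compose[OF UW(4,1) _ smooth_on_Ck[OF sinv] Suc.IH] gU by auto
      then show "Ck_on k (\<lambda>x. g' x v) W"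
      proof (rule Ck_on_cong[OF UW(4), rotated])
        fix z assume z: "z \<in> W"
        then have "g z \<in> B" using gU UW(2) by blast
        then show "inv (frechet_derivative \<Phi> (at (g z))) v = g' z v" by (simp add: g'(2)[OF z] app)
      qed
    qed
  qed
  then have "smooth_on W g" by (simp add: smooth_on_def)
  then show ?thesis using that UW by blast
qed

section \<open>Product coordinates (t, u)\<close>

lemma vsnoc_nth [simp]: "vsnoc u t $ Some i = u $ i" "vsnoc u t $ None = t"
  by (simp_all add: vsnoc_def)

lemma vsnoc_eqI: "(\<And>i. x $ Some i = u $ i) \<Longrightarrow> x $ None = t \<Longrightarrow> x = vsnoc u t"
  unfolding vec_eq_iff by (rule allI, rename_tac i, case_tac i) simp_all

lemma vsnoc_surj: "vsnoc (\<chi> i. x $ Some i) (x $ None) = x"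
  by (rule vsnoc_eqI[symmetric]) simp_all

lemma norm_vsnoc_le:
  fixes u :: "real ^ 'n::finite"
  shows "norm (vsnoc u t) \<le> norm u + \<bar>t\<bar>"
proof -
  have 1: "norm (vsnoc u (0::real)) = norm u" for u :: "real ^ 'n"
    by (simp add: norm_eq_sqrt_inner inner_vec_def sum_option)
  have 2: "norm (vsnoc (0 :: real ^ 'n) t) = \<bar>t\<bar>" by (simp add: norm_eq_sqrt_inner inner_vec_def sum_option)
  have "vsnoc u t = vsnoc u 0 + vsnoc 0 t"
    by (rule vsnoc_eqI[symmetric]) simp_all
  then show ?thesis using norm_triangle_ineq[of "vsnoc u 0" "vsnoc 0 t"] 1 2 by simp
qed

definition tube :: "real set \<Rightarrow> (real ^ 'k) set \<Rightarrow> (real ^ 'k::finite option) set"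
  where "tube I U = {vsnoc u t |t u. t \<in> I \<and> u \<in> U}"

lemma tube_neighbourhood:
  fixes x :: "real ^ 'k::finite option"
  assumes "open W" "x \<in> W"
  obtains I and U :: "(real ^ 'k) set" where "open I" "is_interval I" "open U" "convex U" "x \<in> tube I U" "tube I U \<subseteq> W"
    "open (tube I U)"
proof -
  obtain e where e: "e > 0" "ball x e \<subseteq> W" using assms open_contains_ball by blast
  let ?u = "\<chi> i. x $ Some i"
  define I where "I = ball (x $ None) (e / 2)"
  define U where "U = ball ?u (e / 2)"
  have "tube I U \<subseteq> W"
  proof
    fix z assume "z \<in> tube I U"
    then obtain u t where z: "z = vsnoc u t" "t \<in> I" "u \<in> U" by (auto simp: tube_def)
    have "x - z = vsnoc (?u - u) (x $ None - t)"
      by (rule vsnoc_eqI) (simp_all add: z)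
    then have "dist x z \<le> norm (?u - u) + \<bar>x $ None - t\<bar>" by (simp add: dist_norm norm_vsnoc_le)
    also have "\<dots> < e" using z by (auto simp: I_def U_def dist_norm)
    finally show "z \<in> W" using e by auto
  qed
  moreover have "x \<in> tube I U"
    using vsnoc_surj[of x, symmetric] e unfolding tube_def I_def U_def by fastforce
  moreover have "open (tube I U)"
  proof -
    have "tube I U = (\<lambda>x. x $ None) -` I \<inter> (\<lambda>x. \<chi> i. x $ Some i) -` U"
    proof (intro equalityI subsetI)
      fix x assume "x \<in> (\<lambda>x. x $ None) -` I \<inter> (\<lambda>x. \<chi> i. x $ Some i) -` U"
      then show "x \<in> tube I U" using vsnoc_surj[of x, symmetric] unfolding tube_def by blast
    qed (auto simp: tube_def vec_lambda_eta)
    moreover have "open ((\<lambda>x :: real ^ 'k option. x $ None) -` I)"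
      by (rule open_vimage) (auto simp: I_def intro!: continuous_intros)
    moreover have "open ((\<lambda>x :: real ^ 'k option. \<chi> i. x $ Some i) -` U)"
      by (rule open_vimage) (auto simp: U_def intro!: continuous_intros)
    ultimately show ?thesis by auto
  qed
  ultimately show ?thesis using that[of I U] by (auto simp: I_def U_def is_interval_ball_real)
qed

section \<open>Charts of the manifold and their adaptation\<close>

lemma chart_param:
  assumes "y \<in> chart_image c"
  shows "param c y \<in> fst c" "snd c (param c y) = y"
  using assms unfolding chart_image_def param_def by (auto intro: inv_into_into f_inv_into_f)

lemma chart_inj: assumes "is_chart X c" shows "inj_on (snd c) (fst c)"
proof -
  have "topspace (subtopology X (fst c)) = fst c"
    using assms openin_subset unfolding is_chart_def by (fastforce simp: topspace_subtopology)
  then show ?thesis using assms unfolding is_chart_def by (metis homeomorphic_imp_injective_map)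
qed

lemma param_chart: "is_chart X c \<Longrightarrow> m \<in> fst c \<Longrightarrow> param c (snd c m) = m"
  by (simp add: param_def chart_inj)

lemma chart_open_image:
  assumes c: "is_chart X c" and T: "openin X T"
  shows "open (snd c ` (fst c \<inter> T))"
proof -
  have o: "openin X (fst c)" "open (chart_image c)"
    and h: "homeomorphic_map (subtopology X (fst c)) (top_of_set (chart_image c)) (snd c)"
    using c by (auto simp: is_chart_def)
  have "openin (subtopology X (fst c)) (fst c \<inter> T)"
    using T by (auto simp: openin_subtopology_Int2)
  then have "openin (top_of_set (chart_image c)) (snd c ` (fst c \<inter> T))"
    using homeomorphic_map_openness_eq[OF h] by blast
  then show ?thesis using o(2) openin_open_trans by blast
qed

text \<open>Composes the chart \<open>c\<close> with \<Phi>, cut down so that the image is a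
  product. The local inverse \<open>g\<close> of \<Phi> is part of the result: it expresses the new
  parametrisation by the old one.\<close>

lemma adapted_chart:
  fixes A :: "('m, 'k::finite option) chart set"
  assumes mf: "smooth_manifold X A" and c: "c \<in> A" and p: "p \<in> fst c"
    and B: "open B" "B \<subseteq> chart_image c" "snd c p \<in> B" and \<Phi>: "smooth_on B \<Phi>" "inj (frechet_derivative \<Phi> (at (snd c p)))"
  obtains I U c' g where "open I" "is_interval I" "open U" "convex U" "c' \<in> maximal_atlas X A" "p \<in> fst c'"
    "chart_image c' = tube I U" "open (tube I U)" "smooth_on (tube I U) g"
    "\<And>x. x \<in> tube I U \<Longrightarrow> g x \<in> B \<and> \<Phi> (g x) = x \<and> param c' x = param c (g x)"
proof -
  have ch: "is_chart X d" if "d \<in> A" for d using mf that by (auto simp: smooth_manifold_def)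
  have co: "compatible d e" if "d \<in> A" "e \<in> A" for d e using mf that by (auto simp: smooth_manifold_def)
  have oc: "openin X (fst d)" if "d \<in> A" for d using ch[OF that] by (simp add: is_chart_def)
  obtain U1 W g where UW: "open U1" "U1 \<subseteq> B" "snd c p \<in> U1" "open W" "\<Phi> (snd c p) \<in> W"
    "homeomorphism U1 W \<Phi> g" "smooth_on W g"
    using smooth_inverse_function[OF \<Phi>(1) B(1,3) \<Phi>(2)] by blast
  obtain I and U :: "(real ^ 'k) set" where IU: "open I" "is_interval I" "open U" "convex U"
    "\<Phi> (snd c p) \<in> tube I U" "tube I U \<subseteq> W" "open (tube I U)"
    using tube_neighbourhood[OF UW(4,5)] by blast
  let ?b = "tube I U"
  \<comment> \<open>The part of \<open>U1\<close> that \<Phi> maps into the product; \<Phi> and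
    \<open>g\<close> are mutually inverse between it and \<open>tube I U\<close>.\<close>
  define N where "N = {y \<in> U1. \<Phi> y \<in> ?b}"
  have oN: "open N"
    using continuous_open_preimage[OF homeomorphism_cont1[OF UW(6)] UW(1) IU(7)] by (simp add: N_def Int_def vimage_def)
  have gb: "g x \<in> N" "\<Phi> (g x) = x" if "x \<in> ?b" for x
    using that IU(6) UW(6) unfolding homeomorphism_def N_def by auto
  have gN: "g (\<Phi> y) = y" "\<Phi> y \<in> ?b" if "y \<in> N" for y
    using that UW(6) unfolding homeomorphism_def N_def by auto
  have NB: "N \<subseteq> B" "N \<subseteq> chart_image c" using UW(2) B(2) by (auto simp: N_def)
  have sg: "smooth_on ?b g" using smooth_on_subset[OF UW(7) IU(6)] .
  have s\<Phi>: "smooth_on N \<Phi>" using smooth_on_subset[OF \<Phi>(1) NB(1)] .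
  define S where "S = {m \<in> fst c. snd c m \<in> N}"
  define c' where "c' = (S, \<Phi> \<circ> snd c)"
  have [simp]: "fst c' = S" "snd c' = \<Phi> \<circ> snd c" by (simp_all add: c'_def)
  have h: "homeomorphic_map (subtopology X (fst c)) (top_of_set (chart_image c)) (snd c)"
    using ch[OF c] by (simp add: is_chart_def)
  have tc: "topspace (subtopology X (fst c)) = fst c"
    using openin_subset[OF oc[OF c]] by (auto simp: topspace_subtopology)
  have "openin (subtopology X (fst c)) {m \<in> topspace (subtopology X (fst c)). snd c m \<in> N}"
    by (rule openin_continuous_map_preimage[OF homeomorphic_imp_continuous_map[OF h]])
      (use oN NB in \<open>auto intro: open_openin_trans open_subset\<close>)
  then have oS: "openin X S"
    unfolding tc S_def[symmetric] using openin_trans_full[OF _ oc[OF c]] by blast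
  have imS: "snd c ` S = N"
    using NB(2) by (auto simp: S_def chart_image_def)
  have img: "chart_image c' = ?b"
  proof -
    have "chart_image c' = \<Phi> ` N" by (simp only: chart_image_def \<open>fst c' = S\<close> \<open>snd c' = \<Phi> \<circ> snd c\<close> image_comp[symmetric] imS)
    also have "\<dots> = ?b"
    proof
      show "\<Phi> ` N \<subseteq> ?b" using gN(2) by blast
      show "?b \<subseteq> \<Phi> ` N"
      proof
        fix x assume "x \<in> ?b"
        from gb[OF this] show "x \<in> \<Phi> ` N" by (metis imageI)
      qed
    qed
    finally show ?thesis .
  qed
  have injS: "inj_on (\<Phi> \<circ> snd c) S"
  proof (rule inj_onI)
    fix m m' assume m: "m \<in> S" "m' \<in> S" "(\<Phi> \<circ> snd c) m = (\<Phi> \<circ> snd c) m'"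
    have N: "snd c m \<in> N" "snd c m' \<in> N" and C: "m \<in> fst c" "m' \<in> fst c" using m(1,2) by (simp_all add: S_def)
    have "\<Phi> (snd c m) = \<Phi> (snd c m')" using m(3) by simp
    then have "snd c m = snd c m'" using gN(1)[OF N(1)] gN(1)[OF N(2)] by metis
    then show "m = m'" by (rule inj_onD[OF chart_inj[OF ch[OF c]] _ C])
  qed
  have par: "param c' x = param c (g x)" if "x \<in> ?b" for x
  proof -
    have "g x \<in> chart_image c" using gb(1)[OF that] NB(2) by auto
    note cp = chart_param[OF this]
    show ?thesis unfolding param_def[of c']
      by (rule inv_into_f_eq) (use injS cp gb[OF that] in \<open>auto simp: S_def\<close>)
  qed
  have h1: "homeomorphic_map (subtopology X S) (top_of_set N) (snd c)"
  proof -
    have "homeomorphic_map (subtopology (subtopology X (fst c)) S) (subtopology (top_of_set (chart_image c)) N) (snd c)"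
      by (rule homeomorphic_map_subtopologies[OF h]) (use NB(2) imS tc in \<open>auto simp: S_def\<close>)
    moreover have "fst c \<inter> S = S" "chart_image c \<inter> N = N" using NB(2) by (auto simp: S_def)
    ultimately show ?thesis by (simp add: subtopology_subtopology)
  qed
  have h2: "homeomorphic_map (top_of_set N) (top_of_set ?b) \<Phi>"
  proof -
    have "homeomorphic_maps (top_of_set N) (top_of_set ?b) \<Phi> g"
      unfolding homeomorphic_maps_def
      using smooth_on_continuous[OF sg] smooth_on_continuous[OF s\<Phi>] gb gN
      by (auto simp: continuous_map_in_subtopology)
    then show ?thesis by (rule homeomorphic_maps_map[THEN iffD1, THEN conjunct1])
  qed
  have chart': "is_chart X c'"
    using oS IU(7) img homeomorphic_map_compose[OF h1 h2] by (simp add: is_chart_def)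
  have "compatible c' d" if d: "d \<in> A" for d
    unfolding compatible_def
  proof
    let ?O = "snd c ` (fst c \<inter> fst d)"
    have oO: "open ?O" by (rule chart_open_image[OF ch[OF c] oc[OF d]])
    have eq: "snd c' ` (fst c' \<inter> fst d) = {x \<in> ?b. g x \<in> ?O}" (is "?L = ?R")
    proof
      show "?L \<subseteq> ?R" using gN by (auto simp: S_def)
      show "?R \<subseteq> ?L"
      proof
        fix x assume x: "x \<in> ?R"
        then obtain m where m: "m \<in> fst c" "m \<in> fst d" "g x = snd c m" by auto
        then have "m \<in> S" using gb(1)[of x] x by (simp add: S_def)
        moreover have "x = \<Phi> (snd c m)" using gb(2)[of x] x m by simp
        ultimately show "x \<in> ?L" using m by auto
      qed
    qed
    have oR: "open ?R"
      using continuous_open_preimage[OF smooth_on_continuous[OF sg] IU(7) oO] by (simp add: Int_def vimage_def)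
    have "smooth_on ?R (\<lambda>x. (snd d \<circ> param c) (g x))"
    proof (rule smooth_on_compose[OF oR oO, where f = "snd d \<circ> param c"])
      show "smooth_on ?O (snd d \<circ> param c)" using co[OF c d] by (simp add: compatible_def)
      show "smooth_on ?R g" by (rule smooth_on_subset[OF sg]) blast
    qed blast
    then have "smooth_on ?R (snd d \<circ> param c')"
      by (rule smooth_on_cong[OF oR, rotated]) (simp add: par)
    then show "smooth_on (snd c' ` (fst c' \<inter> fst d)) (snd d \<circ> param c')" unfolding eq .
    let ?P = "snd d ` (fst c' \<inter> fst d)"
    have oP: "open ?P" using chart_open_image[OF ch[OF d] oS] by (simp add: Int_commute)
    have "smooth_on (snd d ` (fst c \<inter> fst d)) (snd c \<circ> param d)" using co[OF c d] by (simp add: compatible_def)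
    then have 1: "smooth_on ?P (snd c \<circ> param d)" by (rule smooth_on_subset) (auto simp: S_def)
    have "smooth_on ?P (\<lambda>x. \<Phi> ((snd c \<circ> param d) x))"
      by (rule smooth_on_compose[OF oP oN s\<Phi> 1]) (auto simp: S_def param_chart[OF ch[OF d]])
    then show "smooth_on ?P (snd c' \<circ> param d)" by (simp add: o_def)
  qed
  then have max: "c' \<in> maximal_atlas X A" using chart' by (simp add: maximal_atlas_def)
  have "snd c p \<in> N" using UW(3) IU(5) by (simp add: N_def)
  then have "p \<in> fst c'" using p by (simp add: S_def)
  then show ?thesis using that[of I U c' g] IU max img sg par gb NB by blast
qed

text \<open>Replaces integral manifolds. A function whose derivative vanishes on the kernel of dt
  has zero derivative in u, hence is constant on the convex slice; \<gamma> is its restriction to a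
  fixed u.\<close>

lemma leaf_function:
  fixes g :: "real ^ 'k::finite option \<Rightarrow> 'a::euclidean_space" and \<Phi> :: "'a \<Rightarrow> real ^ 'k option"
    and q :: "'a \<Rightarrow> real"
  assumes I: "open I" and U: "open U" "convex U" and b: "open (tube I U)" and g: "smooth_on (tube I U) g"
    and B: "open B" and \<Phi>: "smooth_on B \<Phi>" and gB: "\<And>x. x \<in> tube I U \<Longrightarrow> g x \<in> B \<and> \<Phi> (g x) = x"
    and q: "smooth_on B q" and leaf: "\<And>y w. y \<in> B \<Longrightarrow> D \<Phi> y w $ None = 0 \<Longrightarrow> D q y w = 0"
  obtains \<gamma> :: "real \<Rightarrow> real" where "smooth_on I \<gamma>" "\<And>t u. t \<in> I \<Longrightarrow> u \<in> U \<Longrightarrow> q (g (vsnoc u t)) = \<gamma> t"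
proof (cases "U = {}")
  case True
  then show ?thesis using that[of "\<lambda>_. 0"] smooth_on_const by auto
next
  case False
  then obtain u0 where u0: "u0 \<in> U" by blast
  have inb: "vsnoc u t \<in> tube I U" if "t \<in> I" "u \<in> U" for t u using that by (auto simp: tube_def)
  have "smooth_on I (\<lambda>t. vsnoc u0 t)"
  proof (rule smooth_on_vec[OF I])
    show "smooth_on I (\<lambda>t. vsnoc u0 t $ i)" for i
      by (cases i) (simp_all add: smooth_on_const smooth_on_ident[OF I])
  qed
  then have "smooth_on I (\<lambda>t. g (vsnoc u0 t))"
    by (rule smooth_on_compose[OF I b g]) (use u0 inb in auto)
  then have sm: "smooth_on I (\<lambda>t. q (g (vsnoc u0 t)))"
    by (rule smooth_on_compose[OF I B q]) (use u0 inb gB in auto)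
  have "q (g (vsnoc u t)) = q (g (vsnoc u0 t))" if t: "t \<in> I" and u: "u \<in> U" for t u
  proof (rule has_derivative_zero_unique[OF U(2) _ u u0])
    fix u assume u: "u \<in> U"
    let ?x = "vsnoc u t"
    note x = inb[OF t u]
    have l: "linear (\<lambda>v. vsnoc v 0)"
      by (rule linearI; rule vsnoc_eqI[symmetric]; simp)
    have eq: "(\<lambda>u. vsnoc u t) = (\<lambda>u. vsnoc u 0 + vsnoc 0 t)"
      by (rule ext, rule vsnoc_eqI[symmetric]) simp_all
    have 1: "((\<lambda>u. vsnoc u t) has_derivative (\<lambda>v. vsnoc v 0)) (at u)"
      unfolding eq by (rule has_derivative_add_const[OF linear_imp_has_derivative[OF l]])
    have dg: "g differentiable (at ?x)" and dq: "q differentiable (at (g ?x))" and d\<Phi>: "\<Phi> differentiable (at (g ?x))"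
      using smooth_on_differentiable[OF g b x] smooth_on_differentiable[OF q B] smooth_on_differentiable[OF \<Phi> B]
        gB[OF x] by auto
    \<comment> \<open>Since \<Phi> after \<open>g\<close> is the identity, a vector
      \<open>vsnoc v 0\<close> is sent by \<open>g\<close> to one that does not change t.\<close>
    have "D q (g ?x) (D g ?x (vsnoc v 0)) = 0" for v
    proof (rule leaf)
      have dc: "(\<lambda>x. \<Phi> (g x)) differentiable (at ?x)"
        using differentiable_chain_at[OF dg d\<Phi>] by (simp add: o_def)
      have "D \<Phi> (g ?x) (D g ?x (vsnoc v 0)) = D (\<lambda>x. \<Phi> (g x)) ?x (vsnoc v 0)"
        by (rule D_compose[OF d\<Phi> dg, symmetric])
      also have "\<dots> = D (\<lambda>x. x) ?x (vsnoc v 0)"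
        by (rule D_cong_open[OF b x _ dc]) (use gB in auto)
      finally show "D \<Phi> (g ?x) (D g ?x (vsnoc v 0)) $ None = 0" by simp
    qed (use gB[OF x] in auto)
    moreover have "((\<lambda>u. q (g (vsnoc u t))) has_derivative (\<lambda>v. D q (g ?x) (D g ?x (vsnoc v 0)))) (at u)"
      using has_derivative_compose[OF has_derivative_compose[OF 1 dg[unfolded frechet_derivative_works]]
          dq[unfolded frechet_derivative_works]] .
    ultimately show "((\<lambda>u. q (g (vsnoc u t))) has_derivative (\<lambda>v. 0)) (at u within U)"
      by (simp add: has_derivative_at_withinI)
  qed
  then show ?thesis using that[OF sm] by blast
qed

section \<open>Normal forms\<close>

text \<open>The last weight is \<open>\<plusminus>1\<close> for the quadrics with centre and \<open>0\<close> for the paraboloids.\<close>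
definition qf :: "real \<Rightarrow> real ^ 'k::finite option option \<Rightarrow> real ^ 'k option option \<Rightarrow> real"
  where "qf e x z = (\<Sum>l\<in>UNIV. x $ Some (Some l) * z $ Some (Some l)) + e * (x $ Some None * z $ Some None)"

lemma bounded_bilinear_qf: "bounded_bilinear (qf e)"
  unfolding bilinear_conv_bounded_bilinear[symmetric] bilinear_def
  by (auto simp: linear_iff qf_def sum.distrib algebra_simps sum_distrib_left)

interpretation qf: bounded_bilinear "qf e" for e by (rule bounded_bilinear_qf)

lemma qf_sym: "qf e x z = qf e z x"
  by (simp add: qf_def mult.commute)

lemma qf_sum_scale:
  "qf e (\<Sum>n\<in>UNIV. c n *\<^sub>R x n) z = (\<Sum>n\<in>UNIV. c n * qf e (x n) z)"
  "qf e z (\<Sum>n\<in>UNIV. c n *\<^sub>R x n) = (\<Sum>n\<in>UNIV. c n * qf e z (x n))"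
  by (simp_all add: qf.sum_left qf.sum_right qf.scaleR_left qf.scaleR_right)

lemma D_qf:
  "f differentiable (at y) \<Longrightarrow> g differentiable (at y) \<Longrightarrow>
    D (\<lambda>z. qf e (f z) (g z)) y v = qf e (f y) (D g y v) + qf e (D f y v) (g y)"
  by (rule D_bilinear[OF bounded_bilinear_qf])

lemmas smooth_on_qf = smooth_on_bilinear[OF bounded_bilinear_qf]

section \<open>Quadratic forms on the leaves and adapted coordinates\<close>

context normal_frame begin

text \<open>Makes the X_i orthogonal of common square length s, and orthogonal to Z, for a fixed
  quadratic form of the hyperplane. The conditions on s are those under which the defects solve a
  homogeneous system. The number \<open>c\<close> is 0 for paraboloids, where s is known to be
  constant on leaves, and 1 for quadrics with centre, where this is only a consequence of the
  orthogonality to Z.\<close>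

lemma leaf_metric:
  assumes s: "smooth_on V s" and y0: "y0 \<in> V" and y: "y \<in> V"
    and Z: "\<And>y. y \<in> V \<Longrightarrow> qf e (Z y) (Z y) = \<zeta> y * s y"
    and Ds: "\<And>y m. y \<in> V \<Longrightarrow> D s y (E (Some m) y) = - 2 * c * qf e (X (Some m) y) (Z y)"
      "\<And>y. y \<in> V \<Longrightarrow> D s y (E None y) = (\<alpha> y - \<beta> y) * s y"
    and init: "\<And>i j. qf e (X (Some i) y0) (X (Some j) y0) = (if i = j then s y0 else 0)"
      "\<And>i. qf e (X (Some i) y0) (Z y0) = 0"
  shows "qf e (X (Some i) y) (X (Some j) y) = (if i = j then s y else 0)" "qf e (X (Some i) y) (Z y) = 0"
proof -
  \<comment> \<open>The defects: Gram matrix of the X_i minus s times the identity, and the products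
    with Z.\<close>
  define G :: "'k \<times> 'k + 'k \<Rightarrow> real ^ 'k option \<Rightarrow> real" where
    "G p y = (case p of Inl (i, j) \<Rightarrow> qf e (X (Some i) y) (X (Some j) y) - (if i = j then 1 else 0) * s y
      | Inr i \<Rightarrow> qf e (X (Some i) y) (Z y))" for p y
  have G: "G (Inl (i, j)) = (\<lambda>y. qf e (X (Some i) y) (X (Some j) y) - (if i = j then 1 else 0) * s y)"
    "G (Inr i) = (\<lambda>y. qf e (X (Some i) y) (Z y))" for i j by (auto simp: G_def)
  have XX: "qf e (X (Some i) y) (X (Some j) y) = G (Inl (i, j)) y + (if i = j then 1 else 0) * s y"
    and XZ: "qf e (X (Some i) y) (Z y) = G (Inr i) y" "qf e (Z y) (X (Some i) y) = G (Inr i) y" for i j y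
    by (simp_all add: G qf_sym)
  have gen: "in_ideal V G (G p)" for p by (rule in_ideal_generator)
  have sXX: "smooth_on V (\<lambda>y. qf e (X (Some i) y) (X (Some j) y))" for i j
    by (intro smooth_on_qf open_V smooth_X)
  have ss: "smooth_on V (\<lambda>y. (if i = j then 1 else 0) * s y)" for i j :: 'k
    by (intro smooth_on_mult open_V s smooth_on_const)
  have sG: "smooth_on V (G p)" for p
  proof (cases p)
    case (Inl ij)
    then show ?thesis by (cases ij) (simp only: G smooth_on_diff[OF open_V sXX ss])
  next
    case (Inr i) then show ?thesis by (simp only: G smooth_on_qf[OF open_V smooth_X smooth_Z])
  qed
  have DG1: "D (G (Inl (i, j))) y v = qf e (X (Some i) y) (D (X (Some j)) y v)
      + qf e (D (X (Some i)) y v) (X (Some j) y) - (if i = j then 1 else 0) * D s y v" if "y \<in> V" for i j y v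
    unfolding G D_diff[OF smooth_on_differentiable[OF sXX open_V that] smooth_on_differentiable[OF ss open_V that]]
      D_qf[OF diff(2)[OF that] diff(2)[OF that]] D_mult[OF differentiable_const smooth_on_differentiable[OF s open_V that]] by simp
  have DG2: "D (G (Inr i)) y v = qf e (X (Some i) y) (D Z y v) + qf e (D (X (Some i)) y v) (Z y)" if "y \<in> V" for i y v
    unfolding G D_qf[OF diff(2)[OF that] diff(3)[OF that]] ..
  have sk: "(\<Sum>n\<in>UNIV. a n * (G (Inl (i, n)) y + (if i = n then 1 else 0) * s y)) = (\<Sum>n\<in>UNIV. a n * G (Inl (i, n)) y) + a i * s y"
    "(\<Sum>n\<in>UNIV. a n * (G (Inl (n, i)) y + (if n = i then 1 else 0) * s y)) = (\<Sum>n\<in>UNIV. a n * G (Inl (n, i)) y) + a i * s y"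
    for a :: "'k \<Rightarrow> real" and i y
    by (simp_all add: distrib_left sum.distrib if_distrib[of "\<lambda>x. x * _"] if_distrib[of "\<lambda>x. _ * x"] cong: if_cong)
  have "G p y = 0" for p
  proof (rule vanish[OF sG _ _ y0 _ y])
    fix p m
    show "in_ideal V G (\<lambda>y. D (G p) y (E (Some m) y))"
    proof (cases p)
      case (Inl ij)
      obtain i j where ij: "ij = (i, j)" by (cases ij)
      \<comment> \<open>After inserting the defects, the remaining terms with s cancel by skewness
        of \<open>C\<close> in its last indices, and the derivative of s contributes the product of
        X_m with Z.\<close>
      have "in_ideal V G (\<lambda>y. (\<Sum>n\<in>UNIV. C m j n y * G (Inl (i, n)) y) + (\<Sum>n\<in>UNIV. C m i n y * G (Inl (n, j)) y)
        + (if m = j then 1 else 0) * G (Inr i) y + (if m = i then 1 else 0) * G (Inr j) y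
        + (if i = j then 2 * c else 0) * G (Inr m) y)"
        by (intro in_ideal_add in_ideal_sum in_ideal_mult gen continuous_on_const cont) auto
      then show ?thesis
      proof (rule in_ideal_cong)
        fix y assume y: "y \<in> V"
        show "D (G p) y (E (Some m) y) = (\<Sum>n\<in>UNIV. C m j n y * G (Inl (i, n)) y) + (\<Sum>n\<in>UNIV. C m i n y * G (Inl (n, j)) y)
        + (if m = j then 1 else 0) * G (Inr i) y + (if m = i then 1 else 0) * G (Inr j) y
        + (if i = j then 2 * c else 0) * G (Inr m) y"
          using C_skew[OF y, of m i j]
          by (simp add: Inl ij DG1[OF y] D_Xi[OF y] Ds[OF y] qf.add_left qf.add_right qf_sum_scale XX XZ sk
              if_distrib[of "qf e _"] if_distrib[of "\<lambda>x. qf e x _"] qf.zero_left qf.zero_right)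
      qed
    next
      case (Inr i)
      have "in_ideal V G (\<lambda>y. (\<Sum>n\<in>UNIV. C m i n y * G (Inr n) y) + (- \<zeta> y) * G (Inl (i, m)) y)"
        by (intro in_ideal_add in_ideal_sum in_ideal_mult gen continuous_intros cont) auto
      then show ?thesis
      proof (rule in_ideal_cong)
        fix y assume y: "y \<in> V"
        show "D (G p) y (E (Some m) y) = (\<Sum>n\<in>UNIV. C m i n y * G (Inr n) y) + (- \<zeta> y) * G (Inl (i, m)) y"
          by (simp add: Inr DG2[OF y] D_Xi[OF y] D_Z[OF y] qf.add_left qf.add_right qf_sum_scale XX XZ Z[OF y]
              if_distrib[of "\<lambda>x. qf e x _"] qf.zero_left qf.minus_right qf.scaleR_right algebra_simps)
      qed
    qed
    show "in_ideal V G (\<lambda>y. D (G p) y (E None y))"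
    proof (cases p)
      case (Inl ij)
      obtain i j where ij: "ij = (i, j)" by (cases ij)
      have "in_ideal V G (\<lambda>y. (\<Sum>n\<in>UNIV. M j n y * G (Inl (i, n)) y) + (\<Sum>n\<in>UNIV. M i n y * G (Inl (n, j)) y))"
        by (intro in_ideal_add in_ideal_sum in_ideal_mult gen cont) auto
      then show ?thesis
      proof (rule in_ideal_cong)
        fix y assume y: "y \<in> V"
        \<comment> \<open>The symmetric part of \<open>M\<close> is exactly half the growth rate of
          s, so the terms with s cancel here as well.\<close>
        have "M i j y * s y + M j i y * s y = (if i = j then 1 else 0) * ((\<alpha> y - \<beta> y) * s y)"
          using M_sym[OF y, of i j] by (simp add: distrib_right[symmetric])
        then show "D (G p) y (E None y) = (\<Sum>n\<in>UNIV. M j n y * G (Inl (i, n)) y) + (\<Sum>n\<in>UNIV. M i n y * G (Inl (n, j)) y)"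
          by (simp add: Inl ij DG1[OF y] D_Xi[OF y] Ds[OF y] qf_sum_scale XX sk)
      qed
    next
      case (Inr i)
      have "in_ideal V G (\<lambda>y. (\<Sum>n\<in>UNIV. M i n y * G (Inr n) y) + (- \<beta> y) * G (Inr i) y)"
        by (intro in_ideal_add in_ideal_sum in_ideal_mult gen continuous_intros cont) auto
      then show ?thesis
      proof (rule in_ideal_cong)
        fix y assume y: "y \<in> V"
        show "D (G p) y (E None y) = (\<Sum>n\<in>UNIV. M i n y * G (Inr n) y) + (- \<beta> y) * G (Inr i) y"
          by (simp add: Inr DG2[OF y] D_Xi[OF y] D_Z[OF y] qf_sum_scale XZ qf.minus_right qf.scaleR_right)
      qed
    qed
    show "G p y0 = 0"
    proof (cases p)
      case (Inl ij) then show ?thesis by (cases ij) (simp add: G init)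
    qed (simp add: G init)
  qed
  from this[of "Inl (i, j)"] this[of "Inr i"]
  show "qf e (X (Some i) y) (X (Some j) y) = (if i = j then s y else 0)" "qf e (X (Some i) y) (Z y) = 0"
    by (simp_all add: G)
qed

lemma D_expand:
  fixes g :: "real ^ 'k option \<Rightarrow> 'b::real_normed_vector"
  assumes "y \<in> V" "g differentiable (at y)"
  shows "D g y w = \<theta> None y w *\<^sub>R D g y (E None y) + (\<Sum>i\<in>UNIV. \<theta> (Some i) y w *\<^sub>R D g y (E (Some i) y))"
proof -
  note l = linear_frechet_derivative[OF assms(2)]
  have "D g y w = D g y (\<Sum>a\<in>UNIV. \<theta> a y w *\<^sub>R E a y)" by (rule arg_cong[OF E_expand[OF assms(1)]])
  then show ?thesis by (simp add: linear_sum[OF l] linear_add[OF l] linear_cmul[OF l] sum_option)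
qed

lemma D_f_nth: "y \<in> V \<Longrightarrow> D (\<lambda>y. f y $ p) y (E a y) = X a y $ p"
  by (simp add: D_vec_nth diff D_f)

lemma height_nonzero:
  assumes leaf: "\<And>i. X (Some i) y $ None = 0" "Z y $ None = 0" and y: "y \<in> V"
  shows "X None y $ None \<noteq> 0"
proof
  assume "X None y $ None = 0"
  then have "axis None 1 \<bullet> X a y = 0" for a using leaf by (cases a) (auto simp: inner_axis')
  moreover have "axis None 1 \<bullet> Z y = 0" using leaf by (simp add: inner_axis')
  ultimately have "axis None (1::real) = (0 :: real ^ 'k option option)" by (rule spanning[OF y])
  then show False by (simp add: axis_eq_0_iff)
qed

text \<open>The height of \<open>f\<close> varies only along X_1, and there it does, by
  \<open>height_nonzero\<close>; so its kernel is the leaf direction. The functions \<open>u\<close>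
  need to separate the X_i at the base point only, which suffices for an injective
  derivative.\<close>

lemma adapted_coordinates:
  assumes leaf: "\<And>y i. y \<in> V \<Longrightarrow> X (Some i) y $ None = 0" "\<And>y. y \<in> V \<Longrightarrow> Z y $ None = 0"
    and B: "open B" "B \<subseteq> V" "y0 \<in> B" and u: "\<And>l. smooth_on B (u l)"
    and Du: "\<And>i l. D (u l) y0 (E (Some i) y0) = (if i = l then c else 0)" "c \<noteq> (0::real)"
    and \<Phi>: "\<Phi> = (\<lambda>y. vsnoc (\<chi> l. u l y) (f y $ None))"
  shows "smooth_on B \<Phi>" "inj (frechet_derivative \<Phi> (at y0))"
    "\<And>q y w. smooth_on B q \<Longrightarrow> (\<And>y i. y \<in> B \<Longrightarrow> D q y (E (Some i) y) = (0::real)) \<Longrightarrow>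
      y \<in> B \<Longrightarrow> D \<Phi> y w $ None = 0 \<Longrightarrow> D q y w = 0"
proof -
  have n: "\<Phi> y $ None = f y $ None" "\<Phi> y $ Some l = u l y" for y l by (simp_all add: \<Phi>)
  have sf: "smooth_on B (\<lambda>y. f y $ None)"
    using smooth_on_vec_nth[OF B(1) smooth_on_subset[OF smooth_f B(2)]] .
  show s\<Phi>: "smooth_on B \<Phi>"
  proof (rule smooth_on_vec[OF B(1)])
    show "smooth_on B (\<lambda>y. \<Phi> y $ i)" for i using u sf by (cases i) (simp_all add: n)
  qed
  have d\<Phi>: "\<Phi> differentiable (at y)" if "y \<in> B" for y using smooth_on_differentiable[OF s\<Phi> B(1) that] .
  have Dn: "D \<Phi> y w $ None = \<theta> None y w * X None y $ None" "D \<Phi> y w $ Some l = D (u l) y w" if y: "y \<in> B" for y w l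
  proof -
    have yV: "y \<in> V" using y B(2) by blast
    have "D \<Phi> y w $ i = D (\<lambda>y. \<Phi> y $ i) y w" for i by (rule D_vec_nth[OF d\<Phi>[OF y], symmetric])
    note * = this[of None, unfolded n] this[of "Some l", unfolded n]
    show "D \<Phi> y w $ Some l = D (u l) y w" using * by simp
    show "D \<Phi> y w $ None = \<theta> None y w * X None y $ None"
      unfolding *(1) D_expand[OF yV smooth_on_differentiable[OF sf B(1) y], of w]
      by (simp add: D_f_nth[OF yV] leaf[OF yV])
  qed
  have \<theta>0: "\<theta> None y w = 0" if "y \<in> B" "D \<Phi> y w $ None = 0" for y w
    using that Dn(1)[OF that(1), of w] height_nonzero[of y] leaf B(2) by auto
  show "D q y w = 0" if "smooth_on B q" "\<And>y i. y \<in> B \<Longrightarrow> D q y (E (Some i) y) = (0::real)"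
      "y \<in> B" "D \<Phi> y w $ None = 0" for q y w
  proof -
    have yV: "y \<in> V" using that(3) B(2) by blast
    show ?thesis
      unfolding D_expand[OF yV smooth_on_differentiable[OF that(1) B(1) that(3)], of w]
      using that(2)[OF that(3)] \<theta>0[OF that(3,4)] by simp
  qed
  show "inj (frechet_derivative \<Phi> (at y0))"
  proof (rule linear_injective_0[OF linear_frechet_derivative[OF d\<Phi>[OF B(3)]], THEN iffD2], intro allI impI)
    fix w assume w: "D \<Phi> y0 w = 0"
    have yV: "y0 \<in> V" using B by blast
    have t: "\<theta> None y0 w = 0" by (rule \<theta>0[OF B(3)]) (simp add: w)
    have "\<theta> (Some l) y0 w = 0" for l
    proof -
      have "0 = D (u l) y0 w" using Dn(2)[OF B(3), of w l] by (simp add: w)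
      also have "\<dots> = (\<Sum>i\<in>UNIV. \<theta> (Some i) y0 w * (if i = l then c else 0))"
        unfolding D_expand[OF yV smooth_on_differentiable[OF u B(1,3)], of l w] by (simp add: t Du)
      also have "\<dots> = \<theta> (Some l) y0 w * c" by (simp add: if_distrib[of "\<lambda>x. _ * x"] cong: if_cong)
      finally show ?thesis using Du(2) by simp
    qed
    then show "w = 0" using E_expand[OF yV, of w] t by (simp only: sum_option) simp
  qed
qed

section \<open>Leaves that are paraboloids\<close>

lemma Z_component_zero:
  assumes "\<And>y. y \<in> V \<Longrightarrow> \<zeta> y = 0" "y0 \<in> V" "Z y0 $ p = 0" "y \<in> V"
  shows "Z y $ p = 0"
  by (rule vanish1[where c = "\<lambda>y. - \<beta> y" and g = "\<lambda>y. Z y $ p" and ?y0.0 = y0])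
    (use assms in \<open>auto simp: D_vec_nth diff D_Z intro!: smooth_on_vec_nth open_V smooth_Z continuous_intros cont\<close>)

text \<open>The function \<tau> is the scale of the leaf: the height of \<open>f\<close> when the
  leaf is moved by a homothety, the constant 1 when it is translated. Both cases with \<zeta> = 0
  are instances.\<close>

lemma parabolic_form:
  assumes y0: "y0 \<in> V" and \<zeta>: "\<And>y. y \<in> V \<Longrightarrow> \<zeta> y = 0"
    and init: "\<And>i. X (Some i) y0 = axis (Some (Some i)) 1" "Z y0 = axis (Some None) 1" "\<And>l. f y0 $ Some (Some l) = 0"
    and \<tau>: "smooth_on V \<tau>" "\<And>y. y \<in> V \<Longrightarrow> \<tau> y \<noteq> 0" "\<And>y i. y \<in> V \<Longrightarrow> D \<tau> y (E (Some i) y) = 0"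
      "\<And>y. y \<in> V \<Longrightarrow> D \<tau> y (E None y) = \<alpha> y * \<tau> y" "\<tau> y0 = 1"
    and X0: "\<And>y l. y \<in> V \<Longrightarrow> X None y $ Some (Some l) = \<alpha> y * f y $ Some (Some l)"
  obtains \<Phi> q where "smooth_on V \<Phi>" "inj (frechet_derivative \<Phi> (at y0))" "smooth_on V q"
    "\<And>y w. y \<in> V \<Longrightarrow> D \<Phi> y w $ None = 0 \<Longrightarrow> D q y w = (0::real)"
    "\<And>y. y \<in> V \<Longrightarrow> \<Phi> y $ None = f y $ None"
    "\<And>y. y \<in> V \<Longrightarrow> f y = vsnoc (vsnoc (\<tau> y *\<^sub>R (\<chi> l. \<Phi> y $ Some l)) (\<tau> y * (norm (\<chi> l. \<Phi> y $ Some l))\<^sup>2 / 2 + q y)) (f y $ None)"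
proof -
  have Zl: "Z y $ Some (Some l) = 0" if "y \<in> V" for y l
    by (rule Z_component_zero[OF \<zeta> y0 _ that]) (simp_all add: init axis_def)
  have leaf: "X (Some i) y $ None = 0" "Z y $ None = 0" if "y \<in> V" for y i
    by (rule leaf_direction[OF _ _ y0 that]; simp add: init axis_def)+
  have dZ: "(\<lambda>y. Z y $ p) differentiable (at y)" and dX: "(\<lambda>y. X a y $ p) differentiable (at y)"
    and df: "(\<lambda>y. f y $ p) differentiable (at y)" and d\<tau>: "\<tau> differentiable (at y)" if "y \<in> V" for p y a
    using diff[OF that] smooth_on_differentiable[OF \<tau>(1) open_V that]
    by (auto intro: differentiable_bounded_linear[OF bounded_linear_vec_nth])
  \<comment> \<open>Z contributes the rate - \<beta> and \<tau> the rate \<alpha>, so that s grows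
    along X_1 as \<open>leaf_metric\<close> demands; it equals 1 at the base point.\<close>
  define s where "s y = Z y $ Some None * \<tau> y" for y
  have ss: "smooth_on V s" unfolding s_def[abs_def] by (intro smooth_on_mult smooth_on_vec_nth open_V smooth_Z \<tau>)
  have metric: "qf 0 (X (Some i) y) (X (Some j) y) = (if i = j then s y else 0)" if "y \<in> V" for i j y
  proof (rule leaf_metric(1)[OF ss y0 that, where c = 0])
    show "qf 0 (Z y) (Z y) = \<zeta> y * s y" if "y \<in> V" for y by (simp add: qf_def Zl[OF that] \<zeta>[OF that])
    show "D s y (E (Some m) y) = - 2 * 0 * qf 0 (X (Some m) y) (Z y)" "D s y (E None y) = (\<alpha> y - \<beta> y) * s y"
      if "y \<in> V" for y m
      unfolding s_def[abs_def] D_mult[OF dZ[OF that] d\<tau>[OF that]] D_vec_nth[OF diff(3)[OF that]]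
      by (simp_all add: D_Z[OF that] \<tau>(3,4)[OF that] \<zeta>[OF that] algebra_simps)
    show "qf 0 (X (Some i) y0) (X (Some j) y0) = (if i = j then s y0 else 0)" for i j
      by (simp add: qf_def init s_def \<tau>(5) axis_def if_distrib[of "\<lambda>x. x * _"] cong: if_cong)
    show "qf 0 (X (Some i) y0) (Z y0) = 0" for i by (simp add: qf_def init axis_def)
  qed
  \<comment> \<open>The components of \<open>f\<close> and \<tau> have the same growth rate \<alpha>
    along X_1, so the quotient is constant in that direction.\<close>
  define u where "u l y = f y $ Some (Some l) * inverse (\<tau> y)" for l y
  have s\<tau>i: "smooth_on V (\<lambda>y. inverse (\<tau> y))" by (rule smooth_on_inverse[OF open_V \<tau>(1,2)])
  have su: "smooth_on V (u l)" for l
    unfolding u_def[abs_def] by (intro smooth_on_mult smooth_on_vec_nth open_V smooth_f s\<tau>i)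
  have du: "u l differentiable (at y)" if "y \<in> V" for l y using smooth_on_differentiable[OF su open_V that] .
  have D\<tau>i: "D (\<lambda>y. inverse (\<tau> y)) y v = - (inverse (\<tau> y) * D \<tau> y v * inverse (\<tau> y))" if "y \<in> V" for y v
    by (rule D_eqI[OF Deriv.has_derivative_inverse[OF \<tau>(2)[OF that] d\<tau>[OF that, unfolded frechet_derivative_works]]])
  have Du: "D (u l) y (E (Some i) y) = X (Some i) y $ Some (Some l) / \<tau> y" "D (u l) y (E None y) = 0" if "y \<in> V" for l i y
    unfolding u_def[abs_def] D_mult[OF df[OF that] smooth_on_differentiable[OF s\<tau>i open_V that]] D\<tau>i[OF that] D_f_nth[OF that]
    using \<tau>(2)[OF that] by (simp_all add: \<tau>(3,4)[OF that] X0[OF that] field_simps)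
  \<comment> \<open>This is the X_i-derivative of the function \<open>q\<close> below. The term Z in
    the derivative of X_i is compensated by the metric, since s / \<tau> is the axis component of
    Z.\<close>
  define G where "G i y = X (Some i) y $ Some None - (\<Sum>l\<in>UNIV. u l y * X (Some i) y $ Some (Some l))" for i y
  have sG1: "smooth_on V (\<lambda>y. X (Some i) y $ p)" for i p by (intro smooth_on_vec_nth open_V smooth_X)
  have sG2: "smooth_on V (\<lambda>y. \<Sum>l\<in>UNIV. u l y * X (Some i) y $ Some (Some l))" for i
    by (intro smooth_on_sum smooth_on_mult open_V su sG1) auto
  have DG: "D (G i) y v = D (X (Some i)) y v $ Some None
      - (\<Sum>l\<in>UNIV. u l y * D (X (Some i)) y v $ Some (Some l) + D (u l) y v * X (Some i) y $ Some (Some l))"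
    if "y \<in> V" for i y v
  proof -
    have d: "(\<lambda>y. u l y * X (Some i) y $ Some (Some l)) differentiable (at y)" for l
      using du[OF that] dX[OF that] by (intro differentiable_mult)
    have "D (G i) y v = D (X (Some i)) y v $ Some None - (\<Sum>l\<in>UNIV. D (\<lambda>y. u l y * X (Some i) y $ Some (Some l)) y v)"
      unfolding G_def[abs_def] D_diff[OF dX[OF that] smooth_on_differentiable[OF sG2 open_V that]]
        D_sum[OF d] D_vec_nth[OF diff(2)[OF that]] ..
    then show ?thesis by (simp add: D_mult[OF du[OF that] dX[OF that]] D_vec_nth[OF diff(2)[OF that]])
  qed
  have G_sum: "(\<Sum>n\<in>UNIV. a n * G n y) = (\<Sum>n\<in>UNIV. a n * X (Some n) y $ Some None)
      - (\<Sum>l\<in>UNIV. u l y * (\<Sum>n\<in>UNIV. a n * X (Some n) y $ Some (Some l)))" for a y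
  proof -
    have "(\<Sum>l\<in>UNIV. u l y * (\<Sum>n\<in>UNIV. a n * X (Some n) y $ Some (Some l)))
        = (\<Sum>l\<in>UNIV. \<Sum>n\<in>UNIV. a n * (u l y * X (Some n) y $ Some (Some l)))"
      by (simp add: sum_distrib_left mult_ac)
    also have "\<dots> = (\<Sum>n\<in>UNIV. \<Sum>l\<in>UNIV. a n * (u l y * X (Some n) y $ Some (Some l)))" by (rule sum.swap)
    finally show ?thesis by (simp add: G_def right_diff_distrib sum_subtractf sum_distrib_left)
  qed
  have G0: "G i y = 0" if "y \<in> V" for i y
  proof (rule vanish[where G = G, OF _ _ _ y0 _ that])
    fix i m
    show "smooth_on V (G i)" unfolding G_def[abs_def] by (rule smooth_on_diff[OF open_V sG1 sG2])
    have "in_ideal V G (\<lambda>y. \<Sum>n\<in>UNIV. C m i n y * G n y)"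
      by (intro in_ideal_sum in_ideal_mult in_ideal_generator cont) auto
    then show "in_ideal V G (\<lambda>y. D (G i) y (E (Some m) y))"
    proof (rule in_ideal_cong)
      fix y assume y: "y \<in> V"
      have "(\<Sum>l\<in>UNIV. D (u l) y (E (Some m) y) * X (Some i) y $ Some (Some l)) = qf 0 (X (Some m) y) (X (Some i) y) / \<tau> y"
        by (simp add: Du[OF y] qf_def sum_divide_distrib)
      also have "\<dots> = (if m = i then Z y $ Some None else 0)"
        using \<tau>(2)[OF y] by (simp add: metric[OF y] s_def)
      finally have 1: "(\<Sum>l\<in>UNIV. D (u l) y (E (Some m) y) * X (Some i) y $ Some (Some l)) = (if m = i then Z y $ Some None else 0)" .
      have 2: "D (X (Some i)) y (E (Some m) y) $ Some (Some l) = (\<Sum>n\<in>UNIV. C m i n y * X (Some n) y $ Some (Some l))" for l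
        by (simp add: D_Xi[OF y] Zl[OF y])
      have 3: "D (X (Some i)) y (E (Some m) y) $ Some None = (\<Sum>n\<in>UNIV. C m i n y * X (Some n) y $ Some None)
          + (if m = i then Z y $ Some None else 0)"
        by (simp add: D_Xi[OF y])
      show "D (G i) y (E (Some m) y) = (\<Sum>n\<in>UNIV. C m i n y * G n y)"
        unfolding DG[OF y] G_sum 2 3 sum.distrib 1 by simp
    qed
    have "in_ideal V G (\<lambda>y. \<Sum>n\<in>UNIV. M i n y * G n y)"
      by (intro in_ideal_sum in_ideal_mult in_ideal_generator cont) auto
    then show "in_ideal V G (\<lambda>y. D (G i) y (E None y))"
      by (rule in_ideal_cong) (simp add: DG G_sum D_Xi Du)
    show "G i y0 = 0" by (simp add: G_def init u_def axis_def)
  qed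
  define \<Phi> where "\<Phi> y = vsnoc (\<chi> l. u l y) (f y $ None)" for y
  \<comment> \<open>What is left of the axis component after subtracting the paraboloid; it becomes
    \<gamma>_2.\<close>
  define q where "q y = f y $ Some None - \<tau> y * (\<Sum>l\<in>UNIV. u l y * u l y) * (1/2)" for y
  have uu: "smooth_on V (\<lambda>y. \<Sum>l\<in>UNIV. u l y * u l y)" by (intro smooth_on_sum smooth_on_mult open_V su) auto
  have sq: "smooth_on V q"
    unfolding q_def[abs_def] by (intro smooth_on_diff smooth_on_mult smooth_on_vec_nth open_V smooth_f \<tau> uu smooth_on_const)
  have Dq: "D q y (E (Some i) y) = 0" if y: "y \<in> V" for y i
  proof -
    have d1: "(\<lambda>y. \<tau> y * (\<Sum>l\<in>UNIV. u l y * u l y)) differentiable (at y)"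
      by (intro differentiable_mult d\<tau>[OF y] smooth_on_differentiable[OF uu open_V y])
    have d2: "(\<lambda>y. u l y * u l y) differentiable (at y)" for l using du[OF y] by (intro differentiable_mult)
    have "D q y (E (Some i) y) = X (Some i) y $ Some None - \<tau> y * (\<Sum>l\<in>UNIV. D (\<lambda>y. u l y * u l y) y (E (Some i) y)) * (1/2)"
      unfolding q_def[abs_def] D_diff[OF df[OF y] differentiable_mult[OF d1 differentiable_const]] D_f_nth[OF y]
        D_mult[OF d1 differentiable_const] D_mult[OF d\<tau>[OF y] smooth_on_differentiable[OF uu open_V y]] D_sum[OF d2]
      by (simp add: \<tau>(3)[OF y])
    also have "\<dots> = G i y"
      using \<tau>(2)[OF y] by (simp add: D_mult[OF du[OF y] du[OF y]] Du[OF y] G_def sum_distrib_left mult_ac sum_divide_distrib flip: sum.distrib)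
    finally show ?thesis using G0[OF y] by simp
  qed
  have Du0: "D (u l) y0 (E (Some i) y0) = (if i = l then 1 else 0)" for i l
    by (simp add: Du[OF y0] init \<tau>(5) axis_def)
  note co = adapted_coordinates[OF leaf open_V order_refl y0 su Du0 _ \<Phi>_def[abs_def, THEN meta_eq_to_obj_eq]]
  show thesis
  proof (rule that[of \<Phi> q])
    show "smooth_on V \<Phi>" "inj (frechet_derivative \<Phi> (at y0))" by (rule co; simp)+
    show "smooth_on V q" by (rule sq)
    show "D q y w = 0" if "y \<in> V" "D \<Phi> y w $ None = 0" for y w
      by (rule co(3)[OF _ _ _ sq Dq that]) auto
    show "\<Phi> y $ None = f y $ None" for y by (simp add: \<Phi>_def)
    show "f y = vsnoc (vsnoc (\<tau> y *\<^sub>R (\<chi> l. \<Phi> y $ Some l)) (\<tau> y * (norm (\<chi> l. \<Phi> y $ Some l))\<^sup>2 / 2 + q y)) (f y $ None)"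
      if "y \<in> V" for y
    proof (rule vsnoc_eqI)
      fix p :: "'k option"
      have n: "(norm (\<chi> l. \<Phi> y $ Some l))\<^sup>2 = (\<Sum>l\<in>UNIV. u l y * u l y)"
        by (simp add: \<Phi>_def norm_eq_sqrt_inner inner_vec_def sum_nonneg)
      show "f y $ Some p = vsnoc (\<tau> y *\<^sub>R (\<chi> l. \<Phi> y $ Some l)) (\<tau> y * (norm (\<chi> l. \<Phi> y $ Some l))\<^sup>2 / 2 + q y) $ p"
      proof (cases p)
        case None then show ?thesis by (simp add: n q_def)
      next
        case (Some l) then show ?thesis using \<tau>(2)[OF that] by (simp add: \<Phi>_def u_def)
      qed
    qed simp
  qed
qed


section \<open>Leaves that are quadrics with centre\<close>

lemma D_Z_component:
  assumes "y \<in> V" shows "D (\<lambda>y. Z y $ p) y (E (Some i) y) = - \<zeta> y * X (Some i) y $ p"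
    "D (\<lambda>y. Z y $ p) y (E None y) = - \<beta> y * Z y $ p"
  by (simp_all add: D_vec_nth diff assms D_Z)

lemma zeta_nonzero: "y0 \<in> V \<Longrightarrow> \<zeta> y0 \<noteq> 0 \<Longrightarrow> y \<in> V \<Longrightarrow> \<zeta> y \<noteq> 0"
  using zeta_zero by blast

lemma alpha_nonzero:
  "(\<And>y. y \<in> V \<Longrightarrow> \<zeta> y = 0) \<Longrightarrow> y0 \<in> V \<Longrightarrow> \<alpha> y0 \<noteq> 0 \<Longrightarrow> y \<in> V \<Longrightarrow> \<alpha> y \<noteq> 0"
  using alpha_zero by blast

text \<open>\<open>\<zeta> X\<^sub>1 + \<alpha> Z\<close> has constant direction: it is the direction of the line of centres.\<close>
lemma axis_component_zero:
  assumes y0: "y0 \<in> V" "\<zeta> y0 * X None y0 $ p + \<alpha> y0 * Z y0 $ p = 0" and y: "y \<in> V"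
  shows "\<zeta> y * X None y $ p + \<alpha> y * Z y $ p = 0"
proof (rule vanish1[where c = "\<lambda>y. \<kappa> y - \<alpha> y - \<beta> y" and g = "\<lambda>y. \<zeta> y * X None y $ p + \<alpha> y * Z y $ p", OF _ _ _ _ y0 y])
  have sm: "smooth_on V (\<lambda>y. X None y $ p)" "smooth_on V (\<lambda>y. Z y $ p)"
    by (intro smooth_on_vec_nth open_V smooth_X smooth_Z)+
  show "smooth_on V (\<lambda>y. \<zeta> y * X None y $ p + \<alpha> y * Z y $ p)"
    by (intro smooth_on_add smooth_on_mult open_V smooth_scalars sm)
  have D: "D (\<lambda>y. \<zeta> y * X None y $ p + \<alpha> y * Z y $ p) y v
      = \<zeta> y * D (X None) y v $ p + D \<zeta> y v * X None y $ p + (\<alpha> y * D Z y v $ p + D \<alpha> y v * Z y $ p)" if y: "y \<in> V" for y v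
  proof -
    note d = smooth_on_differentiable[OF sm(1) open_V y] smooth_on_differentiable[OF sm(2) open_V y]
    show ?thesis
      unfolding D_add[OF differentiable_mult[OF diff(5)[OF y] d(1)] differentiable_mult[OF diff(4)[OF y] d(2)]]
        D_mult[OF diff(5)[OF y] d(1)] D_mult[OF diff(4)[OF y] d(2)] D_vec_nth[OF diff(2)[OF y]] D_vec_nth[OF diff(3)[OF y]] ..
  qed
  fix y assume y: "y \<in> V"
  show "D (\<lambda>y. \<zeta> y * X None y $ p + \<alpha> y * Z y $ p) y (E (Some i) y) = 0" for i
    by (simp add: D[OF y] D_X0[OF y] D_Z[OF y] D_alpha[OF y] D_zeta[OF y])
  show "D (\<lambda>y. \<zeta> y * X None y $ p + \<alpha> y * Z y $ p) y (E None y) = (\<kappa> y - \<alpha> y - \<beta> y) * (\<zeta> y * X None y $ p + \<alpha> y * Z y $ p)"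
    unfolding D[OF y] D_X0(2)[OF y] D_Z(2)[OF y] D_alpha(2)[OF y] D_zeta(2)[OF y] by (simp add: algebra_simps)
qed (intro continuous_intros cont)

text \<open>Up to its component on the axis, \<open>f\<close> is - Z / \<zeta> when the line of
  centres is the last axis. Z divided by the root of e Q has constant square e for the form
  \<open>qf e\<close>, hence lies on the model quadric: its first components are the coordinates u
  and its remaining one is the graph function. The sign \<open>e\<close> is that of \<zeta>.\<close>

lemma central_form:
  assumes y0: "y0 \<in> V" and \<zeta>: "e * \<zeta> y0 > 0" and e: "e = 1 \<or> e = -1"
    and init: "\<And>i. X (Some i) y0 = axis (Some (Some i)) 1" "Z y0 = sqrt (e * \<zeta> y0) *\<^sub>R axis (Some None) 1"
      "\<zeta> y0 *\<^sub>R X None y0 + \<alpha> y0 *\<^sub>R Z y0 = axis None 1"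
      "\<And>p. f y0 $ Some p = - Z y0 $ Some p / \<zeta> y0"
  obtains B \<Phi> g1 g2 where "open B" "B \<subseteq> V" "y0 \<in> B" "smooth_on B \<Phi>" "inj (frechet_derivative \<Phi> (at y0))"
    "smooth_on B g1" "smooth_on B g2" "\<And>y. y \<in> B \<Longrightarrow> g1 y > 0" "\<And>y. y \<in> B \<Longrightarrow> g2 y \<noteq> 0"
    "\<And>y w. y \<in> B \<Longrightarrow> D \<Phi> y w $ None = 0 \<Longrightarrow> D g1 y w = (0::real)"
    "\<And>y w. y \<in> B \<Longrightarrow> D \<Phi> y w $ None = 0 \<Longrightarrow> D g2 y w = (0::real)"
    "\<And>y. y \<in> B \<Longrightarrow> \<Phi> y $ None = f y $ None"
    "\<And>y. y \<in> B \<Longrightarrow> 1 - e * (norm (\<chi> l. \<Phi> y $ Some l))\<^sup>2 > 0"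
    "\<And>y. y \<in> B \<Longrightarrow> f y = vsnoc ((- sqrt (g1 y) / g2 y) *\<^sub>R vsnoc (\<chi> l. \<Phi> y $ Some l) (sqrt (1 - e * (norm (\<chi> l. \<Phi> y $ Some l))\<^sup>2))) (f y $ None)"
proof -
  have ee: "e * e = 1" using e by auto
  have "\<zeta> y0 \<noteq> 0" using \<zeta> by auto
  then have nz: "\<zeta> y \<noteq> 0" if "y \<in> V" for y using zeta_nonzero[OF y0 _ that] by blast
  have leaf: "X (Some i) y $ None = 0" "Z y $ None = 0" if "y \<in> V" for y i
    by (rule leaf_direction[OF _ _ y0 that]; simp add: init axis_def)+
  have W: "\<zeta> y * X None y $ Some p + \<alpha> y * Z y $ Some p = 0" if "y \<in> V" for y p
  proof (rule axis_component_zero[OF y0 _ that])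
    show "\<zeta> y0 * X None y0 $ Some p + \<alpha> y0 * Z y0 $ Some p = 0"
      using arg_cong[OF init(3), of "\<lambda>x. x $ Some p"] by (simp add: axis_def)
  qed
  have sZ: "smooth_on V (\<lambda>y. Z y $ p)" and sf: "smooth_on V (\<lambda>y. f y $ p)" for p
    by (intro smooth_on_vec_nth open_V smooth_Z smooth_f)+
  have s\<zeta>i: "smooth_on V (\<lambda>y. inverse (\<zeta> y))" by (rule smooth_on_inverse[OF open_V smooth_scalars(4) nz])
  have d: "(\<lambda>y. Z y $ p) differentiable (at y)" "(\<lambda>y. f y $ p) differentiable (at y)"
    "(\<lambda>y. inverse (\<zeta> y)) differentiable (at y)" if "y \<in> V" for y p
    using smooth_on_differentiable[OF _ open_V that] sZ sf s\<zeta>i by blast+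
  have Di: "D (\<lambda>y. inverse (\<zeta> y)) y v = - (inverse (\<zeta> y) * D \<zeta> y v * inverse (\<zeta> y))" if "y \<in> V" for y v
    by (rule D_eqI[OF Deriv.has_derivative_inverse[OF nz[OF that] diff(5)[OF that, unfolded frechet_derivative_works]]])
  \<comment> \<open>The centre f + Z / \<zeta> does not change along leaves, and its X_1-derivative
    is (\<zeta> X_1 + \<alpha> Z) / \<zeta>, which has a component on the last axis only.\<close>
  have center: "f y $ Some p = - Z y $ Some p * inverse (\<zeta> y)" if y: "y \<in> V" for y p
  proof -
    let ?N = "\<lambda>y. f y $ Some p + Z y $ Some p * inverse (\<zeta> y)"
    have "?N y = ?N y0"
    proof (rule const_if_D_zero[OF _ _ y0 y])
      show "smooth_on V ?N" by (intro smooth_on_add smooth_on_mult open_V sf sZ s\<zeta>i)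
      fix y a assume y: "y \<in> V"
      have "D ?N y (E a y) = X a y $ Some p + (Z y $ Some p * (- (inverse (\<zeta> y) * D \<zeta> y (E a y) * inverse (\<zeta> y)))
          + D (\<lambda>y. Z y $ Some p) y (E a y) * inverse (\<zeta> y))"
        unfolding D_add[OF d(2)[OF y] differentiable_mult[OF d(1,3)[OF y]]] D_mult[OF d(1,3)[OF y]] D_f_nth[OF y] Di[OF y] ..
      also have "\<dots> = 0"
      proof (cases a)
        case None
        have "X None y $ Some p = - \<alpha> y * Z y $ Some p / \<zeta> y"
          using W[OF y, of p] nz[OF y] by (simp add: field_simps)
        then show ?thesis using nz[OF y] by (simp add: None D_Z_component[OF y] D_zeta[OF y] field_simps)
      next
        case (Some i)
        then show ?thesis using nz[OF y] by (simp add: D_Z_component[OF y] D_zeta[OF y])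
      qed
      finally show "D ?N y (E a y) = 0" .
    qed
    also have "?N y0 = 0" by (simp add: init(4) divide_inverse)
    finally show ?thesis by simp
  qed
  define Q where "Q y = qf e (Z y) (Z y)" for y
  \<comment> \<open>Forced by the condition that the square of Z be \<zeta> s.\<close>
  define s where "s y = Q y * inverse (\<zeta> y)" for y
  have sQ: "smooth_on V Q" unfolding Q_def[abs_def] by (rule smooth_on_qf[OF open_V smooth_Z smooth_Z])
  have ss: "smooth_on V s" unfolding s_def[abs_def] by (intro smooth_on_mult open_V sQ s\<zeta>i)
  have dQ: "Q differentiable (at y)" if "y \<in> V" for y using smooth_on_differentiable[OF sQ open_V that] .
  have DQ: "D Q y (E (Some m) y) = - 2 * \<zeta> y * qf e (X (Some m) y) (Z y)" "D Q y (E None y) = - 2 * \<beta> y * Q y"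
    if "y \<in> V" for y m
    unfolding Q_def[abs_def] D_qf[OF diff(3)[OF that] diff(3)[OF that]]
    by (simp_all add: D_Z[OF that] qf.scaleR_left qf.scaleR_right qf.minus_left qf.minus_right qf_sym[of e "Z y" "X (Some m) y"])
  \<comment> \<open>The factor \<open>sqrt (e * \<zeta> y0)\<close> in the initial value of Z is
    chosen for this: it gives s = 1, in accordance with the unit vectors X_i.\<close>
  have Q0: "Q y0 = \<zeta> y0 * 1"
    using \<zeta> ee by (simp add: Q_def qf_def init axis_def mult.assoc[symmetric])
  have XZ: "qf e (X (Some i) y) (Z y) = 0" if "y \<in> V" for i y
  proof (rule leaf_metric(2)[OF ss y0 that, where c = 1])
    show "qf e (Z y) (Z y) = \<zeta> y * s y" if "y \<in> V" for y using nz[OF that] by (simp add: s_def Q_def)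
    have Ds: "D s y v = Q y * (- (inverse (\<zeta> y) * D \<zeta> y v * inverse (\<zeta> y))) + D Q y v * inverse (\<zeta> y)" if "y \<in> V" for y v
      unfolding s_def[abs_def] D_mult[OF dQ[OF that] d(3)[OF that]] Di[OF that] ..
    show "D s y (E (Some m) y) = - 2 * 1 * qf e (X (Some m) y) (Z y)" "D s y (E None y) = (\<alpha> y - \<beta> y) * s y"
      if "y \<in> V" for y m
      unfolding Ds[OF that] DQ[OF that] D_zeta[OF that] s_def using nz[OF that] by (simp_all add: field_simps)
    have "s y0 = 1" using nz[OF y0] by (simp add: s_def Q0)
    then show "qf e (X (Some i) y0) (X (Some j) y0) = (if i = j then s y0 else 0)" for i j
      by (simp add: qf_def init axis_def if_distrib[of "\<lambda>x. x * _"] cong: if_cong)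
    show "qf e (X (Some i) y0) (Z y0) = 0" for i by (simp add: qf_def init axis_def)
  qed
  \<comment> \<open>The first condition permits the square root of e Q, the second selects the
    branch on which the leaf is the graph of a positive root. Both hold at the base point.\<close>
  define B where "B = {y \<in> V. 0 < e * Q y} \<inter> {y \<in> V. 0 < Z y $ Some None}"
  have B: "open B" "B \<subseteq> V" "y0 \<in> B"
  proof -
    have "open {y \<in> V. 0 < g y}" if "continuous_on V g" for g :: "_ \<Rightarrow> real"
      using continuous_open_preimage[OF that open_V, of "{0<..}"] by (simp add: Int_def vimage_def)
    moreover have "continuous_on V (\<lambda>y. e * Q y)" "continuous_on V (\<lambda>y. Z y $ Some None)"
      using smooth_on_continuous[OF sQ] smooth_on_continuous[OF sZ] by (auto intro: continuous_intros)
    ultimately show "open B" unfolding B_def by blast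
    show "B \<subseteq> V" by (auto simp: B_def)
    show "y0 \<in> B" using y0 \<zeta> by (simp add: B_def Q0 init axis_def)
  qed
  have BV: "y \<in> V" if "y \<in> B" for y using that B by blast
  define g1 where "g1 y = e * Q y" for y
  have g1: "g1 y > 0" if "y \<in> B" for y using that by (simp add: g1_def B_def)
  have sg1: "smooth_on B g1" unfolding g1_def[abs_def]
    by (rule smooth_on_subset[OF smooth_on_mult[OF open_V smooth_on_const sQ] B(2)])
  have Dg1: "D g1 y (E (Some i) y) = 0" if "y \<in> B" for y i
    unfolding g1_def[abs_def] D_mult[OF differentiable_const dQ[OF BV[OF that]]] by (simp add: DQ[OF BV[OF that]] XZ[OF BV[OF that]])
  define \<rho> where "\<rho> y = inverse (sqrt (g1 y))" for y
  have ssq: "smooth_on {0<..} (\<lambda>x. inverse (sqrt x))"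
    by (rule smooth_on_inverse[OF _ smooth_on_sqrt_real]) auto
  have s\<rho>: "smooth_on B \<rho>"
    unfolding \<rho>_def[abs_def] by (rule smooth_on_compose[OF B(1) _ ssq sg1]) (use g1 in auto)
  have D\<rho>: "D \<rho> y (E (Some i) y) = 0" if y: "y \<in> B" for y i
  proof -
    have dd: "(\<lambda>x. inverse (sqrt x)) differentiable (at (g1 y))"
      by (rule smooth_on_differentiable[OF ssq]) (use g1[OF y] in auto)
    have "D \<rho> y (E (Some i) y) = D (\<lambda>x. inverse (sqrt x)) (g1 y) (D g1 y (E (Some i) y))"
      unfolding \<rho>_def[abs_def] by (rule D_compose[OF dd smooth_on_differentiable[OF sg1 B(1) y]])
    also have "\<dots> = 0" by (simp add: Dg1[OF y] linear_0[OF linear_frechet_derivative[OF dd]])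
    finally show ?thesis .
  qed
  define u where "u l y = Z y $ Some (Some l) * \<rho> y" for l y
  have su: "smooth_on B (u l)" for l
    unfolding u_def[abs_def] by (rule smooth_on_mult[OF B(1) smooth_on_subset[OF sZ B(2)] s\<rho>])
  define \<Phi> where "\<Phi> y = vsnoc (\<chi> l. u l y) (f y $ None)" for y
  have Du0: "D (u l) y0 (E (Some i) y0) = (if i = l then - \<zeta> y0 * \<rho> y0 else 0)" for i l
    unfolding u_def[abs_def] D_mult[OF d(1)[OF y0] smooth_on_differentiable[OF s\<rho> B(1,3)]]
    by (simp add: D_Z_component[OF y0] D\<rho>[OF B(3)] init axis_def)
  have c0: "- \<zeta> y0 * \<rho> y0 \<noteq> 0" using nz[OF y0] g1[OF B(3)] by (simp add: \<rho>_def)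
  note co = adapted_coordinates[OF leaf B su Du0 c0 \<Phi>_def[abs_def, THEN meta_eq_to_obj_eq]]
  have s\<Phi>: "smooth_on B \<Phi>" and inj\<Phi>: "inj (frechet_derivative \<Phi> (at y0))" by (rule co; assumption)+
  have norm: "(norm (\<chi> l. \<Phi> y $ Some l))\<^sup>2 = (\<Sum>l\<in>UNIV. u l y * u l y)" for y
    by (simp add: \<Phi>_def norm_eq_sqrt_inner inner_vec_def sum_nonneg)
  \<comment> \<open>The equation of the model quadric for the normalised Z, solved for its last
    component; \<open>e * e = 1\<close> is used.\<close>
  have key: "1 - e * (norm (\<chi> l. \<Phi> y $ Some l))\<^sup>2 = (Z y $ Some None * \<rho> y)\<^sup>2" if y: "y \<in> B" for y
  proof -
    have r2: "\<rho> y * \<rho> y * g1 y = 1"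
      using g1[OF y] by (simp add: \<rho>_def field_simps)
    have "(norm (\<chi> l. \<Phi> y $ Some l))\<^sup>2 = \<rho> y * \<rho> y * (\<Sum>l\<in>UNIV. Z y $ Some (Some l) * Z y $ Some (Some l))"
      unfolding norm by (simp add: u_def sum_distrib_left mult_ac)
    also have "(\<Sum>l\<in>UNIV. Z y $ Some (Some l) * Z y $ Some (Some l)) = Q y - e * (Z y $ Some None)\<^sup>2"
      by (simp add: Q_def qf_def power2_eq_square)
    finally have n: "(norm (\<chi> l. \<Phi> y $ Some l))\<^sup>2 = \<rho> y * \<rho> y * (Q y - e * (Z y $ Some None)\<^sup>2)" .
    have "e * (norm (\<chi> l. \<Phi> y $ Some l))\<^sup>2 = \<rho> y * \<rho> y * (e * Q y) - (e * e) * (\<rho> y * \<rho> y) * (Z y $ Some None)\<^sup>2"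
      unfolding n by (simp add: algebra_simps)
    then show ?thesis using r2 by (simp add: ee g1_def power2_eq_square)
  qed
  have pos: "Z y $ Some None * \<rho> y > 0" if "y \<in> B" for y
    using that g1[OF that] by (simp add: B_def \<rho>_def)
  show thesis
  proof (rule that[OF B s\<Phi> inj\<Phi> sg1 smooth_on_subset[OF smooth_scalars(4) B(2)] g1 nz[OF BV]])
    show "D g1 y w = 0" if "y \<in> B" "D \<Phi> y w $ None = 0" for y w by (rule co(3)[OF _ _ sg1 Dg1 that])
    show "D \<zeta> y w = 0" if "y \<in> B" "D \<Phi> y w $ None = 0" for y w
      by (rule co(3)[OF _ _ smooth_on_subset[OF smooth_scalars(4) B(2)] D_zeta(1)[OF BV] that])
    show "\<Phi> y $ None = f y $ None" for y by (simp add: \<Phi>_def)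
    fix y assume y: "y \<in> B"
    show "1 - e * (norm (\<chi> l. \<Phi> y $ Some l))\<^sup>2 > 0" unfolding key[OF y] by (rule zero_less_power[OF pos[OF y]])
    have sq: "sqrt (1 - e * (norm (\<chi> l. \<Phi> y $ Some l))\<^sup>2) = Z y $ Some None * \<rho> y"
      using pos[OF y] by (simp add: key[OF y])
    have gr: "sqrt (g1 y) * \<rho> y = 1" using g1[OF y] by (simp add: \<rho>_def)
    show "f y = vsnoc ((- sqrt (g1 y) / \<zeta> y) *\<^sub>R vsnoc (\<chi> l. \<Phi> y $ Some l) (sqrt (1 - e * (norm (\<chi> l. \<Phi> y $ Some l))\<^sup>2))) (f y $ None)"
    proof (rule vsnoc_eqI)
      fix p :: "'k option"
      have "vsnoc (\<chi> l. \<Phi> y $ Some l) (sqrt (1 - e * (norm (\<chi> l. \<Phi> y $ Some l))\<^sup>2)) $ p = Z y $ Some p * \<rho> y"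
        unfolding sq by (cases p) (simp_all add: \<Phi>_def u_def)
      moreover have "- sqrt (g1 y) / \<zeta> y * (Z y $ Some p * \<rho> y) = - (sqrt (g1 y) * \<rho> y) * Z y $ Some p * inverse (\<zeta> y)"
        by (simp add: divide_inverse)
      ultimately show "f y $ Some p = ((- sqrt (g1 y) / \<zeta> y) *\<^sub>R vsnoc (\<chi> l. \<Phi> y $ Some l) (sqrt (1 - e * (norm (\<chi> l. \<Phi> y $ Some l))\<^sup>2))) $ p"
        using center[OF BV[OF y], of p] by (simp add: gr)
    qed simp
  qed
qed

text \<open>The normalisation puts f - X_1 / \<alpha> at the origin for the base point. It then
  stays on the axis of the paraboloids, so X_1 = \<alpha> f in all other components; the height
  component of this shows that the height can serve as the scale \<tau>.\<close>

lemma parabolic_form_moving: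
  assumes y0: "y0 \<in> V" and \<zeta>: "\<And>y. y \<in> V \<Longrightarrow> \<zeta> y = 0" and \<alpha>: "\<alpha> y0 \<noteq> 0"
    and init: "\<And>i. X (Some i) y0 = axis (Some (Some i)) 1" "Z y0 = axis (Some None) 1"
      "X None y0 = \<alpha> y0 *\<^sub>R axis None 1" "f y0 = axis None 1"
  shows "y \<in> V \<Longrightarrow> f y $ None \<noteq> 0"
    and "y \<in> V \<Longrightarrow> D (\<lambda>y. f y $ None) y (E (Some i) y) = 0"
    and "y \<in> V \<Longrightarrow> D (\<lambda>y. f y $ None) y (E None y) = \<alpha> y * f y $ None"
    and "y \<in> V \<Longrightarrow> X None y $ Some (Some l) = \<alpha> y * f y $ Some (Some l)"
proof -
  have nz: "\<alpha> y \<noteq> 0" if "y \<in> V" for y using alpha_nonzero[OF \<zeta> y0 \<alpha> that] .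
  have leaf: "X (Some i) y $ None = 0" "Z y $ None = 0" if "y \<in> V" for y i
    by (rule leaf_direction[OF _ _ y0 that]; simp add: init axis_def)+
  have Zl: "Z y $ p = 0" if "y \<in> V" "p \<noteq> Some None" for y p
    by (rule Z_component_zero[OF \<zeta> y0 _ that(1)]) (use that(2) in \<open>simp_all add: init axis_def\<close>)
  \<comment> \<open>The axis component is excluded because it is the only nonzero component of Z,
    which enters the derivative of X_1.\<close>
  have R: "X None y $ p = \<alpha> y * f y $ p" if y: "y \<in> V" and p: "p \<noteq> Some None" for y p
  proof -
    have sX: "smooth_on V (\<lambda>y. X None y $ p)" and sf: "smooth_on V (\<lambda>y. f y $ p)"
      by (intro smooth_on_vec_nth open_V smooth_X smooth_f)+
    let ?N = "\<lambda>y. X None y $ p - \<alpha> y * f y $ p"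
    have "?N y = 0"
    proof (rule vanish1[where g = ?N and c = "\<lambda>y. \<kappa> y - \<alpha> y", OF _ _ _ _ y0 _ y])
      show "smooth_on V ?N" by (intro smooth_on_diff smooth_on_mult open_V sX sf smooth_scalars)
      have D: "D ?N y v = D (X None) y v $ p - (\<alpha> y * D (\<lambda>y. f y $ p) y v + D \<alpha> y v * f y $ p)" if y: "y \<in> V" for y v
      proof -
        note d = smooth_on_differentiable[OF sX open_V y] smooth_on_differentiable[OF sf open_V y]
        show ?thesis unfolding D_diff[OF d(1) differentiable_mult[OF diff(4)[OF y] d(2)]] D_mult[OF diff(4)[OF y] d(2)]
          D_vec_nth[OF diff(2)[OF y]] ..
      qed
      fix y assume y: "y \<in> V"
      show "D ?N y (E (Some i) y) = 0" for i by (simp add: D[OF y] D_f_nth[OF y] D_X0[OF y] D_alpha[OF y])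
      show "D ?N y (E None y) = (\<kappa> y - \<alpha> y) * ?N y"
        unfolding D[OF y] D_f_nth[OF y] D_X0(2)[OF y] D_alpha(2)[OF y] using \<zeta>[OF y] Zl[OF y p] by (simp add: algebra_simps)
    qed (auto simp: init intro!: continuous_intros cont)
    then show ?thesis by simp
  qed
  show "f y $ None \<noteq> 0" if "y \<in> V"
    using R[OF that, of None] height_nonzero[OF leaf[OF that] that] by auto
  show "D (\<lambda>y. f y $ None) y (E (Some i) y) = 0" if "y \<in> V" by (simp add: D_f_nth[OF that] leaf[OF that])
  show "D (\<lambda>y. f y $ None) y (E None y) = \<alpha> y * f y $ None" if "y \<in> V" by (simp add: D_f_nth[OF that] R[OF that])
  show "X None y $ Some (Some l) = \<alpha> y * f y $ Some (Some l)" if "y \<in> V" by (simp add: R[OF that])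
qed

text \<open>With \<alpha> = 0 and Z on the axis, the components of X_1 that belong to u satisfy a
  homogeneous equation. The leaf therefore moves without drift in u and with constant scale.\<close>

lemma parabolic_form_translation:
  assumes y0: "y0 \<in> V" and \<zeta>: "\<And>y. y \<in> V \<Longrightarrow> \<zeta> y = 0" and \<alpha>: "\<And>y. y \<in> V \<Longrightarrow> \<alpha> y = 0"
    and init: "Z y0 = axis (Some None) 1" "X None y0 = axis None 1" and y: "y \<in> V"
  shows "X None y $ Some (Some l) = 0"
proof (rule vanish1[where g = "\<lambda>y. X None y $ Some (Some l)" and c = \<kappa>, OF _ _ _ _ y0 _ y])
  show "smooth_on V (\<lambda>y. X None y $ Some (Some l))" by (intro smooth_on_vec_nth open_V smooth_X)
  fix y assume y: "y \<in> V"
  have Zl: "Z y $ Some (Some l) = 0"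
    by (rule Z_component_zero[OF \<zeta> y0 _ y]) (simp_all add: init axis_def)
  show "D (\<lambda>y. X None y $ Some (Some l)) y (E (Some i) y) = 0" for i
    by (simp add: D_vec_nth diff y D_X0 \<alpha>)
  show "D (\<lambda>y. X None y $ Some (Some l)) y (E None y) = \<kappa> y * X None y $ Some (Some l)"
    by (simp add: D_vec_nth diff y D_X0 Zl)
qed (auto simp: init axis_def cont)

end

section \<open>The classification\<close>

lemma frame_to_standard:
  fixes e :: "'n::finite \<Rightarrow> real ^ 'n"
  assumes "\<forall>u. (\<forall>i. u \<bullet> e i = 0) \<longrightarrow> u = 0"
  shows "\<exists>L A :: real ^ 'n \<Rightarrow> real ^ 'n. linear L \<and> bij L \<and> linear A \<and> surj A \<and>
    (\<forall>i. A (e i) = axis i 1) \<and> (\<forall>x. L (A x) = x)"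
proof -
  define N :: "real ^ 'n ^ 'n" where "N = (\<chi> i. e i)"
  have "u = 0" if "N *v u = 0" for u
  proof (rule assms[THEN spec, THEN mp], rule allI)
    fix i
    have "(N *v u) $ i = 0" using that by simp
    then show "u \<bullet> e i = 0" by (simp add: N_def matrix_vector_mult_def inner_vec_def mult.commute)
  qed
  then have "invertible N" using matrix_left_invertible_ker invertible_left_inverse by blast
  then have "invertible (transpose N)" by (rule transpose_invertible)
  then obtain B where B: "transpose N ** B = mat 1" "B ** transpose N = mat 1" unfolding invertible_def by blast
  have LA: "transpose N *v (B *v x) = x" and AL: "B *v (transpose N *v x) = x" for x
    by (simp_all only: matrix_vector_mul_assoc B matrix_vector_mul_lid)
  show ?thesis
  proof (intro exI conjI allI)
    show "linear ((*v) (transpose N))" "linear ((*v) B)" by simp_all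
    show "bij ((*v) (transpose N))" using LA AL by (intro o_bij[of "(*v) B"]) auto
    show "surj ((*v) B)" using AL by (metis surjI)
    show "transpose N *v (B *v x) = x" for x by (rule LA)
    fix i
    have "transpose N *v axis i 1 = e i" by (simp add: matrix_vector_mult_basis row_def N_def vec_eq_iff)
    then show "B *v e i = axis i 1" using AL[of "axis i 1"] by simp
  qed
qed

text \<open>Second derivatives of \<open>f\<close> are symmetric and the Levi-Civita connection has
  no torsion. It supplies K(X_i, X_1) from the given K(X_1, X_i).\<close>

lemma (in affine_hypersurface) difference_tensor_sym:
  assumes LC: "levi_civita_on U h \<Gamma>" and y: "y \<in> U"
  shows "difference_tensor f \<xi> \<Gamma> y v w = difference_tensor f \<xi> \<Gamma> y w v"
proof -
  have "cov_deriv \<Gamma> (\<lambda>_. v) (\<lambda>_. w) y - cov_deriv \<Gamma> (\<lambda>_. w) (\<lambda>_. v) y = lie_bracket (\<lambda>_. v) (\<lambda>_. w) y"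
    using LC y smooth_on_const unfolding levi_civita_on_def by blast
  then have "cov_deriv \<Gamma> (\<lambda>_. v) (\<lambda>_. w) y = cov_deriv \<Gamma> (\<lambda>_. w) (\<lambda>_. v) y"
    by (simp add: lie_bracket_def)
  then show ?thesis
    unfolding difference_tensor_def induced_conn_def using D2_symmetric[OF smooth_f open_U y, of w v] by simp
qed

text \<open>Restriction to a ball provides the convexity needed for joining points by segments. The
  coefficient \<kappa> is (n - 1) r + \<beta> because \<xi> is rewritten as Z + \<beta> X_1 in the
  derivative of X_1.\<close>

lemma (in symmetric_hypersurface) normal_frame_ball:
  assumes ball: "ball y0 d \<subseteq> V"
  shows "normal_frame (ball y0 d) f E (\<lambda>a y v. coframe a y \<bullet> D f y v) X (\<lambda>y. \<xi> y - \<beta> y *\<^sub>R X None y)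
    \<alpha> \<beta> (\<lambda>y. CARD('k) * r y + \<beta> y) (\<lambda>y. b y + \<alpha> y * \<beta> y)
    (\<lambda>i j. conn None (Some i) (Some j)) (\<lambda>i j m. conn (Some i) (Some j) (Some m))"
proof -
  have s: "smooth_on (ball y0 d) g" if "smooth_on V g" for g :: "_ \<Rightarrow> 'z::real_normed_vector"
    using smooth_on_subset[OF that ball] .
  have d: "b differentiable (at y)" "\<alpha> differentiable (at y)" "\<beta> differentiable (at y)" if "y \<in> V" for y
    using smooth_on_differentiable[OF _ open_V that] smooth_b smooth_alpha smooth_beta by auto
  have DZ: "D (\<lambda>y. \<xi> y - \<beta> y *\<^sub>R X None y) y v = D \<xi> y v - (\<beta> y *\<^sub>R D (X None) y v + D \<beta> y v *\<^sub>R X None y)"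
    if "y \<in> V" for y v
    unfolding D_diff[OF diffV(2)[OF that] differentiable_bounded_bilinear[OF bounded_bilinear_scaleR d(3)[OF that] diffV(4)[OF that]]]
      D_scaleR[OF d(3)[OF that] diffV(4)[OF that]] ..
  have D\<zeta>: "D (\<lambda>y. b y + \<alpha> y * \<beta> y) y v = D b y v + (\<alpha> y * D \<beta> y v + D \<alpha> y v * \<beta> y)" if "y \<in> V" for y v
    unfolding D_add[OF d(1)[OF that] differentiable_mult[OF d(2,3)[OF that]]] D_mult[OF d(2,3)[OF that]] ..
  have T\<beta>: "D \<beta> y (E None y) = - CARD('k) * r y * \<beta> y - a y - \<beta> y * \<beta> y" if "y \<in> V" for y
    unfolding T_beta[OF that] by (simp add: \<alpha>_def \<beta>_def)
  have r: "r y = (\<beta> y - \<alpha> y) / 2" for y by (simp add: \<alpha>_def \<beta>_def)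
  show ?thesis
  proof
    show "smooth_on (ball y0 d) f" "\<And>a. smooth_on (ball y0 d) (X a)" "smooth_on (ball y0 d) \<alpha>" "smooth_on (ball y0 d) \<beta>"
      "\<And>i j. smooth_on (ball y0 d) (conn None (Some i) (Some j))"
      "\<And>i j m. smooth_on (ball y0 d) (conn (Some i) (Some j) (Some m))"
      by (intro s smooth_f_V smooth_X smooth_alpha smooth_beta smooth_conn)+
    show "smooth_on (ball y0 d) (\<lambda>y. \<xi> y - \<beta> y *\<^sub>R X None y)"
      by (intro s smooth_on_diff smooth_on_scaleR open_V smooth_xi_V smooth_beta smooth_X)
    show "smooth_on (ball y0 d) (\<lambda>y. CARD('k) * r y + \<beta> y)" "smooth_on (ball y0 d) (\<lambda>y. b y + \<alpha> y * \<beta> y)"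
      by (intro s smooth_on_add smooth_on_mult open_V smooth_r smooth_b smooth_alpha smooth_beta smooth_on_const)+
    show "\<And>a v. smooth_on (ball y0 d) (\<lambda>y. coframe a y \<bullet> D f y v)"
      by (intro s smooth_on_inner open_V smooth_coframe smooth_on_D smooth_f_V)
  next
    fix y v u assume "y \<in> ball y0 d"
    then have y: "y \<in> V" using ball by blast
    show "v = (\<Sum>a\<in>UNIV. (coframe a y \<bullet> D f y v) *\<^sub>R E a y)" unfolding coframe_Df[OF y] by (rule E_expand[OF y])
    show "D f y (E a y) = X a y" for a by (simp add: X_def)
    show "D (X None) y (E (Some i) y) = \<alpha> y *\<^sub>R X (Some i) y" for i by (rule D_X_leaf[OF y])
    show "D (X None) y (E None y) = (CARD('k) * r y + \<beta> y) *\<^sub>R X None y + (\<xi> y - \<beta> y *\<^sub>R X None y)"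
      by (simp add: D_T[OF y] algebra_simps)
    show "D (X (Some j)) y (E (Some i) y) = (\<Sum>m\<in>UNIV. conn (Some i) (Some j) (Some m) y *\<^sub>R X (Some m) y)
        + (if i = j then \<xi> y - \<beta> y *\<^sub>R X None y else 0)" for i j by (rule D_X_leaf[OF y])
    show "D (X (Some i)) y (E None y) = (\<Sum>m\<in>UNIV. conn None (Some i) (Some m) y *\<^sub>R X (Some m) y)" for i
      by (rule D_T[OF y])
    show "D (\<lambda>y. \<xi> y - \<beta> y *\<^sub>R X None y) y (E (Some i) y) = - (b y + \<alpha> y * \<beta> y) *\<^sub>R X (Some i) y" for i
      by (simp add: DZ[OF y] D_xi_frame[OF y] D_X_leaf[OF y] beta_leaf[OF y] algebra_simps)
    \<comment> \<open>The X_1-derivative of \<beta> cancels the terms with a and r, leaving a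
      multiple of Z.\<close>
    show "D (\<lambda>y. \<xi> y - \<beta> y *\<^sub>R X None y) y (E None y) = - \<beta> y *\<^sub>R (\<xi> y - \<beta> y *\<^sub>R X None y)"
      unfolding DZ[OF y] D_xi_frame[OF y] D_T[OF y] T\<beta>[OF y] by (simp add: algebra_simps)
    show "conn (Some i) (Some j) (Some m) y = - conn (Some i) (Some m) (Some j) y" for i j m by (rule conn_values[OF y])
    show "conn None (Some i) (Some j) y + conn None (Some j) (Some i) y = (if i = j then \<alpha> y - \<beta> y else 0)" for i j
      using conn_values(7)[OF y, of i j] by (simp add: r)
    show "D \<alpha> y (E (Some i) y) = 0" for i by (rule alpha_leaf[OF y])
    show "D \<alpha> y (E None y) = \<alpha> y * (CARD('k) * r y + \<beta> y - \<alpha> y) - (b y + \<alpha> y * \<beta> y)"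
      unfolding T_alpha[OF y] by (simp add: algebra_simps power2_eq_square)
    show "D (\<lambda>y. b y + \<alpha> y * \<beta> y) y (E (Some i) y) = 0" for i
      by (simp add: D\<zeta>[OF y] alpha_leaf[OF y] beta_leaf[OF y] b_leaf[OF y])
    show "D (\<lambda>y. b y + \<alpha> y * \<beta> y) y (E None y) = - (\<alpha> y + \<beta> y) * (b y + \<alpha> y * \<beta> y)"
      unfolding D\<zeta>[OF y] T_alpha[OF y] T\<beta>[OF y] T_b[OF y] by (simp add: algebra_simps power2_eq_square)
    show "u = 0" if u: "\<And>a. u \<bullet> X a y = 0" "u \<bullet> (\<xi> y - \<beta> y *\<^sub>R X None y) = 0"
      by (subst frame_expand(2)[OF y, of u])
        (use u in \<open>simp add: inner_diff_right inner_commute[of "X _ _"] inner_commute[of "\<xi> _"]\<close>)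
  qed auto
qed

lemma congruent_nearI:
  assumes "open I" "is_interval I" "open U" "c' \<in> maximal_atlas X A" "p \<in> fst c'" "chart_image c' = tube I U"
    and L: "linear L" "bij L" and F: "\<And>t u. t \<in> I \<Longrightarrow> u \<in> U \<Longrightarrow> F (param c' (vsnoc u t)) = L (G t u) + w"
  shows "congruent_near X A F p I U G"
proof -
  have "affine_transformation (\<lambda>x. L x + w)" unfolding affine_transformation_def using L by blast
  then show ?thesis
    using assms unfolding congruent_near_def tube_def by (intro conjI bexI[of _ c'] exI[of _ "\<lambda>x. L x + w"]) auto
qed

text \<open>The graph is the part of the model quadric over \<open>U\<close> with positive last
  coordinate: a piece of the upper hemisphere for e = 1 and of the hyperboloid sheet for e = -1. It
  is in standard position, so the identity serves as the linear map.\<close>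

lemma quadric_graph_immersion:
  fixes U :: "(real ^ 'k::finite) set"
  assumes U: "open U" "\<And>u. u \<in> U \<Longrightarrow> 0 < 1 - e * (norm u)\<^sup>2" and e: "e = 1 \<and> \<epsilon> = 1 \<or> e = -1 \<and> \<epsilon> = (-1 :: int)"
  shows "quadric_immersion \<epsilon> U (\<lambda>u. vsnoc u (sqrt (1 - e * (norm u)\<^sup>2)))"
proof -
  let ?\<phi> = "\<lambda>u :: real ^ 'k. vsnoc u (sqrt (1 - e * (norm u)\<^sup>2))"
  have "smooth_on U (\<lambda>u. sqrt (1 - e * (u \<bullet> u)))"
    using U(2) by (intro smooth_on_sqrt smooth_on_diff smooth_on_mult smooth_on_inner smooth_on_const smooth_on_ident U(1))
      (simp add: power2_norm_eq_inner)
  then have s: "smooth_on U (\<lambda>u. sqrt (1 - e * (norm u)\<^sup>2))" by (simp add: power2_norm_eq_inner)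
  have sm: "smooth_on U ?\<phi>"
  proof (rule smooth_on_vec[OF U(1)])
    show "smooth_on U (\<lambda>u. ?\<phi> u $ i)" for i
      by (cases i) (simp_all add: s smooth_on_vec_nth[OF U(1) smooth_on_ident[OF U(1)]])
  qed
  have "inj (frechet_derivative ?\<phi> (at u))" if u: "u \<in> U" for u
  proof (rule injI)
    fix v v' assume eq: "D ?\<phi> u v = D ?\<phi> u v'"
    have n: "D ?\<phi> u v $ Some l = v $ l" for v l
    proof -
      have "D ?\<phi> u v $ Some l = D (\<lambda>u. ?\<phi> u $ Some l) u v"
        by (rule D_vec_nth[OF smooth_on_differentiable[OF sm U(1) u], symmetric])
      also have "\<dots> = D (\<lambda>u. u) u v $ l" by (simp only: vsnoc_nth D_vec_nth[OF differentiable_ident])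
      finally show ?thesis by simp
    qed
    have "v $ l = v' $ l" for l using n[of v l] n[of v' l] unfolding eq by simp
    then show "v = v'" by (simp add: vec_eq_iff)
  qed
  then have imm: "immersion_on U ?\<phi>" using sm by (simp add: immersion_on_def)
  define W where "W = {x :: real ^ 'k option. (\<chi> i. x $ Some i) \<in> U \<and> 0 < x $ None}"
  have "open W"
  proof -
    have "open ((\<lambda>x :: real ^ 'k option. \<chi> i. x $ Some i) -` U)"
      by (rule open_vimage) (auto simp: U(1) intro!: continuous_intros)
    moreover have "open ((\<lambda>x :: real ^ 'k option. x $ None) -` {0<..})"
      by (rule open_vimage) (auto intro!: continuous_intros)
    ultimately have "open ((\<lambda>x :: real ^ 'k option. \<chi> i. x $ Some i) -` U \<inter> (\<lambda>x. x $ None) -` {0<..})" by blast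
    then show ?thesis by (simp add: W_def vimage_def Int_def)
  qed
  have nrm: "(norm u)\<^sup>2 = (\<Sum>i\<in>UNIV. (u $ i)\<^sup>2)" for u :: "real ^ 'k"
    unfolding power2_norm_eq_inner inner_vec_def by (simp add: power2_eq_square)
  have model: "x \<in> model_quadric \<epsilon> \<and> x $ None > 0 \<longleftrightarrow> (x $ None)\<^sup>2 = 1 - e * (\<Sum>i\<in>UNIV. (x $ Some i)\<^sup>2) \<and> x $ None > 0"
    for x :: "real ^ 'k option"
  proof -
    have "(norm x)\<^sup>2 = (x $ None)\<^sup>2 + (\<Sum>i\<in>UNIV. (x $ Some i)\<^sup>2)"
      unfolding power2_norm_eq_inner inner_vec_def by (simp add: power2_eq_square sum_option)
    moreover have "norm x = 1 \<longleftrightarrow> (norm x)\<^sup>2 = 1" by (simp add: abs_square_eq_1)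
    ultimately show ?thesis using e by (auto simp: model_quadric_def unit_hyperboloid_sheet_def)
  qed
  have "?\<phi> ` U = model_quadric \<epsilon> \<inter> W"
  proof
    show "?\<phi> ` U \<subseteq> model_quadric \<epsilon> \<inter> W"
    proof
      fix x assume "x \<in> ?\<phi> ` U"
      then obtain u where u: "u \<in> U" "x = ?\<phi> u" by blast
      have "x $ None > 0" "(x $ None)\<^sup>2 = 1 - e * (\<Sum>i\<in>UNIV. (x $ Some i)\<^sup>2)"
        using U(2)[OF u(1)] u(2) by (simp_all add: nrm)
      then have "x \<in> model_quadric \<epsilon>" using model by blast
      moreover have "(\<chi> i. x $ Some i) = u" using u(2) by (simp add: vec_eq_iff)
      ultimately show "x \<in> model_quadric \<epsilon> \<inter> W" using u(1) \<open>x $ None > 0\<close> by (simp add: W_def)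
    qed
    show "model_quadric \<epsilon> \<inter> W \<subseteq> ?\<phi> ` U"
    proof
      fix x assume x: "x \<in> model_quadric \<epsilon> \<inter> W"
      let ?u = "\<chi> i. x $ Some i"
      have p: "x $ None > 0" "?u \<in> U" using x by (auto simp: W_def)
      then have "(x $ None)\<^sup>2 = 1 - e * (\<Sum>i\<in>UNIV. (x $ Some i)\<^sup>2)" using model[of x] x by blast
      then have "(x $ None)\<^sup>2 = 1 - e * (norm ?u)\<^sup>2" by (simp add: nrm)
      then have "x $ None = sqrt (1 - e * (norm ?u)\<^sup>2)" using p(1) by (metis less_imp_le real_sqrt_unique)
      then have "x = ?\<phi> ?u" using vsnoc_surj[of x] by simp
      then show "x \<in> ?\<phi> ` U" using p(2) by blast
    qed
  qed
  then have "openin (top_of_set (model_quadric \<epsilon>)) ((\<lambda>x. x) ` ?\<phi> ` U)"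
    using \<open>open W\<close> by (simp add: openin_open_Int)
  moreover have "det (matrix (\<lambda>x :: real ^ 'k option. x)) = 1"
    using matrix_id_mat_1 by (metis det_I eq_id_iff)
  ultimately show ?thesis
    unfolding quadric_immersion_def using imm e linear_ident by blast
qed

section \<open>The three normal forms in a chart\<close>

locale chart_frame =
  normal_frame V "F \<circ> param c" E \<theta> Y Z \<alpha> \<beta> \<kappa> \<zeta> M C
  for V and F :: "'m \<Rightarrow> real ^ 'k::finite option option" and c :: "('m, 'k option) chart" and E \<theta> Y Z \<alpha> \<beta> \<kappa> \<zeta> M C +
  fixes X :: "'m topology" and A :: "('m, 'k option) chart set" and p :: 'm
  assumes mf: "smooth_manifold X A" and c: "c \<in> A" and p: "p \<in> fst c" and pV: "snd c p \<in> V" and Vc: "V \<subseteq> chart_image c"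
begin

lemma case_central:
  assumes \<zeta>: "\<zeta> (snd c p) \<noteq> 0"
  shows "\<exists>I U \<gamma>1 \<gamma>2 \<epsilon> \<phi>. smooth_on I \<gamma>1 \<and> smooth_on I \<gamma>2 \<and> quadric_immersion \<epsilon> U \<phi> \<and>
    congruent_near X A F p I U (\<lambda>t u. vsnoc (\<gamma>1 t *\<^sub>R \<phi> u) (\<gamma>2 t))"
proof -
  let ?y = "snd c p" and ?f = "F \<circ> param c"
  define e :: real where "e = (if \<zeta> ?y > 0 then 1 else -1)"
  define \<epsilon> :: int where "\<epsilon> = (if \<zeta> ?y > 0 then 1 else -1)"
  have e: "e = 1 \<or> e = -1" "e * \<zeta> ?y > 0" "e = 1 \<and> \<epsilon> = 1 \<or> e = -1 \<and> \<epsilon> = -1"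
    using \<zeta> by (auto simp: e_def \<epsilon>_def)
  define q where "q = sqrt (e * \<zeta> ?y)"
  have q: "q > 0" using e by (simp add: q_def)
  \<comment> \<open>The basis that becomes standard: leaf directions, the normalised Z, and the
    direction of the line of centres.\<close>
  define b where "b i = (case i of None \<Rightarrow> \<zeta> ?y *\<^sub>R Y None ?y + \<alpha> ?y *\<^sub>R Z ?y | Some None \<Rightarrow> inverse q *\<^sub>R Z ?y
    | Some (Some l) \<Rightarrow> Y (Some l) ?y)" for i
  have b: "b (Some (Some l)) = Y (Some l) ?y" "b (Some None) = inverse q *\<^sub>R Z ?y"
    "b None = \<zeta> ?y *\<^sub>R Y None ?y + \<alpha> ?y *\<^sub>R Z ?y" for l by (simp_all add: b_def)
  have b0: "u = 0" if u: "\<forall>i. u \<bullet> b i = 0" for u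
  proof (rule spanning[OF pV])
    show uZ: "u \<bullet> Z ?y = 0" using u[THEN spec, of "Some None"] q by (simp add: b)
    have "u \<bullet> Y None ?y = 0" using u[THEN spec, of None] \<zeta> by (simp add: b inner_add_right uZ)
    then show "u \<bullet> Y a ?y = 0" for a using u[THEN spec, of "Some (Some _)"] by (cases a) (simp_all add: b)
  qed
  have "\<forall>u. (\<forall>i. u \<bullet> b i = 0) \<longrightarrow> u = 0" using b0 by blast
  from frame_to_standard[OF this] obtain L T :: "real ^ 'k option option \<Rightarrow> real ^ 'k option option" where LT: "linear L \<and> bij L \<and> linear T \<and> surj T \<and>
    (\<forall>i. T (b i) = axis i 1) \<and> (\<forall>x. L (T x) = x)" by (elim exE)
  have L: "linear L" "bij L" and T: "linear T" "surj T" "\<And>i. T (b i) = axis i 1" "\<And>x. L (T x) = x"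
    using LT by auto
  \<comment> \<open>The centre of the leaf through the base point, moved to the origin.\<close>
  define w where "w = ?f ?y + inverse (\<zeta> ?y) *\<^sub>R Z ?y"
  interpret N: normal_frame V "\<lambda>y. T (?f y - w)" E \<theta> "\<lambda>a y. T (Y a y)" "\<lambda>y. T (Z y)" \<alpha> \<beta> \<kappa> \<zeta> M C
    by (rule normal_frame_affine[OF normal_frame_axioms T(1,2)])
  have "T (Z ?y) = T (q *\<^sub>R b (Some None))" using q by (simp add: b)
  then have TZ: "T (Z ?y) = sqrt (e * \<zeta> ?y) *\<^sub>R axis (Some None) 1" by (simp only: linear_cmul[OF T(1)] T(3) q_def)
  have TX: "T (Y (Some i) ?y) = axis (Some (Some i)) 1" for i using T(3)[of "Some (Some i)"] by (simp only: b)
  have TW: "\<zeta> ?y *\<^sub>R T (Y None ?y) + \<alpha> ?y *\<^sub>R T (Z ?y) = axis None 1"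
    using T(3)[of None] by (simp only: b linear_add[OF T(1)] linear_cmul[OF T(1)])
  have Tf: "T (?f ?y - w) $ Some s = - T (Z ?y) $ Some s / \<zeta> ?y" for s
    by (simp add: w_def linear_neg[OF T(1)] linear_cmul[OF T(1)] divide_inverse)
  obtain \<Phi> g1 g2 B where B: "open B" "B \<subseteq> V" "?y \<in> B" and \<Phi>: "smooth_on B \<Phi>" "inj (frechet_derivative \<Phi> (at ?y))"
    and g: "smooth_on B g1" "smooth_on B g2" "\<And>y. y \<in> B \<Longrightarrow> g1 y > 0" "\<And>y. y \<in> B \<Longrightarrow> g2 y \<noteq> 0"
    and leaf: "\<And>y w. y \<in> B \<Longrightarrow> D \<Phi> y w $ None = 0 \<Longrightarrow> D g1 y w = 0"
      "\<And>y w. y \<in> B \<Longrightarrow> D \<Phi> y w $ None = 0 \<Longrightarrow> D g2 y w = 0"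
    and t: "\<And>y. y \<in> B \<Longrightarrow> \<Phi> y $ None = T (?f y - w) $ None"
    and pos: "\<And>y. y \<in> B \<Longrightarrow> 1 - e * (norm (\<chi> l. \<Phi> y $ Some l))\<^sup>2 > 0"
    and form: "\<And>y. y \<in> B \<Longrightarrow> T (?f y - w) = vsnoc ((- sqrt (g1 y) / g2 y) *\<^sub>R vsnoc (\<chi> l. \<Phi> y $ Some l) (sqrt (1 - e * (norm (\<chi> l. \<Phi> y $ Some l))\<^sup>2))) (T (?f y - w) $ None)"
  proof (rule N.central_form[OF pV e(2,1) TX TZ TW Tf], goal_cases)
    case (1 B \<Phi> g1 g2) show thesis by (rule that[of B \<Phi> g1 g2]; fact 1)
  qed
  have Bc: "B \<subseteq> chart_image c" using B Vc by blast
  obtain I U c' k where I: "open I" "is_interval I" "open U" "convex U" and c': "c' \<in> maximal_atlas X A" "p \<in> fst c'"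
    "chart_image c' = tube I U" and tube: "open (tube I U)" "smooth_on (tube I U) k"
    and k: "\<And>x. x \<in> tube I U \<Longrightarrow> k x \<in> B \<and> \<Phi> (k x) = x \<and> param c' x = param c (k x)"
  proof (rule adapted_chart[OF mf c p B(1) Bc B(3) \<Phi>], goal_cases)
    case (1 I U c' k) show thesis by (rule that[of I U c' k]; fact 1)
  qed
  have k': "\<And>x. x \<in> tube I U \<Longrightarrow> k x \<in> B \<and> \<Phi> (k x) = x" using k by blast
  obtain \<gamma>1 where \<gamma>1: "smooth_on I \<gamma>1" "\<And>t u. t \<in> I \<Longrightarrow> u \<in> U \<Longrightarrow> g1 (k (vsnoc u t)) = \<gamma>1 t"
  proof ((rule leaf_function[OF I(1,3,4) tube B(1) \<Phi>(1) k' g(1) leaf(1)]; (assumption)?), goal_cases)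
    case (1 \<gamma>) show thesis by (rule that[of \<gamma>]; fact 1)
  qed
  obtain \<gamma>2 where \<gamma>2: "smooth_on I \<gamma>2" "\<And>t u. t \<in> I \<Longrightarrow> u \<in> U \<Longrightarrow> g2 (k (vsnoc u t)) = \<gamma>2 t"
  proof ((rule leaf_function[OF I(1,3,4) tube B(1) \<Phi>(1) k' g(2) leaf(2)]; (assumption)?), goal_cases)
    case (1 \<gamma>) show thesis by (rule that[of \<gamma>]; fact 1)
  qed
  \<comment> \<open>A point of the product is needed to carry sign conditions on \<open>B\<close>
    over to functions of t alone or of u alone.\<close>
  have "snd c' p \<in> tube I U" using c' by (auto simp: chart_image_def)
  then obtain t0 u0 where t0: "t0 \<in> I" "u0 \<in> U" by (auto simp: tube_def)
  have inb: "vsnoc u t \<in> tube I U" if "t \<in> I" "u \<in> U" for t u using that by (auto simp: tube_def)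
  have \<gamma>1_pos: "\<gamma>1 t > 0" and \<gamma>2_nz: "\<gamma>2 t \<noteq> 0" if "t \<in> I" for t
    using g(3,4)[of "k (vsnoc u0 t)"] k'[OF inb[OF that t0(2)]] \<gamma>1(2)[OF that t0(2)] \<gamma>2(2)[OF that t0(2)] by auto
  have P: "(\<chi> l. \<Phi> (k (vsnoc u t)) $ Some l) = u" if "t \<in> I" "u \<in> U" for t u
    using k'[OF inb[OF that]] by (simp add: vec_eq_iff)
  show ?thesis
  proof (intro exI conjI)
    show "smooth_on I (\<lambda>t. - sqrt (\<gamma>1 t) / \<gamma>2 t)"
      by (intro smooth_on_divide smooth_on_minus smooth_on_sqrt I(1) \<gamma>1(1) \<gamma>2(1) \<gamma>1_pos \<gamma>2_nz)
    \<comment> \<open>The height itself is the parameter, so \<gamma>_2 is the identity.\<close>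
    show "smooth_on I (\<lambda>t. t)" by (rule smooth_on_ident[OF I(1)])
    show "quadric_immersion \<epsilon> U (\<lambda>u. vsnoc u (sqrt (1 - e * (norm u)\<^sup>2)))"
    proof (rule quadric_graph_immersion[OF I(3) _ e(3)])
      show "0 < 1 - e * (norm u)\<^sup>2" if "u \<in> U" for u
        using pos[of "k (vsnoc u t0)"] k'[OF inb[OF t0(1) that]] P[OF t0(1) that] by simp
    qed
    show "congruent_near X A F p I U (\<lambda>t u. vsnoc ((- sqrt (\<gamma>1 t) / \<gamma>2 t) *\<^sub>R vsnoc u (sqrt (1 - e * (norm u)\<^sup>2))) t)"
    proof (rule congruent_nearI[OF I(1-3) c' L])
      fix t u assume tu: "t \<in> I" "u \<in> U"
      let ?x = "vsnoc u t"
      note x = inb[OF tu]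
      have kB: "k ?x \<in> B" using k'[OF x] by blast
      have "T (?f (k ?x) - w) $ None = t" using t[OF kB] k'[OF x] by simp
      then have "T (?f (k ?x) - w) = vsnoc ((- sqrt (\<gamma>1 t) / \<gamma>2 t) *\<^sub>R vsnoc u (sqrt (1 - e * (norm u)\<^sup>2))) t"
        using form[OF kB] unfolding P[OF tu] \<gamma>1(2)[OF tu] \<gamma>2(2)[OF tu] by simp
      then have "?f (k ?x) - w = L (vsnoc ((- sqrt (\<gamma>1 t) / \<gamma>2 t) *\<^sub>R vsnoc u (sqrt (1 - e * (norm u)\<^sup>2))) t)"
        using T(4) by metis
      then show "F (param c' ?x) = L (vsnoc ((- sqrt (\<gamma>1 t) / \<gamma>2 t) *\<^sub>R vsnoc u (sqrt (1 - e * (norm u)\<^sup>2))) t) + w"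
        using k[OF x] by (simp add: algebra_simps)
    qed
  qed
qed

text \<open>Common to both parabolic cases; \<open>c1\<close> rescales X_1, by 1 / \<alpha> if
  \<alpha> is nonzero and by 1 otherwise.\<close>

lemma standard_position:
  assumes c1: "c1 \<noteq> 0"
  obtains L T :: "real ^ 'k option option \<Rightarrow> real ^ 'k option option" where "linear L" "bij L" "linear T" "surj T" "\<And>x. L (T x) = x"
    "\<And>i. T (Y (Some i) (snd c p)) = axis (Some (Some i)) 1" "T (Z (snd c p)) = axis (Some None) 1"
    "c1 *\<^sub>R T (Y None (snd c p)) = axis None 1"
proof -
  let ?y = "snd c p"
  define b where "b i = (case i of None \<Rightarrow> c1 *\<^sub>R Y None ?y | Some None \<Rightarrow> Z ?y | Some (Some l) \<Rightarrow> Y (Some l) ?y)" for i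
  have b: "b (Some (Some l)) = Y (Some l) ?y" "b (Some None) = Z ?y" "b None = c1 *\<^sub>R Y None ?y" for l
    by (simp_all add: b_def)
  have b0: "u = 0" if u: "\<forall>i. u \<bullet> b i = 0" for u
  proof (rule spanning[OF pV])
    show "u \<bullet> Z ?y = 0" using u[THEN spec, of "Some None"] by (simp add: b)
    show "u \<bullet> Y a ?y = 0" for a using u[THEN spec, of "Some (Some _)"] u[THEN spec, of None] c1 by (cases a) (simp_all add: b)
  qed
  have "\<forall>u. (\<forall>i. u \<bullet> b i = 0) \<longrightarrow> u = 0" using b0 by blast
  from frame_to_standard[OF this] obtain L T :: "real ^ 'k option option \<Rightarrow> real ^ 'k option option" where LT: "linear L \<and> bij L \<and> linear T \<and> surj T \<and>
    (\<forall>i. T (b i) = axis i 1) \<and> (\<forall>x. L (T x) = x)" by (elim exE)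
  have L: "linear L" "bij L" and T: "linear T" "surj T" "\<And>i. T (b i) = axis i 1" "\<And>x. L (T x) = x"
    using LT by auto
  have "T (Y (Some i) ?y) = axis (Some (Some i)) 1" for i using T(3)[of "Some (Some i)"] by (simp only: b)
  moreover have "T (Z ?y) = axis (Some None) 1" using T(3)[of "Some None"] by (simp only: b)
  moreover have "c1 *\<^sub>R T (Y None ?y) = axis None 1" using T(3)[of None] by (simp only: b linear_cmul[OF T(1)])
  ultimately show thesis using that[OF L T(1,2,4)] by blast
qed

text \<open>The scale is assumed here to be a function of the coordinate t, either t itself or the
  constant 1, so that only \<open>q\<close> has to be turned into a function of t.\<close>

lemma parabolic_chart:
  fixes L T :: "real ^ 'k option option \<Rightarrow> real ^ 'k option option"
  assumes L: "linear L" "bij L" "\<And>x. L (T x) = x"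
    and \<Phi>: "smooth_on V \<Phi>" "inj (frechet_derivative \<Phi> (at (snd c p)))" and q: "smooth_on V q"
    and leaf: "\<And>y w. y \<in> V \<Longrightarrow> D \<Phi> y w $ None = 0 \<Longrightarrow> D q y w = (0::real)"
    and t: "\<And>y. y \<in> V \<Longrightarrow> \<Phi> y $ None = T ((F \<circ> param c) y - w) $ None"
    and form: "\<And>y. y \<in> V \<Longrightarrow> T ((F \<circ> param c) y - w) = vsnoc (vsnoc (\<tau> (\<Phi> y $ None) *\<^sub>R (\<chi> l. \<Phi> y $ Some l))
      (\<tau> (\<Phi> y $ None) * (norm (\<chi> l. \<Phi> y $ Some l))\<^sup>2 / 2 + q y)) (T ((F \<circ> param c) y - w) $ None)"
  shows "\<exists>I U \<gamma>. open I \<and> smooth_on I \<gamma> \<and>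
    congruent_near X A F p I U (\<lambda>t u. vsnoc (vsnoc (\<tau> t *\<^sub>R u) (\<tau> t * (norm u)\<^sup>2 / 2 + \<gamma> t)) t)"
proof -
  let ?f = "F \<circ> param c"
  obtain I U c' k where I: "open I" "is_interval I" "open U" "convex U" and c': "c' \<in> maximal_atlas X A" "p \<in> fst c'"
    "chart_image c' = tube I U" and tube: "open (tube I U)" "smooth_on (tube I U) k"
    and k: "\<And>x. x \<in> tube I U \<Longrightarrow> k x \<in> V \<and> \<Phi> (k x) = x \<and> param c' x = param c (k x)"
  proof (rule adapted_chart[OF mf c p open_V Vc pV \<Phi>], goal_cases)
    case (1 I U c' k) show thesis by (rule that[of I U c' k]; fact 1)
  qed
  have k': "\<And>x. x \<in> tube I U \<Longrightarrow> k x \<in> V \<and> \<Phi> (k x) = x" using k by blast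
  obtain \<gamma> where \<gamma>: "smooth_on I \<gamma>" "\<And>t u. t \<in> I \<Longrightarrow> u \<in> U \<Longrightarrow> q (k (vsnoc u t)) = \<gamma> t"
  proof ((rule leaf_function[OF I(1,3,4) tube open_V \<Phi>(1) k' q leaf]; (assumption)?), goal_cases)
    case (1 \<gamma>) show thesis by (rule that[of \<gamma>]; fact 1)
  qed
  have "congruent_near X A F p I U (\<lambda>t u. vsnoc (vsnoc (\<tau> t *\<^sub>R u) (\<tau> t * (norm u)\<^sup>2 / 2 + \<gamma> t)) t)"
  proof (rule congruent_nearI[OF I(1-3) c' L(1,2)])
    fix t u assume tu: "t \<in> I" "u \<in> U"
    let ?x = "vsnoc u t"
    have x: "?x \<in> tube I U" using tu by (auto simp: tube_def)
    have kV: "k ?x \<in> V" and \<Phi>k: "\<Phi> (k ?x) = ?x" using k'[OF x] by auto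
    have P: "(\<chi> l. ?x $ Some l) = u" by (simp add: vec_eq_iff)
    have "T (?f (k ?x) - w) = vsnoc (vsnoc (\<tau> t *\<^sub>R u) (\<tau> t * (norm u)\<^sup>2 / 2 + \<gamma> t)) t"
      using form[OF kV] t[OF kV] unfolding \<Phi>k P \<gamma>(2)[OF tu] by simp
    then have "?f (k ?x) - w = L (vsnoc (vsnoc (\<tau> t *\<^sub>R u) (\<tau> t * (norm u)\<^sup>2 / 2 + \<gamma> t)) t)"
      using L(3) by metis
    then show "F (param c' ?x) = L (vsnoc (vsnoc (\<tau> t *\<^sub>R u) (\<tau> t * (norm u)\<^sup>2 / 2 + \<gamma> t)) t) + w"
      using k[OF x] by (simp add: algebra_simps)
  qed
  then show ?thesis using I(1) \<gamma>(1) by blast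
qed

lemma case_moving:
  assumes \<zeta>: "\<zeta> (snd c p) = 0" and \<alpha>: "\<alpha> (snd c p) \<noteq> 0"
  shows "\<exists>I U \<gamma>1 \<gamma>2. smooth_on I \<gamma>1 \<and> smooth_on I \<gamma>2 \<and>
    congruent_near X A F p I U (\<lambda>t u. vsnoc (vsnoc (\<gamma>1 t *\<^sub>R u) (\<gamma>1 t * (norm u)\<^sup>2 / 2 + \<gamma>2 t)) (\<gamma>1 t))"
proof -
  let ?y = "snd c p" and ?f = "F \<circ> param c"
  have z: "\<zeta> y = 0" if "y \<in> V" for y by (rule zeta_zero[OF pV \<zeta> that])
  obtain L T :: "real ^ 'k option option \<Rightarrow> real ^ 'k option option" where L: "linear L" "bij L" "\<And>x. L (T x) = x" and T: "linear T" "surj T"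
    and i: "\<And>i. T (Y (Some i) ?y) = axis (Some (Some i)) 1" "T (Z ?y) = axis (Some None) 1"
      "inverse (\<alpha> ?y) *\<^sub>R T (Y None ?y) = axis None 1"
    using standard_position[of "inverse (\<alpha> ?y)"] \<alpha> by (metis inverse_zero_imp_zero)
  \<comment> \<open>The point f - X_1 / \<alpha> at the base point becomes the origin, which puts
    \<open>f\<close> itself at height 1.\<close>
  define w where "w = ?f ?y - inverse (\<alpha> ?y) *\<^sub>R Y None ?y"
  interpret N: normal_frame V "\<lambda>y. T (?f y - w)" E \<theta> "\<lambda>a y. T (Y a y)" "\<lambda>y. T (Z y)" \<alpha> \<beta> \<kappa> \<zeta> M C
    by (rule normal_frame_affine[OF normal_frame_axioms T])
  have i3: "T (Y None ?y) = \<alpha> ?y *\<^sub>R axis None 1" using \<alpha> unfolding i(3)[symmetric] by simp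
  have i4: "T (?f ?y - w) = axis None 1" using i(3) by (simp add: w_def linear_cmul[OF T(1)])
  note mv = N.parabolic_form_moving[OF pV z \<alpha> i(1,2) i3 i4]
  have \<tau>: "smooth_on V (\<lambda>y. T (?f y - w) $ None)" by (rule smooth_on_vec_nth[OF open_V N.smooth_f])
  have l0: "T (?f ?y - w) $ Some (Some l) = 0" "T (?f ?y - w) $ None = 1" for l unfolding i4 by (simp_all add: axis_def)
  obtain \<Phi> q where "smooth_on V \<Phi>" "inj (frechet_derivative \<Phi> (at ?y))" "smooth_on V q"
    "\<And>y w. y \<in> V \<Longrightarrow> D \<Phi> y w $ None = 0 \<Longrightarrow> D q y w = (0::real)"
    and t: "\<And>y. y \<in> V \<Longrightarrow> \<Phi> y $ None = T (?f y - w) $ None"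
    and form: "\<And>y. y \<in> V \<Longrightarrow> T (?f y - w) = vsnoc (vsnoc (T (?f y - w) $ None *\<^sub>R (\<chi> l. \<Phi> y $ Some l))
      (T (?f y - w) $ None * (norm (\<chi> l. \<Phi> y $ Some l))\<^sup>2 / 2 + q y)) (T (?f y - w) $ None)"
  proof ((rule N.parabolic_form[OF pV z i(1,2) l0(1) \<tau> mv(1-3) l0(2) mv(4)]; (assumption)?), goal_cases)
    case (1 \<Phi> q) show thesis by (rule that[of \<Phi> q]; fact 1)
  qed
  \<comment> \<open>The height is both the scale and the coordinate t; hence \<gamma>_1 is the
    identity.\<close>
  note pc = parabolic_chart[OF L this(1-4) t, where \<tau> = "\<lambda>t. t"]
  have "\<exists>I U \<gamma>. open I \<and> smooth_on I \<gamma> \<and>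
    congruent_near X A F p I U (\<lambda>t u. vsnoc (vsnoc (t *\<^sub>R u) (t * (norm u)\<^sup>2 / 2 + \<gamma> t)) t)"
  proof (rule pc)
    fix y assume y: "y \<in> V"
    show "T (?f y - w) = vsnoc (vsnoc (\<Phi> y $ None *\<^sub>R (\<chi> l. \<Phi> y $ Some l))
      (\<Phi> y $ None * (norm (\<chi> l. \<Phi> y $ Some l))\<^sup>2 / 2 + q y)) (T (?f y - w) $ None)"
      unfolding t[OF y] by (rule form[OF y])
  qed
  then show ?thesis using smooth_on_ident by blast
qed

lemma case_translation:
  assumes \<zeta>: "\<zeta> (snd c p) = 0" and \<alpha>: "\<alpha> (snd c p) = 0"
  shows "\<exists>I U \<gamma>1 \<gamma>2. smooth_on I \<gamma>1 \<and> smooth_on I \<gamma>2 \<and>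
    congruent_near X A F p I U (\<lambda>t u. vsnoc (vsnoc u ((norm u)\<^sup>2 / 2 + \<gamma>2 t)) (\<gamma>1 t))"
proof -
  let ?y = "snd c p" and ?f = "F \<circ> param c"
  have z: "\<zeta> y = 0" if "y \<in> V" for y by (rule zeta_zero[OF pV \<zeta> that])
  have al: "\<alpha> y = 0" if "y \<in> V" for y by (rule alpha_zero[OF z pV \<alpha> that])
  obtain L T :: "real ^ 'k option option \<Rightarrow> real ^ 'k option option" where L: "linear L" "bij L" "\<And>x. L (T x) = x" and T: "linear T" "surj T"
    and i: "\<And>i. T (Y (Some i) ?y) = axis (Some (Some i)) 1" "T (Z ?y) = axis (Some None) 1"
      "1 *\<^sub>R T (Y None ?y) = axis None 1"
    using standard_position[of 1] zero_neq_one by metis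
  define w where "w = ?f ?y"
  interpret N: normal_frame V "\<lambda>y. T (?f y - w)" E \<theta> "\<lambda>a y. T (Y a y)" "\<lambda>y. T (Z y)" \<alpha> \<beta> \<kappa> \<zeta> M C
    by (rule normal_frame_affine[OF normal_frame_axioms T])
  have l0: "T (?f ?y - w) $ Some (Some l) = 0" for l by (simp add: w_def linear_0[OF T(1)])
  have one: "(1::real) \<noteq> 0" "D (\<lambda>_. 1::real) y (E (Some i) y) = 0" "D (\<lambda>_. 1::real) y (E None y) = \<alpha> y * 1"
    if "y \<in> V" for y i by (simp_all add: al that)
  have X0: "T (Y None y) $ Some (Some l) = \<alpha> y * T (?f y - w) $ Some (Some l)" if "y \<in> V" for y l
    using N.parabolic_form_translation[OF pV z al i(2) _ that, of l] i(3) al[OF that] by simp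
  obtain \<Phi> q where "smooth_on V \<Phi>" "inj (frechet_derivative \<Phi> (at ?y))" "smooth_on V q"
    "\<And>y w. y \<in> V \<Longrightarrow> D \<Phi> y w $ None = 0 \<Longrightarrow> D q y w = (0::real)"
    and t: "\<And>y. y \<in> V \<Longrightarrow> \<Phi> y $ None = T (?f y - w) $ None"
    and form: "\<And>y. y \<in> V \<Longrightarrow> T (?f y - w) = vsnoc (vsnoc (1 *\<^sub>R (\<chi> l. \<Phi> y $ Some l))
      (1 * (norm (\<chi> l. \<Phi> y $ Some l))\<^sup>2 / 2 + q y)) (T (?f y - w) $ None)"
  proof ((rule N.parabolic_form[OF pV z i(1,2) l0 smooth_on_const[of V "1::real"] one refl X0]; (assumption)?), goal_cases)
    case (1 \<Phi> q) show thesis by (rule that[of \<Phi> q]; fact 1)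
  qed
  then have "\<exists>I U \<gamma>. open I \<and> smooth_on I \<gamma> \<and>
    congruent_near X A F p I U (\<lambda>t u. vsnoc (vsnoc (1 *\<^sub>R u) (1 * (norm u)\<^sup>2 / 2 + \<gamma> t)) t)"
    by (intro parabolic_chart[OF L, where \<tau> = "\<lambda>_. 1"])
  then show ?thesis using smooth_on_ident by (simp only: scaleR_one mult_1) blast
qed

end

theorem theorem3p1:
  fixes X :: "'m topology"
    and A :: "('m, 'k::finite option) chart set"
    and F \<xi> :: "'m \<Rightarrow> real ^ 'k option option"
    and \<Gamma> :: "('m, 'k option) chart \<Rightarrow>
      real ^ 'k option \<Rightarrow> real ^ 'k option \<Rightarrow> real ^ 'k option \<Rightarrow> real ^ 'k option"
    and a b r \<sigma> \<zeta> :: "'m \<Rightarrow> real"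
  assumes dim: "CARD('k option) \<ge> 3"
    and manifold: "smooth_manifold X A" and connected: "connected_space X"
    and hypersurface: "immersed_hypersurface A F"
    and convex: "strictly_locally_convex A F"
    and normal: "affine_normal A F \<xi>"
    and levi_civita: "levi_civita A F \<xi> \<Gamma>"
    and symmetry: "pointwise_SO_symmetry A F \<xi> \<Gamma>"
    and assoc: "associated_functions A F \<xi> \<Gamma> a b r \<sigma>"
    and zeta: "\<And>p. \<zeta> p = b p - (r p)\<^sup>2 + (\<sigma> p)\<^sup>2"
  shows "\<forall>p\<in>topspace X.
    (\<zeta> p \<noteq> 0 \<longrightarrow>
      (\<exists>I U \<gamma>1 \<gamma>2 \<epsilon> \<phi>. smooth_on I \<gamma>1 \<and> smooth_on I \<gamma>2 \<and> quadric_immersion \<epsilon> U \<phi> \<and>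
        congruent_near X A F p I U (\<lambda>t u. vsnoc (\<gamma>1 t *\<^sub>R \<phi> u) (\<gamma>2 t)))) \<and>
    (\<zeta> p = 0 \<and> \<sigma> p \<noteq> r p \<longrightarrow>
      (\<exists>I U \<gamma>1 \<gamma>2. smooth_on I \<gamma>1 \<and> smooth_on I \<gamma>2 \<and>
        congruent_near X A F p I U
          (\<lambda>t u. vsnoc (vsnoc (\<gamma>1 t *\<^sub>R u) (\<gamma>1 t * (norm u)\<^sup>2 / 2 + \<gamma>2 t)) (\<gamma>1 t)))) \<and>
    (\<zeta> p = 0 \<and> \<sigma> p = r p \<longrightarrow>
      (\<exists>I U \<gamma>1 \<gamma>2. smooth_on I \<gamma>1 \<and> smooth_on I \<gamma>2 \<and>
        congruent_near X A F p I U
          (\<lambda>t u. vsnoc (vsnoc u ((norm u)\<^sup>2 / 2 + \<gamma>2 t)) (\<gamma>1 t))))"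
proof
  fix p assume "p \<in> topspace X"
  then have "p \<in> (\<Union>c\<in>A. fst c)" using manifold by (simp add: smooth_manifold_def)
  then obtain c where c: "c \<in> A" and p: "p \<in> fst c" by blast
  have ch: "is_chart X c" using manifold c by (simp add: smooth_manifold_def)
  let ?U = "chart_image c" and ?f = "F \<circ> param c" and ?x = "\<xi> \<circ> param c" and ?y = "snd c p"
  have par: "param c ?y = p" by (rule param_chart[OF ch p])
  interpret H: affine_hypersurface ?U ?f ?x
    using ch hypersurface normal c unfolding is_chart_def immersed_hypersurface_def affine_normal_def
    by unfold_locales auto
  have LC: "levi_civita_on ?U H.h (\<Gamma> c)" using levi_civita c unfolding levi_civita_def by blast
  have sm: "smooth_on ?U (a \<circ> param c)" "smooth_on ?U (b \<circ> param c)" "smooth_on ?U (r \<circ> param c)"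
    using assoc c unfolding associated_functions_def smooth_map_def by auto
  note frames = bspec[OF assoc[unfolded associated_functions_def, THEN conjunct2, THEN conjunct2, THEN conjunct2] c]
  have rp: "r m > 0" if "m \<in> fst c" for m using bspec[OF frames that] by (rule conjunct1)
  from bspec[OF frames p, THEN conjunct2] obtain V and E :: "'k option \<Rightarrow> real ^ 'k option \<Rightarrow> real ^ 'k option" where V: "open V" "?y \<in> V" "V \<subseteq> ?U" and sE: "\<forall>i. smooth_on V (E i)"
    and fr: "\<forall>y\<in>V.
          let h = H.h y;
              S = shape_op ?f ?x y;
              K = difference_tensor ?f ?x (\<Gamma> c) y;
              q = param c y
          in (\<forall>i j. h (E i y) (E j y) = (if i = j then 1 else 0)) \<and>
            S (E None y) = a q *\<^sub>R E None y \<and>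
            (\<forall>i. S (E (Some i) y) = b q *\<^sub>R E (Some i) y) \<and>
            K (E None y) (E None y) = (real CARD('k) * r q) *\<^sub>R E None y \<and>
            (\<forall>i. K (E None y) (E (Some i) y) = - r q *\<^sub>R E (Some i) y) \<and>
            (\<forall>i j. K (E (Some i) y) (E (Some j) y) =
              (if i = j then - r q *\<^sub>R E None y else 0)) \<and>
            (\<forall>i. cov_deriv (\<Gamma> c) (E (Some i)) (E None) y = \<sigma> q *\<^sub>R E (Some i) y)"
    by (elim exE conjE) (rule that)
  interpret S: symmetric_hypersurface ?U ?f ?x V E "\<Gamma> c" "a \<circ> param c" "b \<circ> param c" "r \<circ> param c" "\<sigma> \<circ> param c"
  proof
    show "open V" "V \<subseteq> ?U" "levi_civita_on ?U H.h (\<Gamma> c)" "\<And>i. smooth_on V (E i)" by (rule V LC sE[THEN spec])+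
    show "2 \<le> CARD('k)" using dim by simp
    show "smooth_on V (a \<circ> param c)" "smooth_on V (b \<circ> param c)" "smooth_on V (r \<circ> param c)"
      using smooth_on_subset[OF _ V(3)] sm by auto
    fix y assume y: "y \<in> V"
    note f = bspec[OF fr y, unfolded Let_def]
    show "H.h y (E i y) (E j y) = (if i = j then 1 else 0)" for i j using f by blast
    show "0 < (r \<circ> param c) y" using rp[OF chart_param(1)] y V(3) by auto
    show "shape_op ?f ?x y (E None y) = (a \<circ> param c) y *\<^sub>R E None y"
      "shape_op ?f ?x y (E (Some i) y) = (b \<circ> param c) y *\<^sub>R E (Some i) y"
      "difference_tensor ?f ?x (\<Gamma> c) y (E None y) (E None y) = (real CARD('k) * (r \<circ> param c) y) *\<^sub>R E None y"
      "difference_tensor ?f ?x (\<Gamma> c) y (E None y) (E (Some i) y) = - (r \<circ> param c) y *\<^sub>R E (Some i) y"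
      "difference_tensor ?f ?x (\<Gamma> c) y (E (Some i) y) (E (Some j) y) = (if i = j then - (r \<circ> param c) y *\<^sub>R E None y else 0)"
      "cov_deriv (\<Gamma> c) (E (Some i)) (E None) y = (\<sigma> \<circ> param c) y *\<^sub>R E (Some i) y" for i j
      using f by (simp_all only: o_def)
    then show "difference_tensor ?f ?x (\<Gamma> c) y (E (Some i) y) (E None y) = - (r \<circ> param c) y *\<^sub>R E (Some i) y" for i
      using H.difference_tensor_sym[OF LC, of y "E (Some i) y" "E None y"] y V(3) by auto
  qed
  obtain d where d: "d > 0" "ball ?y d \<subseteq> V" using V(1,2) open_contains_ball by blast
  interpret N: normal_frame "ball ?y d" ?f E "\<lambda>a y v. S.coframe a y \<bullet> D ?f y v" S.X
    "\<lambda>y. ?x y - S.\<beta> y *\<^sub>R S.X None y" S.\<alpha> S.\<beta> "\<lambda>y. CARD('k) * (r \<circ> param c) y + S.\<beta> y"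
    "\<lambda>y. (b \<circ> param c) y + S.\<alpha> y * S.\<beta> y" "\<lambda>i j. S.conn None (Some i) (Some j)"
    "\<lambda>i j m. S.conn (Some i) (Some j) (Some m)"
    by (rule S.normal_frame_ball[OF d(2)])
  interpret C: chart_frame "ball ?y d" F c E "\<lambda>a y v. S.coframe a y \<bullet> D ?f y v" S.X
    "\<lambda>y. ?x y - S.\<beta> y *\<^sub>R S.X None y" S.\<alpha> S.\<beta> "\<lambda>y. CARD('k) * (r \<circ> param c) y + S.\<beta> y"
    "\<lambda>y. (b \<circ> param c) y + S.\<alpha> y * S.\<beta> y" "\<lambda>i j. S.conn None (Some i) (Some j)"
    "\<lambda>i j m. S.conn (Some i) (Some j) (Some m)" X A p
    by unfold_locales (use manifold c p d V(3) in auto)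
  have \<zeta>: "(b \<circ> param c) ?y + S.\<alpha> ?y * S.\<beta> ?y = \<zeta> p"
    by (simp add: par zeta S.\<alpha>_def S.\<beta>_def algebra_simps power2_eq_square)
  have \<alpha>: "S.\<alpha> ?y = \<sigma> p - r p" by (simp add: par S.\<alpha>_def)
  note cases = C.case_central[unfolded \<zeta>] C.case_moving[unfolded \<zeta>, unfolded \<alpha>] C.case_translation[unfolded \<zeta>, unfolded \<alpha>]
  show "(\<zeta> p \<noteq> 0 \<longrightarrow>
      (\<exists>I U \<gamma>1 \<gamma>2 \<epsilon> \<phi>. smooth_on I \<gamma>1 \<and> smooth_on I \<gamma>2 \<and> quadric_immersion \<epsilon> U \<phi> \<and>
        congruent_near X A F p I U (\<lambda>t u. vsnoc (\<gamma>1 t *\<^sub>R \<phi> u) (\<gamma>2 t)))) \<and>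
    (\<zeta> p = 0 \<and> \<sigma> p \<noteq> r p \<longrightarrow>
      (\<exists>I U \<gamma>1 \<gamma>2. smooth_on I \<gamma>1 \<and> smooth_on I \<gamma>2 \<and>
        congruent_near X A F p I U
          (\<lambda>t u. vsnoc (vsnoc (\<gamma>1 t *\<^sub>R u) (\<gamma>1 t * (norm u)\<^sup>2 / 2 + \<gamma>2 t)) (\<gamma>1 t)))) \<and>
    (\<zeta> p = 0 \<and> \<sigma> p = r p \<longrightarrow>
      (\<exists>I U \<gamma>1 \<gamma>2. smooth_on I \<gamma>1 \<and> smooth_on I \<gamma>2 \<and>
        congruent_near X A F p I U
          (\<lambda>t u. vsnoc (vsnoc u ((norm u)\<^sup>2 / 2 + \<gamma>2 t)) (\<gamma>1 t))))"
    using cases by (intro conjI impI) auto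
qed

end
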